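(* Let $d\geq 1$ and let $\mathscr{A}\subseteq (0,1)^{d}$ be an analytic set. The following are equivalent: (i) $\mathscr{A}$ is contained in an $F_{\sigma}$, purely unrectifiable subset of $\mathbb{R}^d$; (ii) a typical $f\in\operatorname{Lip}_{1}([0,1]^{d})$ is nowhere differentiable in $\mathscr{A}$, i.e. the set of $f\in\operatorname{Lip}_1([0,1]^d)$ which are not differentiable at any point of $\mathscr{A}$ is residual in $\operatorname{Lip}_1([0,1]^d)$.
   Context: $\operatorname{Lip}_{1}([0,1]^{d})$ denotes the set of all functions $f\colon[0,1]^d\to\mathbb{R}$ with Lipschitz constant at most $1$, viewed as a complete metric space with the supremum metric. A property holds for a typical $f\in\operatorname{Lip}_1([0,1]^d)$ if the set of $f$ with this property is residual (its complement is meagre). A Lipschitz curve is a Lipschitz map $\gamma\colon I\to\mathbb{R}^d$, $I\subseteq\mathbb{R}$ a closed interval, whose derivative is bounded away from zero in norm almost everywhere. A set $P\subseteq\mathbb{R}^d$ is purely unrectifiable if for every Lipschitz curve $\gamma\colon[0,1]\to\mathbb{R}^d$ the set $\gamma^{-1}(P)$ has Lebesgue measure zero. *)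

theory Defs
  imports "HOL-Analysis.Analysis"
begin

text \<open>Analytic subsets of a Euclidean space: empty, or a continuous image of the
  Baire space \<open>\<nat>\<^sup>\<nat>\<close> (type \<open>nat \<Rightarrow> nat\<close> with the product topology of discrete \<open>nat\<close>).\<close>
definition analytic_set :: "'a::euclidean_space set \<Rightarrow> bool" where
  "analytic_set A \<longleftrightarrow> A = {} \<or>
     (\<exists>g :: (nat \<Rightarrow> nat) \<Rightarrow> 'a. continuous_on UNIV g \<and> range g = A)"

definition lipschitz_curve_on :: "real set \<Rightarrow> (real \<Rightarrow> 'a::euclidean_space) \<Rightarrow> bool" where
  "lipschitz_curve_on I \<gamma> \<longleftrightarrow>
     (\<exists>L. L-lipschitz_on I \<gamma>) \<and>
     (\<exists>c>0. AE t in lebesgue_on I.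
        \<exists>v. (\<gamma> has_vector_derivative v) (at t within I) \<and> c \<le> norm v)"

definition purely_unrectifiable :: "'a::euclidean_space set \<Rightarrow> bool" where
  "purely_unrectifiable P \<longleftrightarrow>
     (\<forall>\<gamma> :: real \<Rightarrow> 'a. lipschitz_curve_on {0..1} \<gamma> \<longrightarrow>
        {t \<in> {0..1}. \<gamma> t \<in> P} \<in> null_sets lebesgue)"

text \<open>The space \<open>Lip\<^sub>1([0,1]^d)\<close> with the supremum metric. Functions are represented
  extensionally on the cube \<open>cbox 0 One = [0,1]^d\<close>.\<close>
definition Lip1_metric :: "('a::euclidean_space \<Rightarrow> real) metric" where
  "Lip1_metric = submetric (funspace (cbox 0 One) (euclidean_metric :: real metric))
                           {f. 1-lipschitz_on (cbox 0 One) f}"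

definition Lip1_topology :: "('a::euclidean_space \<Rightarrow> real) topology" where
  "Lip1_topology = mtopology_of Lip1_metric"

definition nowhere_dense_in :: "'a topology \<Rightarrow> 'a set \<Rightarrow> bool" where
  "nowhere_dense_in X S \<longleftrightarrow> S \<subseteq> topspace X \<and> X interior_of (X closure_of S) = {}"

definition meagre_in :: "'a topology \<Rightarrow> 'a set \<Rightarrow> bool" where
  "meagre_in X S \<longleftrightarrow> (countable union_of nowhere_dense_in X) S"

definition residual_in :: "'a topology \<Rightarrow> 'a set \<Rightarrow> bool" where
  "residual_in X S \<longleftrightarrow> S \<subseteq> topspace X \<and> meagre_in X (topspace X - S)"

end

theory Submission
  imports Defs "HOL-Complex_Analysis.Great_Picard"
begin

text \<open>
  Suppose first that \<open>A\<close> lies in a countable union of compact purely unrectifiable sets \<open>K\<close>, and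
  fix a direction \<open>e\<close>. By Arzela--Ascoli, some neighbourhood of \<open>K\<close> is met in arbitrarily small
  length by every curve that is a Lipschitz graph over the line \<open>\<real>e\<close>. Maximising this length over
  graphs ending at a point produces a small potential \<open>g\<close> which grows at unit speed along \<open>e\<close> near
  \<open>K\<close> and is almost constant across \<open>e\<close>. Precomposition with \<open>x \<mapsto> x - g x e\<close> hardly moves a
  function or its Lipschitz constant but makes it constant along \<open>e\<close> near \<open>K\<close>; so a typical
  function can only have derivative 0 at points of \<open>K\<close>. On the other hand a typical function has,
  at every point, difference quotients above 1/2 at arbitrarily small scales.

  Conversely, let \<open>A\<close> be analytic and not so covered. Sets which are covered by \<open>F\<^sub>\<sigma>\<close> sets null on
  all curves with tangents near \<open>e\<close> form \<open>\<sigma>\<close>-ideals, and a piece of \<open>A\<close> outside such an ideal stays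
  outside an ideal for a narrower cone of directions. In the Banach--Mazur game we keep a piece of
  \<open>A\<close>, a direction \<open>e\<close> and a function that is affine with gradient \<open>e\<close> near that piece, whose closure
  fills most of a short curve in direction \<open>e\<close>. Any 1-Lipschitz answer close enough to this function
  grows at almost maximal speed along the curve, so by the weak maximal inequality at all smaller
  scales at some point of the closure, and for 1-Lipschitz functions this controls all directions.
  The limit is differentiable at a point of \<open>A\<close>.
\<close>

section \<open>Vitali coverings on the line\<close>

text \<open>Two obstacles shape the game. A piece of \<open>A\<close> need not be measurable, so its
  length on a curve has no meaning. Its kernel is closed, and a kernel null on all curves of the
  cone would itself be an admissible F_sigma cover. Hence the good point is sought in the kernel,
  possibly outside \<open>A\<close>, and the parametrisation by the Baire space brings the limit
  back: each move fixes one more entry of a code. The second obstacle is scale. A stage is exactly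
  affine only below some radius, and the next perturbation destroys this at much smaller distances.
  So every stage must control all distances from its own \<open>scale\<close> down to the next one,
  with relative error \<open>err n\<close>. The constants come from one balance: a slope deficit
  1/N^2 along a segment of length N |w| costs |w|/N, and the detour caused by w costs |w|/(2 N).
  With N = 2^n this makes the errors of order 2^-n and the cone widths \<open>tol n\<close> of order
  4^-n.\<close>

lemma disjoint_intervals_ordered:
  fixes c c' r r' :: real
  assumes "disjnt (cball c r) (cball c' r')" "c' \<le> c" "0 < r" "0 < r'"
  shows "c' + r' < c - r"
proof (rule ccontr)
  assume "\<not> c' + r' < c - r"
  then have "max (c - r) c' \<in> cball c r \<inter> cball c' r'"
    using assms by (auto simp: dist_real_def)
  then show False using assms(1) by (auto simp: disjnt_def)
qed

text \<open>Once the interval with the largest centre is removed, the others lie left of it; so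
  \<open>b\<close> stays arbitrary in the induction and becomes \<open>c i - r i\<close>.\<close>

lemma sum_increments_le:
  fixes F :: "real \<Rightarrow> real"
  assumes "finite C" "mono_on {a..b} F" "a \<le> b"
    and "\<And>i. i \<in> C \<Longrightarrow> a \<le> c i - r i \<and> c i + r i \<le> b \<and> 0 < r i"
    and "pairwise (\<lambda>i j. disjnt (cball (c i) (r i)) (cball (c j) (r j))) C"
  shows "(\<Sum>i\<in>C. F (c i + r i) - F (c i - r i)) \<le> F b - F a"
  using assms
proof (induction C arbitrary: b rule: finite_ranking_induct[where f = c])
  case empty
  then show ?case by (simp add: mono_on_def)
next
  case (insert i C)
  have i: "a \<le> c i - r i" "c i + r i \<le> b" "0 < r i" using insert.prems(3)[of i] by auto
  show ?case
  proof (cases "i \<in> C")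
    case True
    then show ?thesis using insert by (simp add: insert_absorb)
  next
    case False
    have "c j + r j < c i - r i" if "j \<in> C" for j
    proof (rule disjoint_intervals_ordered)
      show "disjnt (cball (c i) (r i)) (cball (c j) (r j))"
        by (rule pairwiseD[OF insert.prems(4)]) (use that False in auto)
      show "c j \<le> c i" "0 < r i" "0 < r j"
        using insert.hyps(2)[OF that] insert.prems(3)[of j] that i by simp_all
    qed
    then have "(\<Sum>i\<in>C. F (c i + r i) - F (c i - r i)) \<le> F (c i - r i) - F a"
    proof (intro insert.IH)
      show "mono_on {a..c i - r i} F"
        using insert.prems(1) by (rule mono_on_subset) (use i in auto)
      show "pairwise (\<lambda>i j. disjnt (cball (c i) (r i)) (cball (c j) (r j))) C"
        using insert.prems(4) by (rule pairwise_subset) auto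
      show "a \<le> c j - r j \<and> c j + r j \<le> c i - r i \<and> 0 < r j"
        if "j \<in> C" "\<And>j. j \<in> C \<Longrightarrow> c j + r j < c i - r i" for j
        using insert.prems(3)[of j] that by (auto simp: less_imp_le)
    qed (use i in auto)
    moreover have "F (c i + r i) \<le> F b"
      by (rule mono_onD[OF insert.prems(1)]) (use i in auto)
    ultimately show ?thesis
      using False insert.hyps by simp
  qed
qed

lemma measure_real_cball: "0 \<le> r \<Longrightarrow> measure lebesgue (cball (c::real) r) = 2 * r"
  by (simp add: cball_eq_atLeastAtMost)

text \<open>The factor \<open>k\<close> serves both covering results: \<open>k = 1\<close> when
  disjoint intervals already cover almost everything, \<open>k = 5\<close> when they cover only
  after enlargement. Disjointness bounds the increments of \<open>F\<close>; the enlarged intervals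
  may overlap.\<close>

lemma measure_Union_steep_intervals:
  fixes F :: "real \<Rightarrow> real"
  assumes "countable C" and F: "mono_on {a..b} F" "a \<le> b" and "0 < v" "0 \<le> k"
    and C: "\<And>i. i \<in> C \<Longrightarrow> a \<le> c i - r i \<and> c i + r i \<le> b \<and> 0 < r i \<and>
                 v * (2 * r i) \<le> F (c i + r i) - F (c i - r i)"
    and "pairwise (\<lambda>i j. disjnt (cball (c i) (r i)) (cball (c j) (r j))) C"
  shows "(\<Union>i\<in>C. cball (c i) (k * r i)) \<in> lmeasurable"
    and "v * measure lebesgue (\<Union>i\<in>C. cball (c i) (k * r i)) \<le> k * (F b - F a)"
proof -
  have *: "measure lebesgue (\<Union>i\<in>D. cball (c i) (k * r i)) \<le> k * (F b - F a) / v"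
    if D: "D \<subseteq> C" "finite D" for D
  proof -
    have "measure lebesgue (\<Union>i\<in>D. cball (c i) (k * r i)) \<le> (\<Sum>i\<in>D. measure lebesgue (cball (c i) (k * r i)))"
      using D by (intro measure_UNION_le) auto
    also have "\<dots> = (\<Sum>i\<in>D. k * (2 * r i))"
      using D C \<open>0 \<le> k\<close> by (intro sum.cong refl) (subst measure_real_cball; force)
    also have "\<dots> \<le> (\<Sum>i\<in>D. k * ((F (c i + r i) - F (c i - r i)) / v))"
      using D C \<open>0 < v\<close> \<open>0 \<le> k\<close>
      by (intro sum_mono mult_left_mono) (auto simp: field_simps)
    also have "\<dots> = k / v * (\<Sum>i\<in>D. F (c i + r i) - F (c i - r i))"
      by (simp add: sum_distrib_left)
    also have "\<dots> \<le> k / v * (F b - F a)"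
      using assms D by (intro mult_left_mono sum_increments_le) (auto intro: pairwise_subset)
    finally show ?thesis by simp
  qed
  show "(\<Union>i\<in>C. cball (c i) (k * r i)) \<in> lmeasurable"
    by (rule fmeasurable_UN_bound[OF \<open>countable C\<close> _ *]) auto
  have "measure lebesgue (\<Union>i\<in>C. cball (c i) (k * r i)) \<le> k * (F b - F a) / v"
    by (rule measure_UN_bound[OF \<open>countable C\<close> _ *]) auto
  then show "v * measure lebesgue (\<Union>i\<in>C. cball (c i) (k * r i)) \<le> k * (F b - F a)"
    using \<open>0 < v\<close> by (simp add: field_simps)
qed

lemma measure_le_negligible_Diff:
  assumes "E \<in> lmeasurable" "M \<in> lmeasurable" "negligible (E - M)"
  shows "measure lebesgue E \<le> measure lebesgue M"
proof -
  have N: "E - M \<in> lmeasurable" "measure lebesgue (E - M) = 0"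
    using assms(3) by (simp_all add: negligible_imp_measurable negligible_imp_measure0)
  have "measure lebesgue E \<le> measure lebesgue ((E - M) \<union> M)"
    using assms N by (intro measure_mono_fmeasurable) auto
  also have "\<dots> \<le> measure lebesgue (E - M) + measure lebesgue M"
    using assms N by (intro measure_Un_le) auto
  finally show ?thesis using N by simp
qed

text \<open>Vitali's theorem extracts disjoint steep intervals covering almost all of
  \<open>E\<close>, and their increments add up to at most that of \<open>F\<close>. The intervals
  need only contain x; midpoint and radius recode them as the balls of the covering theorem.\<close>

lemma measure_steep_set_le:
  fixes F :: "real \<Rightarrow> real"
  assumes F: "mono_on {a..b} F" "a \<le> b" and "0 < v"
    and E: "E \<in> lmeasurable"
    and fine: "\<And>x d. x \<in> E \<Longrightarrow> 0 < d \<Longrightarrow>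
      \<exists>p q. a \<le> p \<and> p < q \<and> q \<le> b \<and> x \<in> {p..q} \<and> q - p < d \<and> v * (q - p) \<le> F q - F p"
  shows "v * measure lebesgue E \<le> F b - F a"
proof -
  define K where "K = {(c, r). a \<le> c - r \<and> c + r \<le> b \<and> 0 < r \<and> v * (2 * r) \<le> F (c + r) - F (c - r)}"
  obtain C where C: "countable C" "C \<subseteq> K"
     "pairwise (\<lambda>i j. disjnt (cball (fst i) (snd i)) (cball (fst j) (snd j))) C"
     "negligible (E - (\<Union>i\<in>C. cball (fst i) (snd i)))"
  proof (rule Vitali_covering_theorem_cballs)
    show "0 < snd i" if "i \<in> K" for i using that by (auto simp: K_def)
    show "\<exists>i. i \<in> K \<and> x \<in> cball (fst i) (snd i) \<and> snd i < d" if xd: "x \<in> E" "0 < d" for x d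
    proof -
      obtain p q where pq: "a \<le> p" "p < q" "q \<le> b" "x \<in> {p..q}" "q - p < d" "v * (q - p) \<le> F q - F p"
        using fine[OF xd] by blast
      have "(p + q) / 2 + (q - p) / 2 = q" "(p + q) / 2 - (q - p) / 2 = p" "2 * ((q - p) / 2) = q - p" by argo+
      then have "((p + q) / 2, (q - p) / 2) \<in> K" "x \<in> cball ((p + q) / 2) ((q - p) / 2)"
        using pq by (simp_all only: K_def cball_eq_atLeastAtMost mem_Collect_eq prod.case) auto
      then show ?thesis using pq by fastforce
    qed
  qed
  have Cb: "i \<in> C \<Longrightarrow> a \<le> fst i - snd i \<and> fst i + snd i \<le> b \<and> 0 < snd i \<and>
                 v * (2 * snd i) \<le> F (fst i + snd i) - F (fst i - snd i)" for i
    using C(2) by (auto simp: K_def)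
  note M = measure_Union_steep_intervals[OF C(1) F \<open>0 < v\<close> _ Cb C(3), of 1, simplified]
  have "measure lebesgue E \<le> measure lebesgue (\<Union>i\<in>C. cball (fst i) (snd i))"
    using measure_le_negligible_Diff[OF E M(1) C(4)] .
  then show ?thesis
    using M(2) \<open>0 < v\<close> by (smt (verit) mult_left_mono)
qed

text \<open>The intervals need not be short, so the covering lemma with its factor 5 replaces the
  covering theorem. \<open>B\<close> may be non-measurable, hence the measurable superset.\<close>

lemma weak_maximal_inequality:
  fixes F :: "real \<Rightarrow> real"
  assumes F: "mono_on {a..b} F" "a < b" and "0 < v"
    and B: "\<And>x. x \<in> B \<Longrightarrow> \<exists>p q. a \<le> p \<and> p < q \<and> q \<le> b \<and> x \<in> {p..q} \<and> v * (q - p) \<le> F q - F p"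
  obtains M where "B \<subseteq> M" "M \<in> lmeasurable" "v * measure lebesgue M \<le> 5 * (F b - F a)"
proof -
  define K where "K = {(c, r). a \<le> c - r \<and> c + r \<le> b \<and> 0 < r \<and> v * (2 * r) \<le> F (c + r) - F (c - r)}"
  obtain C where C: "countable C" "C \<subseteq> K"
     "pairwise (\<lambda>i j. disjnt (cball (fst i) (snd i)) (cball (fst j) (snd j))) C"
     "B \<subseteq> (\<Union>i\<in>C. cball (fst i) (5 * snd i))"
  proof (rule Vitali_covering_lemma_cballs)
    show "B \<subseteq> (\<Union>i\<in>K. cball (fst i) (snd i))"
    proof
      fix x assume "x \<in> B"
      then obtain p q where pq: "a \<le> p" "p < q" "q \<le> b" "x \<in> {p..q}" "v * (q - p) \<le> F q - F p"
        using B by blast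
      have "(p + q) / 2 + (q - p) / 2 = q" "(p + q) / 2 - (q - p) / 2 = p" "2 * ((q - p) / 2) = q - p" by argo+
      then have "((p + q) / 2, (q - p) / 2) \<in> K" "x \<in> cball ((p + q) / 2) ((q - p) / 2)"
        using pq by (simp_all only: K_def cball_eq_atLeastAtMost mem_Collect_eq prod.case) auto
      then show "x \<in> (\<Union>i\<in>K. cball (fst i) (snd i))" by fastforce
    qed
    show "0 < snd i \<and> snd i \<le> b - a" if "i \<in> K" for i using that by (auto simp: K_def)
  qed
  have Cb: "i \<in> C \<Longrightarrow> a \<le> fst i - snd i \<and> fst i + snd i \<le> b \<and> 0 < snd i \<and>
                 v * (2 * snd i) \<le> F (fst i + snd i) - F (fst i - snd i)" for i
    using C(2) by (auto simp: K_def)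
  show thesis
    using that[OF C(4)] measure_Union_steep_intervals[OF C(1) F(1) less_imp_le[OF F(2)] \<open>0 < v\<close> _ Cb C(3), of 5]
    by simp
qed

text \<open>A weak form of Lebesgue density: disjoint intervals inside an open set barely larger
  than \<open>E\<close> cover almost all of \<open>E\<close>, which bounds its measure by c times
  itself plus a small error.\<close>

lemma fine_cover_imp_null:
  fixes E :: "real set"
  assumes E: "E \<in> lmeasurable" and c: "0 \<le> c" "c < 1"
    and fine: "\<And>x d. x \<in> E \<Longrightarrow> 0 < d \<Longrightarrow>
      \<exists>p q. p < q \<and> x \<in> {p..q} \<and> q - p < d \<and> measure lebesgue (E \<inter> {p..q}) \<le> c * (q - p)"
  shows "measure lebesgue E = 0"
proof -
  have le: "measure lebesgue E \<le> c * (measure lebesgue E + e)" if "0 < e" for e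
  proof -
    obtain U where U: "open U" "E \<subseteq> U" "U \<in> lmeasurable" "measure lebesgue U < measure lebesgue E + e"
    proof -
      obtain U where U: "open U" "E \<subseteq> U" "U - E \<in> lmeasurable" "emeasure lebesgue (U - E) < ennreal e"
        using sets_lebesgue_outer_open[of E e] E \<open>0 < e\<close> by blast
      have "U = E \<union> (U - E)" using U by auto
      then have m: "U \<in> lmeasurable" using E U by (metis fmeasurable.Un)
      have "measure lebesgue (U - E) < e"
        using U \<open>0 < e\<close> by (simp add: emeasure_eq_measure2 ennreal_less_iff)
      then show thesis
        using that[of U] U m E measurable_measure_Diff[of U lebesgue E] by auto
    qed
    define K where "K = {(m, r). 0 < r \<and> cball m r \<subseteq> U \<and> measure lebesgue (E \<inter> cball m r) \<le> c * (2 * r)}"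
    obtain C where C: "countable C" "C \<subseteq> K"
      "pairwise (\<lambda>i j. disjnt (cball (fst i) (snd i)) (cball (fst j) (snd j))) C"
      "negligible (E - (\<Union>i\<in>C. cball (fst i) (snd i)))"
    proof (rule Vitali_covering_theorem_cballs)
      show "0 < snd i" if "i \<in> K" for i using that by (auto simp: K_def)
      show "\<exists>i. i \<in> K \<and> x \<in> cball (fst i) (snd i) \<and> snd i < d" if xd: "x \<in> E" "0 < d" for x d
      proof -
        obtain e' where e': "0 < e'" "ball x e' \<subseteq> U"
          using U xd by (meson openE subsetD)
        obtain p q where pq: "p < q" "x \<in> {p..q}" "q - p < min d e'"
          "measure lebesgue (E \<inter> {p..q}) \<le> c * (q - p)"
          using fine[of x "min d e'"] xd e' by auto
        have mid: "(p + q) / 2 + (q - p) / 2 = q" "(p + q) / 2 - (q - p) / 2 = p" by argo+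
        have "2 * ((q - p) / 2) = q - p" by simp
        from mid have cb: "cball ((p + q) / 2) ((q - p) / 2) = {p..q}"
          by (simp only: cball_eq_atLeastAtMost)
        have "{p..q} \<subseteq> ball x e'"
          using pq by (auto simp: dist_real_def)
        then have "((p + q) / 2, (q - p) / 2) \<in> K"
          using pq e' by (simp only: K_def cb mem_Collect_eq prod.case \<open>2 * ((q - p) / 2) = q - p\<close>) auto
        then show ?thesis using pq(1-3) by (intro exI[of _ "((p + q) / 2, (q - p) / 2)"]) (simp add: cb)
      qed
    qed
    let ?E = "\<lambda>i. E \<inter> cball (fst i) (snd i)"
    have *: "measure lebesgue (\<Union>i\<in>D. ?E i) \<le> c * measure lebesgue U" if D: "D \<subseteq> C" "finite D" for D
    proof -
      have "measure lebesgue (\<Union>i\<in>D. ?E i) \<le> (\<Sum>i\<in>D. measure lebesgue (?E i))"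
        using D E by (intro measure_UNION_le) auto
      also have "\<dots> \<le> (\<Sum>i\<in>D. c * (2 * snd i))"
        using D C(2) by (intro sum_mono) (auto simp: K_def)
      also have "\<dots> = (\<Sum>i\<in>D. c * measure lebesgue (cball (fst i) (snd i)))"
        using D C(2) by (intro sum.cong refl) (subst measure_real_cball; force simp: K_def)
      also have "\<dots> = c * measure lebesgue (\<Union>i\<in>D. cball (fst i) (snd i))"
        unfolding sum_distrib_left[symmetric] using D pairwise_subset[OF C(3) D(1)]
        by (subst measure_UNION') simp_all
      also have "\<dots> \<le> c * measure lebesgue U"
      proof (intro mult_left_mono measure_mono_fmeasurable)
        show "(\<Union>i\<in>D. cball (fst i) (snd i)) \<subseteq> U"
          using D C(2) unfolding K_def by fastforce
      qed (use D U c in auto)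
      finally show ?thesis .
    qed
    have m: "(\<Union>i\<in>C. ?E i) \<in> lmeasurable"
      using E by (intro fmeasurable_UN_bound[OF C(1) _ *]) auto
    have le: "measure lebesgue (\<Union>i\<in>C. ?E i) \<le> c * measure lebesgue U"
      using E by (intro measure_UN_bound[OF C(1) _ *]) auto
    have "E - (\<Union>i\<in>C. ?E i) = E - (\<Union>i\<in>C. cball (fst i) (snd i))" by blast
    then have "measure lebesgue E \<le> measure lebesgue (\<Union>i\<in>C. ?E i)"
      using measure_le_negligible_Diff[OF E m] C(4) by presburger
    also have "\<dots> \<le> c * measure lebesgue U" by (fact le)
    also have "\<dots> \<le> c * (measure lebesgue E + e)"
      using U c by (intro mult_left_mono) auto
    finally show ?thesis .
  qed
  show ?thesis
  proof (rule ccontr)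
    assume "measure lebesgue E \<noteq> 0"
    then have "0 < measure lebesgue E" by (simp add: zero_less_measure_iff)
    define m where "m = measure lebesgue E"
    \<comment> \<open>An error of half the gap (1 - c) m is small enough to contradict m >
      0.\<close>
    have "m \<le> c * (m + (1 - c) * m / 2)"
      using le[of "(1 - c) * m / 2"] c \<open>0 < measure lebesgue E\<close> by (simp add: m_def)
    also have "\<dots> \<le> c * m + 1 * ((1 - c) * m / 2)"
      using c \<open>0 < measure lebesgue E\<close> unfolding distrib_left m_def
      by (intro add_left_mono mult_right_mono) auto
    finally have "(1 - c) * m \<le> 0" by argo
    then show False using c \<open>0 < measure lebesgue E\<close> by (auto simp: m_def mult_le_0_iff)
  qed
qed

section \<open>Lipschitz curves are differentiable almost everywhere\<close>

text \<open>Lebesgue's argument for monotone functions: inside an interval of mean slope below u,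
  the points with arbitrarily short intervals of slope above v fill at most the fraction u/v. Every
  point of \<open>E\<close> lies in arbitrarily short intervals of this kind.\<close>

lemma oscillating_slope_null:
  fixes F :: "real \<Rightarrow> real"
  assumes "mono F" and cont: "continuous_on UNIV F" and "0 < u" "u < v"
  defines "E \<equiv> {x. \<forall>d>0. (\<exists>h. 0 < \<bar>h\<bar> \<and> \<bar>h\<bar> < d \<and> v < (F (x + h) - F x) / h) \<and>
                         (\<exists>h. 0 < \<bar>h\<bar> \<and> \<bar>h\<bar> < d \<and> (F (x + h) - F x) / h < u)}"
  shows "negligible E"
proof -
  have op: "open {x. v < (F (x + h) - F x) / h}" "open {x. (F (x + h) - F x) / h < u}" if "h \<noteq> 0" for h
    using that
    by (auto intro!: open_Collect_less continuous_intros continuous_on_compose2[OF cont])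
  \<comment> \<open>Countably many scales suffice, and each contributes an open set by continuity of
    \<open>F\<close>; so \<open>E\<close> is a G_delta, hence measurable.\<close>
  have E_eq: "E = (\<Inter>n::nat. (\<Union>h\<in>{h. 0 < \<bar>h\<bar> \<and> \<bar>h\<bar> < 1 / Suc n}. {x. v < (F (x + h) - F x) / h}) \<inter>
                    (\<Union>h\<in>{h. 0 < \<bar>h\<bar> \<and> \<bar>h\<bar> < 1 / Suc n}. {x. (F (x + h) - F x) / h < u}))"
    (is "_ = ?R")
  proof
    show "E \<subseteq> ?R"
    proof (intro subsetI INT_I)
      fix x n assume "x \<in> E"
      moreover have "0 < 1 / real (Suc n)" by simp
      ultimately show "x \<in> (\<Union>h\<in>{h. 0 < \<bar>h\<bar> \<and> \<bar>h\<bar> < 1 / Suc n}. {x. v < (F (x + h) - F x) / h}) \<inter>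
                    (\<Union>h\<in>{h. 0 < \<bar>h\<bar> \<and> \<bar>h\<bar> < 1 / Suc n}. {x. (F (x + h) - F x) / h < u})"
        unfolding E_def by blast
    qed
    show "?R \<subseteq> E"
    proof
      fix x assume x: "x \<in> ?R"
      have "(\<exists>h. 0 < \<bar>h\<bar> \<and> \<bar>h\<bar> < d \<and> v < (F (x + h) - F x) / h) \<and>
            (\<exists>h. 0 < \<bar>h\<bar> \<and> \<bar>h\<bar> < d \<and> (F (x + h) - F x) / h < u)" if "0 < d" for d
      proof -
        obtain n where "1 / real (Suc n) < d"
          using nat_approx_posE[of d] \<open>0 < d\<close> by blast
        then show ?thesis using x by (fastforce dest: spec[of _ n])
      qed
      then show "x \<in> E" unfolding E_def by blast
    qed
  qed
  have Eb: "E \<in> sets borel"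
  proof -
    have "open ((\<Union>h\<in>{h. 0 < \<bar>h\<bar> \<and> \<bar>h\<bar> < 1 / Suc n}. {x. v < (F (x + h) - F x) / h}) \<inter>
                    (\<Union>h\<in>{h. 0 < \<bar>h\<bar> \<and> \<bar>h\<bar> < 1 / Suc n}. {x. (F (x + h) - F x) / h < u}))" for n :: nat
      using op by (intro open_Int open_UN) auto
    then show ?thesis unfolding E_eq by (intro sets.countable_INT) auto
  qed
  have "negligible (E \<inter> cball 0 R)" for R
  proof -
    let ?E = "E \<inter> cball 0 R"
    have m: "?E \<in> lmeasurable"
      using Eb fmeasurable_Int_fmeasurable[OF lmeasurable_cball, of E 0 R]
      by (simp add: Int_commute sets_completionI_sets)
    have "measure lebesgue ?E = 0"
    proof (rule fine_cover_imp_null[OF m])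
      show "0 \<le> u / v" "u / v < 1" using assms by auto
      fix x d :: real assume x: "x \<in> ?E" and "0 < d"
      then obtain h where h: "0 < \<bar>h\<bar>" "\<bar>h\<bar> < d" "(F (x + h) - F x) / h < u"
        unfolding E_def by blast
      define p q where "p = min x (x + h)" and "q = max x (x + h)"
      have pq: "p < q" "x \<in> {p..q}" "q - p < d" "q - p = \<bar>h\<bar>"
        using h by (auto simp: p_def q_def)
      have "(F q - F p) / (q - p) = (F (x + h) - F x) / h"
        using h by (cases "h > 0") (auto simp: p_def q_def field_simps)
      with h(3) have "(F q - F p) / (q - p) < u" by simp
      with pq(1) have slope: "F q - F p \<le> u * (q - p)" by (simp add: divide_less_eq)
      \<comment> \<open>The open interval leaves room on both sides of a point for steep intervals
        inside \<open>{p..q}\<close>; the two end points form a null set.\<close>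
      have mm: "?E \<inter> {p<..<q} \<in> lmeasurable"
        using m by (simp add: fmeasurable.Int)
      have "v * measure lebesgue (?E \<inter> {p<..<q}) \<le> F q - F p"
      proof (rule measure_steep_set_le[where F = F and a = p and b = q, OF _ _ _ mm])
        show "mono_on {p..q} F" using \<open>mono F\<close> by (rule mono_on_subset) auto
        show "p \<le> q" "0 < v" using pq assms by auto
        fix y e :: real assume y: "y \<in> ?E \<inter> {p<..<q}" and "0 < e"
        then have "0 < min e (min (y - p) (q - y))" by auto
        then obtain k where k: "0 < \<bar>k\<bar>" "\<bar>k\<bar> < min e (min (y - p) (q - y))" "v < (F (y + k) - F y) / k"
          using y unfolding E_def by blast
        define p' q' where "p' = min y (y + k)" and "q' = max y (y + k)"
        have pq': "p \<le> p'" "p' < q'" "q' \<le> q" "y \<in> {p'..q'}" "q' - p' < e"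
          using k by (auto simp: p'_def q'_def)
        have "(F q' - F p') / (q' - p') = (F (y + k) - F y) / k"
          using k by (cases "k > 0") (auto simp: p'_def q'_def field_simps)
        with k(3) have "v < (F q' - F p') / (q' - p')" by simp
        with pq'(2) have "v * (q' - p') \<le> F q' - F p'" by (simp add: less_divide_eq)
        with pq' show "\<exists>p' q'. p \<le> p' \<and> p' < q' \<and> q' \<le> q \<and> y \<in> {p'..q'} \<and> q' - p' < e \<and> v * (q' - p') \<le> F q' - F p'"
          by blast
      qed
      moreover have "measure lebesgue (?E \<inter> {p..q}) \<le> measure lebesgue (?E \<inter> {p<..<q})"
      proof (rule measure_le_negligible_Diff[OF _ mm])
        show "?E \<inter> {p..q} \<in> lmeasurable" using m by (simp add: fmeasurable.Int)
        have "?E \<inter> {p..q} - ?E \<inter> {p<..<q} \<subseteq> {p, q}" by auto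
        then show "negligible (?E \<inter> {p..q} - ?E \<inter> {p<..<q})"
          by (rule negligible_subset[rotated]) (simp add: negligible_finite)
      qed
      ultimately have "v * measure lebesgue (?E \<inter> {p..q}) \<le> u * (q - p)"
        using slope \<open>0 < u\<close> \<open>u < v\<close> by (smt (verit) mult_left_mono)
      then have "measure lebesgue (?E \<inter> {p..q}) \<le> u / v * (q - p)"
        using assms by (simp add: field_simps)
      with pq show "\<exists>p q. p < q \<and> x \<in> {p..q} \<and> q - p < d \<and> measure lebesgue (?E \<inter> {p..q}) \<le> u / v * (q - p)"
        by blast
    qed
    then show ?thesis using m by (simp add: negligible_iff_measure0)
  qed
  then have "negligible (\<Union>n::nat. E \<inter> cball 0 (real n))"
    by (intro negligible_countable_Union) auto
  moreover have "E \<subseteq> (\<Union>n::nat. E \<inter> cball 0 (real n))"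
    using real_arch_simple by fastforce
  ultimately show ?thesis by (rule negligible_subset)
qed

text \<open>Adding (L + 1) x moves all slopes into [1, 2 L + 1], so the function becomes monotone
  and only positive rational slopes have to be separated.\<close>

lemma lipschitz_real_differentiable_ae:
  fixes f :: "real \<Rightarrow> real"
  assumes lip: "L-lipschitz_on UNIV f"
  shows "negligible {x. \<not> f differentiable (at x)}"
proof -
  have L: "0 \<le> L" using lip by (rule lipschitz_on_nonneg)
  define F where "F x = f x + (L + 1) * x" for x
  have bd: "\<bar>f y - f x\<bar> \<le> L * \<bar>y - x\<bar>" for x y
    using lipschitz_onD[OF lip, of y x] by (simp add: dist_real_def)
  have slope: "1 \<le> (F (x + h) - F x) / h \<and> (F (x + h) - F x) / h \<le> 2 * L + 1" if "h \<noteq> 0" for x h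
  proof -
    have "(F (x + h) - F x) / h = (f (x + h) - f x) / h + (L + 1)"
      using that by (simp add: F_def field_simps)
    moreover have "\<bar>(f (x + h) - f x) / h\<bar> \<le> L"
      using bd[of "x + h" x] that by (simp add: abs_divide divide_le_eq)
    ultimately show ?thesis by linarith
  qed
  have "mono F"
  proof (rule monoI)
    fix x y :: real assume "x \<le> y"
    then show "F x \<le> F y" using slope[of "y - x" x]
      by (cases "x = y") (auto simp: field_simps)
  qed
  have cont: "continuous_on UNIV F"
    unfolding F_def by (intro continuous_intros lipschitz_on_continuous_on[OF lip])
  define E where "E u v = {x. \<forall>d>0. (\<exists>h. 0 < \<bar>h\<bar> \<and> \<bar>h\<bar> < d \<and> v < (F (x + h) - F x) / h) \<and>
                         (\<exists>h. 0 < \<bar>h\<bar> \<and> \<bar>h\<bar> < d \<and> (F (x + h) - F x) / h < u)}" for u v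
  have "negligible (\<Union>(u,v)\<in>{(u,v) \<in> \<rat> \<times> \<rat>. 0 < u \<and> u < v}. E u v)"
  proof (rule negligible_countable_Union)
    have "countable (\<rat> \<times> \<rat> :: (real \<times> real) set)" by (simp add: countable_rat)
    then have "countable {(u,v) \<in> \<rat> \<times> \<rat>. 0 < u \<and> u < (v::real)}"
      by (rule countable_subset[rotated]) auto
    then show "countable ((\<lambda>(u,v). E u v) ` {(u,v) \<in> \<rat> \<times> \<rat>. 0 < u \<and> u < v})" by (rule countable_image)
  qed (use oscillating_slope_null[OF \<open>mono F\<close> cont] in \<open>auto simp: E_def\<close>)
  moreover have "{x. \<not> f differentiable (at x)} \<subseteq> (\<Union>(u,v)\<in>{(u,v) \<in> \<rat> \<times> \<rat>. 0 < u \<and> u < v}. E u v)"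
  proof (rule subsetI, rule ccontr)
    fix x assume x: "x \<in> {x. \<not> f differentiable (at x)}"
      and "x \<notin> (\<Union>(u,v)\<in>{(u,v) \<in> \<rat> \<times> \<rat>. 0 < u \<and> u < v}. E u v)"
    then have notE: "x \<notin> E u v" if "u \<in> \<rat>" "v \<in> \<rat>" "0 < u" "u < v" for u v
      using that by blast
    define q where "q h = (F (x + h) - F x) / h" for h
    \<comment> \<open>\<open>S\<close> collects the eventual upper bounds of the difference
      quotients, so \<open>D\<close> is the upper derivative; a smaller lower derivative would put x
      into some \<open>E u v\<close>.\<close>
    define S where "S = {w. \<exists>d>0. \<forall>h. 0 < \<bar>h\<bar> \<and> \<bar>h\<bar> < d \<longrightarrow> q h \<le> w}"
    define D where "D = Inf S"
    have S_ge: "1 \<le> w" if "w \<in> S" for w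
    proof -
      obtain d where d: "d > 0" "\<forall>h. 0 < \<bar>h\<bar> \<and> \<bar>h\<bar> < d \<longrightarrow> q h \<le> w"
        using \<open>w \<in> S\<close> unfolding S_def by blast
      have "q (d/2) \<le> w" using d by auto
      moreover have "1 \<le> q (d/2)" using slope[of "d/2" x] d unfolding q_def by auto
      ultimately show ?thesis by linarith
    qed
    have Sne: "2 * L + 1 \<in> S"
      unfolding S_def q_def using slope[of _ x] by (auto intro!: exI[of _ 1])
    have bdd: "bdd_below S" using S_ge by (rule bdd_belowI)
    have D1: "1 \<le> D" unfolding D_def using S_ge Sne by (intro cInf_greatest) auto
    have up: "\<exists>d>0. \<forall>h. 0 < \<bar>h\<bar> \<and> \<bar>h\<bar> < d \<longrightarrow> q h < D + e" if "0 < e" for e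
    proof -
      obtain w where "w \<in> S" "w < D + e"
        using cInf_lessD[of S "D + e"] Sne \<open>0 < e\<close> by (auto simp: D_def)
      from \<open>w \<in> S\<close> obtain d where "d > 0" "\<forall>h. 0 < \<bar>h\<bar> \<and> \<bar>h\<bar> < d \<longrightarrow> q h \<le> w"
        unfolding S_def by blast
      with \<open>w < D + e\<close> show ?thesis by (meson le_less_trans)
    qed
    \<comment> \<open>e < 1 together with D \<ge> 1 keeps the separating rationals positive.\<close>
    have low: "\<exists>d>0. \<forall>h. 0 < \<bar>h\<bar> \<and> \<bar>h\<bar> < d \<longrightarrow> D - e < q h" if e: "0 < e" "e < 1" for e
    proof (rule ccontr)
      assume neg: "\<not> ?thesis"
      obtain u where u: "u \<in> \<rat>" "D - e < u" "u < D" using Rats_dense_in_real[of "D - e" D] e by auto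
      obtain v where v: "v \<in> \<rat>" "u < v" "v < D" using Rats_dense_in_real[of u D] u by auto
      have "v \<notin> S" using cInf_lower[OF _ bdd, of v] v by (auto simp: D_def)
      then have "\<exists>h. 0 < \<bar>h\<bar> \<and> \<bar>h\<bar> < d \<and> v < q h" if "d > 0" for d
        using that unfolding S_def mem_Collect_eq not_ex not_all not_imp not_le de_Morgan_conj by blast
      moreover have "\<exists>h. 0 < \<bar>h\<bar> \<and> \<bar>h\<bar> < d \<and> q h < u" if "d > 0" for d
        using neg that u(2) by (meson le_less_trans not_le)
      ultimately have "x \<in> E u v" by (simp add: E_def q_def)
      then show False using notE[of u v] u v D1 e by auto
    qed
    have "(q \<longlongrightarrow> D) (at 0)"
    proof (rule LIM_I)
      fix e :: real assume "0 < e"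
      obtain d1 where d1: "d1 > 0" "\<And>h. 0 < \<bar>h\<bar> \<and> \<bar>h\<bar> < d1 \<Longrightarrow> q h < D + e"
        using up[OF \<open>0 < e\<close>] by blast
      have "0 < min e (1/2)" "min e (1/2) < 1" using \<open>0 < e\<close> by (auto simp: min_def)
      then obtain d2 where d2: "d2 > 0" "\<And>h. 0 < \<bar>h\<bar> \<and> \<bar>h\<bar> < d2 \<Longrightarrow> D - min e (1/2) < q h"
        using low[of "min e (1/2)"] by blast
      show "\<exists>s>0. \<forall>h. h \<noteq> 0 \<and> norm (h - 0) < s \<longrightarrow> norm (q h - D) < e"
        using d1 d2 by (intro exI[of _ "min d1 d2"]) (force simp: abs_less_iff)
    qed
    then have "(F has_field_derivative D) (at x)"
      by (simp add: DERIV_def q_def[abs_def])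
    then have "((\<lambda>y. F y - (L + 1) * y) has_field_derivative (D - (L + 1))) (at x)"
      by (auto intro!: derivative_eq_intros)
    then have "(f has_field_derivative (D - (L + 1))) (at x)"
      by (simp add: F_def)
    then show False using x by (auto simp: real_differentiable_def)
  qed
  ultimately show ?thesis by (rule negligible_subset)
qed

lemma lipschitz_curve_differentiable_ae:
  fixes f :: "real \<Rightarrow> 'a::euclidean_space"
  assumes lip: "L-lipschitz_on UNIV f"
  shows "negligible {x. \<not> f differentiable (at x)}"
proof -
  have "L-lipschitz_on UNIV (\<lambda>x. f x \<bullet> b)" if "b \<in> Basis" for b
  proof (rule lipschitz_onI)
    show "0 \<le> L" using lip by (rule lipschitz_on_nonneg)
    show "dist (f x \<bullet> b) (f y \<bullet> b) \<le> L * dist x y" for x y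
      using lipschitz_onD[OF lip, of x y] Basis_le_norm[OF that, of "f x - f y"]
      by (simp add: dist_norm inner_diff_left)
  qed
  then have "negligible (\<Union>b\<in>Basis. {x. \<not> (\<lambda>x. f x \<bullet> b) differentiable (at x)})"
    by (intro negligible_Union) (auto intro: lipschitz_real_differentiable_ae)
  moreover have "{x. \<not> f differentiable (at x)} \<subseteq> (\<Union>b\<in>Basis. {x. \<not> (\<lambda>x. f x \<bullet> b) differentiable (at x)})"
    using differentiable_componentwise_within[of f _ UNIV] by auto
  ultimately show ?thesis by (rule negligible_subset)
qed

section \<open>Sets that are null on curves near a direction\<close>

lemma lipschitz_extend_real:
  fixes f :: "'a::metric_space \<Rightarrow> real"
  assumes lip: "L-lipschitz_on E f"
  obtains g where "L-lipschitz_on UNIV g" "\<And>x. x \<in> E \<Longrightarrow> g x = f x"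
proof (cases "E = {}")
  case True
  have "L-lipschitz_on UNIV (\<lambda>x::'a. 0::real)"
    using lipschitz_on_nonneg[OF lip] by (simp add: lipschitz_on_def)
  then show thesis using that True by blast
next
  case False
  have L: "0 \<le> L" using lip by (rule lipschitz_on_nonneg)
  have lipE: "f s \<le> f t + L * dist t s" if "s \<in> E" "t \<in> E" for s t
    using lipschitz_onD[OF lip that] by (simp add: dist_real_def dist_commute)
  \<comment> \<open>McShane's formula for the largest extension with constant
    \<open>L\<close>.\<close>
  define g where "g t = (INF s\<in>E. f s + L * dist t s)" for t
  have tri: "L * dist t s \<le> L * dist t u + L * dist u s" for t u s
    using mult_left_mono[OF dist_triangle[of t s u] L] by (simp add: distrib_left)
  have bdd: "bdd_below ((\<lambda>s. f s + L * dist t s) ` E)" for t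
  proof -
    obtain s0 where "s0 \<in> E" using False by blast
    have "f s0 - L * dist t s0 \<le> f s + L * dist t s" if "s \<in> E" for s
      using lipE[OF \<open>s0 \<in> E\<close> that] tri[of s s0 t] by (simp add: dist_commute)
    then show ?thesis by (auto intro!: bdd_belowI)
  qed
  have le: "g t \<le> g u + L * dist t u" for t u
  proof -
    have "g t - L * dist t u \<le> f s + L * dist u s" if "s \<in> E" for s
      using cINF_lower[OF bdd that, of t] tri[of t s u] by (simp add: g_def)
    then have "g t - L * dist t u \<le> g u"
      unfolding g_def[of u] using False by (intro cINF_greatest) auto
    then show ?thesis by simp
  qed
  show thesis
  proof
    show "L-lipschitz_on UNIV g"
    proof (rule lipschitz_onI[OF _ L])
      show "dist (g t) (g u) \<le> L * dist t u" for t u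
        using le[of t u] le[of u t] by (simp add: dist_real_def dist_commute abs_le_iff)
    qed
    show "g x = f x" if "x \<in> E" for x
    proof (rule antisym)
      show "g x \<le> f x" using cINF_lower[OF bdd that, of x] by (simp add: g_def)
      show "f x \<le> g x" unfolding g_def using False lipE[OF that]
        by (intro cINF_greatest) (auto simp: dist_commute)
    qed
  qed
qed

text \<open>Extending each coordinate separately costs the factor \<open>DIM('a)\<close>, which is
  compensated later by dividing the cone width by the dimension.\<close>

lemma lipschitz_extend_euclidean:
  fixes f :: "'b::metric_space \<Rightarrow> 'a::euclidean_space" and L :: real
  assumes lip: "L-lipschitz_on E f"
  obtains g where "(DIM('a) * L)-lipschitz_on UNIV g" "\<And>x. x \<in> E \<Longrightarrow> g x = f x"
proof -
  have L: "0 \<le> L" using lip by (rule lipschitz_on_nonneg)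
  have "\<exists>g. L-lipschitz_on UNIV g \<and> (\<forall>x\<in>E. g x = f x \<bullet> b)" if b: "b \<in> Basis" for b
  proof -
    have "L-lipschitz_on E (\<lambda>x. f x \<bullet> b)"
    proof (rule lipschitz_onI[OF _ L])
      show "dist (f x \<bullet> b) (f y \<bullet> b) \<le> L * dist x y" if "x \<in> E" "y \<in> E" for x y
        using lipschitz_onD[OF lip that] Basis_le_norm[OF b, of "f x - f y"]
        by (simp add: dist_norm inner_diff_left)
    qed
    then show ?thesis by (rule lipschitz_extend_real) blast
  qed
  then obtain g where g: "\<And>b. b \<in> Basis \<Longrightarrow> L-lipschitz_on UNIV (g b)"
    "\<And>b x. b \<in> Basis \<Longrightarrow> x \<in> E \<Longrightarrow> g b x = f x \<bullet> b"
    by metis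
  define h where "h x = (\<Sum>b\<in>Basis. g b x *\<^sub>R b)" for x
  show thesis
  proof
    show "(DIM('a) * L)-lipschitz_on UNIV h"
    proof (rule lipschitz_onI)
      show "0 \<le> DIM('a) * L" using L by simp
      fix x y
      have "norm (h x - h y) = norm (\<Sum>b\<in>Basis. (g b x - g b y) *\<^sub>R b)"
        by (simp add: h_def sum_subtractf scaleR_diff_left)
      also have "\<dots> \<le> (\<Sum>b\<in>(Basis::'a set). L * dist x y)"
      proof (rule sum_norm_le)
        show "norm ((g b x - g b y) *\<^sub>R b) \<le> L * dist x y" if "b \<in> Basis" for b
          using lipschitz_onD[OF g(1)[OF that], of x y] that by (simp add: dist_real_def)
      qed
      finally show "dist (h x) (h y) \<le> DIM('a) * L * dist x y"
        by (simp add: dist_norm)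
    qed
    show "h x = f x" if "x \<in> E" for x
      using that g(2) by (simp add: h_def euclidean_representation)
  qed
qed

text \<open>A two-point condition on the whole line instead of one on derivatives: after subtracting
  t e it is a Lipschitz bound, so a curve known only on part of the line can be completed to a
  member by Lipschitz extension.\<close>

definition near_curves :: "'a::euclidean_space \<Rightarrow> real \<Rightarrow> (real \<Rightarrow> 'a) set" where
  "near_curves e \<sigma> = {\<gamma>. \<forall>s t. norm (\<gamma> s - \<gamma> t - (s - t) *\<^sub>R e) \<le> \<sigma> * \<bar>s - t\<bar>}"

definition dir_null :: "'a::euclidean_space \<Rightarrow> real \<Rightarrow> 'a set \<Rightarrow> bool" where
  "dir_null e \<sigma> P \<longleftrightarrow> (\<forall>\<gamma>\<in>near_curves e \<sigma>. negligible {t. \<gamma> t \<in> P})"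

definition dir_small :: "'a::euclidean_space \<Rightarrow> real \<Rightarrow> 'a set \<Rightarrow> bool" where
  "dir_small e \<sigma> X \<longleftrightarrow> (\<exists>F. X \<subseteq> F \<and> fsigma_in euclidean F \<and> dir_null e \<sigma> F)"

lemma dir_null_subset: "dir_null e \<sigma> Q \<Longrightarrow> P \<subseteq> Q \<Longrightarrow> dir_null e \<sigma> P"
  unfolding dir_null_def by (meson negligible_subset Collect_mono subsetD)

lemma dir_null_Union: "countable \<P> \<Longrightarrow> (\<And>P. P \<in> \<P> \<Longrightarrow> dir_null e \<sigma> P) \<Longrightarrow> dir_null e \<sigma> (\<Union>\<P>)"
proof -
  assume A: "countable \<P>" "\<And>P. P \<in> \<P> \<Longrightarrow> dir_null e \<sigma> P"
  have "negligible {t. \<gamma> t \<in> \<Union>\<P>}" if "\<gamma> \<in> near_curves e \<sigma>" for \<gamma>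
  proof -
    have "negligible (\<Union>P\<in>\<P>. {t. \<gamma> t \<in> P})"
      using A that by (intro negligible_countable_Union) (auto simp: dir_null_def)
    moreover have "{t. \<gamma> t \<in> \<Union>\<P>} = (\<Union>P\<in>\<P>. {t. \<gamma> t \<in> P})" by blast
    ultimately show ?thesis by simp
  qed
  then show ?thesis by (simp add: dir_null_def)
qed

lemma dir_small_subset: "dir_small e \<sigma> Y \<Longrightarrow> X \<subseteq> Y \<Longrightarrow> dir_small e \<sigma> X"
  unfolding dir_small_def by blast

lemma dir_small_Union:
  assumes "countable \<X>" "\<And>X. X \<in> \<X> \<Longrightarrow> dir_small e \<sigma> X"
  shows "dir_small e \<sigma> (\<Union>\<X>)"
proof -
  obtain F where F: "\<And>X. X \<in> \<X> \<Longrightarrow> X \<subseteq> F X \<and> fsigma_in euclidean (F X) \<and> dir_null e \<sigma> (F X)"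
    using assms(2) unfolding dir_small_def by metis
  have "\<Union>\<X> \<subseteq> \<Union>(F ` \<X>)" using F by fastforce
  moreover have "fsigma_in euclidean (\<Union>(F ` \<X>))"
    using F assms(1) by (intro fsigma_in_Union) auto
  moreover have "dir_null e \<sigma> (\<Union>(F ` \<X>))"
    using F assms(1) by (intro dir_null_Union) auto
  ultimately show ?thesis unfolding dir_small_def by blast
qed

lemma negligible_affine_preimage:
  fixes c d :: real
  assumes "negligible S" "c \<noteq> 0"
  shows "negligible {t. c * t + d \<in> S}"
proof -
  have "negligible ((\<lambda>x. (x - d) / c) ` S)"
    using assms
    by (intro negligible_differentiable_image_negligible) (auto simp: differentiable_on_def)
  moreover have "{t. c * t + d \<in> S} \<subseteq> (\<lambda>x. (x - d) / c) ` S"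
  proof
    fix t assume "t \<in> {t. c * t + d \<in> S}"
    then show "t \<in> (\<lambda>x. (x - d) / c) ` S"
      using assms(2) by (intro image_eqI[of _ _ "c * t + d"]) auto
  qed
  ultimately show ?thesis by (rule negligible_subset)
qed

text \<open>The points whose tangent is close to a direction of the net fall into countably many
  pieces. On each, the curve run at a suitable rational speed satisfies the two-point condition of
  \<open>near_curves\<close>, so it extends to a member. A general \<open>S\<close> covers both
  curves on \<open>{0..1}\<close> and curves on the whole line.\<close>

lemma negligible_curve_preimage:
  fixes \<gamma> :: "real \<Rightarrow> 'a::euclidean_space"
  assumes "countable N" "0 < \<sigma>"
    and null: "\<And>e. e \<in> N \<Longrightarrow> norm e = 1 \<and> dir_null e \<sigma> P"
    and deriv: "negligible {t\<in>S. \<not> (\<exists>v. (\<gamma> has_vector_derivative v) (at t within S) \<and> v \<noteq> 0 \<and>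
                   (\<exists>e\<in>N. norm (v /\<^sub>R norm v - e) < \<sigma> / (2 * DIM('a))))}"
  shows "negligible {t\<in>S. \<gamma> t \<in> P}"
proof -
  define \<tau> where "\<tau> = \<sigma> / DIM('a)"
  have \<tau>: "0 < \<tau>" "DIM('a) * \<tau> = \<sigma>" using \<open>0 < \<sigma>\<close> by (auto simp: \<tau>_def)
  define E where "E e c m = {t\<in>S. \<forall>u\<in>S. \<bar>u - t\<bar> < 1 / Suc m \<longrightarrow>
      norm (\<gamma> u - \<gamma> t - (u - t) *\<^sub>R (c *\<^sub>R e)) \<le> c * \<tau> * \<bar>u - t\<bar>}" for e c and m :: nat
  have piece: "negligible {t \<in> E e c m. \<lfloor>t * Suc m\<rfloor> = j \<and> \<gamma> t \<in> P}"
    if e: "e \<in> N" and c: "0 < c" for e c m and j :: int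
  proof -
    \<comment> \<open>Cutting by the floor makes any two points of a piece closer than 1 / Suc m, so
      the estimate at one of them applies to the other.\<close>
    let ?T = "{t \<in> E e c m. \<lfloor>t * Suc m\<rfloor> = j}"
    have near: "\<bar>u - t\<bar> < 1 / Suc m" if "u \<in> ?T" "t \<in> ?T" for u t
    proof -
      have "\<bar>u * Suc m - t * Suc m\<bar> < 1" using that by (simp; linarith)
      then have "\<bar>u - t\<bar> * Suc m < 1" by (simp flip: left_diff_distrib add: abs_mult)
      then show ?thesis by (simp add: field_simps)
    qed
    have "(c * \<tau>)-lipschitz_on ?T (\<lambda>t. \<gamma> t - t *\<^sub>R (c *\<^sub>R e))"
    proof (rule lipschitz_onI)
      show "0 \<le> c * \<tau>" using c \<tau> by simp
      fix u t assume ut: "u \<in> ?T" "t \<in> ?T"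
      have "norm (\<gamma> u - \<gamma> t - (u - t) *\<^sub>R (c *\<^sub>R e)) \<le> c * \<tau> * \<bar>u - t\<bar>"
        using near[OF ut] ut unfolding E_def by blast
      then show "dist (\<gamma> u - u *\<^sub>R (c *\<^sub>R e)) (\<gamma> t - t *\<^sub>R (c *\<^sub>R e)) \<le> c * \<tau> * dist u t"
        by (simp add: dist_norm algebra_simps)
    qed
    then obtain \<zeta> where \<zeta>: "(DIM('a) * (c * \<tau>))-lipschitz_on UNIV \<zeta>"
      "\<And>t. t \<in> ?T \<Longrightarrow> \<zeta> t = \<gamma> t - t *\<^sub>R (c *\<^sub>R e)"
      by (rule lipschitz_extend_euclidean) blast
    \<comment> \<open>The substitution s = c t turns the drift c e into e.\<close>
    define \<eta> where "\<eta> s = \<zeta> (s / c) + s *\<^sub>R e" for s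
    have "\<eta> \<in> near_curves e \<sigma>"
    proof -
      have "norm (\<eta> s - \<eta> t - (s - t) *\<^sub>R e) \<le> \<sigma> * \<bar>s - t\<bar>" for s t
      proof -
        have "norm (\<eta> s - \<eta> t - (s - t) *\<^sub>R e) = dist (\<zeta> (s / c)) (\<zeta> (t / c))"
          by (simp add: \<eta>_def dist_norm algebra_simps)
        also have "\<dots> \<le> DIM('a) * (c * \<tau>) * dist (s / c) (t / c)"
          by (rule lipschitz_onD[OF \<zeta>(1)]) auto
        also have "dist (s / c) (t / c) = \<bar>s - t\<bar> / c"
          using c by (simp add: dist_real_def flip: diff_divide_distrib)
        also have "DIM('a) * (c * \<tau>) * (\<bar>s - t\<bar> / c) = \<sigma> * \<bar>s - t\<bar>"
          using c \<tau>(2) by (simp add: mult.assoc[symmetric])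
        finally show ?thesis .
      qed
      then show ?thesis by (simp add: near_curves_def)
    qed
    then have "negligible {s. \<eta> s \<in> P}" using null[OF e] by (simp add: dir_null_def)
    then have "negligible {t. c * t \<in> {s. \<eta> s \<in> P}}"
      using negligible_affine_preimage[of "{s. \<eta> s \<in> P}" c 0] c by simp
    moreover have "{t \<in> E e c m. \<lfloor>t * Suc m\<rfloor> = j \<and> \<gamma> t \<in> P} \<subseteq> {t. c * t \<in> {s. \<eta> s \<in> P}}"
    proof
      fix t assume t: "t \<in> {t \<in> E e c m. \<lfloor>t * Suc m\<rfloor> = j \<and> \<gamma> t \<in> P}"
      then have "\<eta> (c * t) = \<gamma> t" using \<zeta>(2)[of t] c by (simp add: \<eta>_def mult.commute)
      with t show "t \<in> {t. c * t \<in> {s. \<eta> s \<in> P}}" by simp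
    qed
    ultimately show ?thesis by (rule negligible_subset)
  qed
  define I where "I = N \<times> {c \<in> \<rat>. 0 < (c::real)} \<times> (UNIV :: nat set) \<times> (UNIV :: int set)"
  define W where "W = (\<lambda>(e, c, m, j). {t \<in> E e c m. \<lfloor>t * Suc m\<rfloor> = j \<and> \<gamma> t \<in> P})"
  have "countable {c \<in> \<rat>. 0 < (c::real)}"
    by (rule countable_subset[OF _ countable_rat]) auto
  then have "countable I" unfolding I_def using \<open>countable N\<close> by (intro countable_SIGMA) auto
  then have "negligible (\<Union>(W ` I))"
    using piece by (intro negligible_countable_Union) (auto simp: I_def W_def)
  moreover have "{t\<in>S. \<gamma> t \<in> P} \<subseteq> {t\<in>S. \<not> (\<exists>v. (\<gamma> has_vector_derivative v) (at t within S) \<and> v \<noteq> 0 \<and>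
                   (\<exists>e\<in>N. norm (v /\<^sub>R norm v - e) < \<sigma> / (2 * DIM('a))))} \<union> \<Union>(W ` I)" (is "_ \<subseteq> ?B \<union> _")
  proof
    fix t assume t: "t \<in> {t\<in>S. \<gamma> t \<in> P}"
    show "t \<in> ?B \<union> \<Union>(W ` I)"
    proof (cases "t \<in> ?B")
      case False
      with t obtain v e where v: "(\<gamma> has_vector_derivative v) (at t within S)" "v \<noteq> 0" "e \<in> N"
        "norm (v /\<^sub>R norm v - e) < \<tau> / 2"
        by (auto simp: \<tau>_def)
      \<comment> \<open>Of the allowance \<tau>, half goes to the direction and a quarter to
        replacing the speed by a rational; the positive remainder absorbs the error of
        differentiation.\<close>
      obtain c where c: "c \<in> \<rat>" "norm v < c" "c < norm v * (1 + \<tau> / 4)"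
        using Rats_dense_in_real[of "norm v" "norm v * (1 + \<tau> / 4)"] v \<tau> by (auto simp: distrib_left)
      have "norm (v - norm v *\<^sub>R e) = norm (norm v *\<^sub>R (v /\<^sub>R norm v - e))"
        using v(2) by (simp add: scaleR_diff_right)
      also have "\<dots> \<le> norm v * (\<tau> / 2)" using v by simp
      finally have "norm (v - c *\<^sub>R e) \<le> norm v * (\<tau> / 2) + norm ((norm v - c) *\<^sub>R e)"
        using norm_triangle_ineq[of "v - norm v *\<^sub>R e" "(norm v - c) *\<^sub>R e"] by (simp add: algebra_simps)
      also have "norm ((norm v - c) *\<^sub>R e) = c - norm v"
        using null[OF v(3)] c by simp
      finally have le: "norm (v - c *\<^sub>R e) \<le> norm v * \<tau> / 2 + (c - norm v)" by simp
      have "0 < norm v * \<tau>" "c < norm v + norm v * \<tau> / 4"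
        using v(2) \<tau>(1) c(3) by (simp_all add: distrib_left)
      with le have "norm (v - c *\<^sub>R e) < norm v * \<tau>" by linarith
      also have "\<dots> \<le> c * \<tau>" using c \<tau> by simp
      finally have \<epsilon>: "0 < c * \<tau> - norm (v - c *\<^sub>R e)" by simp
      obtain d where d: "0 < d" "\<And>u. u \<in> S \<Longrightarrow> norm (u - t) < d \<Longrightarrow>
          norm (\<gamma> u - \<gamma> t - (u - t) *\<^sub>R v) \<le> (c * \<tau> - norm (v - c *\<^sub>R e)) * norm (u - t)"
        using v(1) \<epsilon> unfolding has_vector_derivative_def has_derivative_within_alt by blast
      obtain m where m: "1 / real (Suc m) < d" using nat_approx_posE[of d] d(1) by blast
      have "t \<in> E e c m"
      proof -
        have "norm (\<gamma> u - \<gamma> t - (u - t) *\<^sub>R (c *\<^sub>R e)) \<le> c * \<tau> * \<bar>u - t\<bar>" if "u \<in> S" "\<bar>u - t\<bar> < 1 / Suc m" for u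
        proof -
          have "norm (\<gamma> u - \<gamma> t - (u - t) *\<^sub>R (c *\<^sub>R e)) \<le> norm (\<gamma> u - \<gamma> t - (u - t) *\<^sub>R v) + norm ((u - t) *\<^sub>R (v - c *\<^sub>R e))"
            using norm_triangle_ineq[of "\<gamma> u - \<gamma> t - (u - t) *\<^sub>R v" "(u - t) *\<^sub>R (v - c *\<^sub>R e)"] by (simp add: algebra_simps)
          also have "\<dots> \<le> (c * \<tau> - norm (v - c *\<^sub>R e)) * \<bar>u - t\<bar> + \<bar>u - t\<bar> * norm (v - c *\<^sub>R e)"
            using d(2)[OF that(1)] that(2) m by simp
          finally show ?thesis by (simp add: algebra_simps)
        qed
        then show ?thesis using t by (simp add: E_def)
      qed
      moreover have "0 < c" using c(2) norm_ge_zero[of v] by linarith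
      ultimately have "t \<in> W (e, c, m, \<lfloor>t * Suc m\<rfloor>)" "(e, c, m, \<lfloor>t * Suc m\<rfloor>) \<in> I"
        using t v(3) c(1) by (auto simp: W_def I_def)
      then show ?thesis by blast
    qed simp
  qed
  ultimately show ?thesis using deriv by (meson negligible_Un negligible_subset)
qed

text \<open>One cover must serve all directions at once. Finite intersections of F_sigma sets are
  again F_sigma, countable ones need not be; hence the finite nets of the sphere.\<close>

lemma finite_fsigma_cover:
  assumes "finite N" "\<And>e. e \<in> N \<Longrightarrow> dir_small e \<sigma> X"
  obtains F where "X \<subseteq> F" "fsigma_in euclidean F" "\<And>e. e \<in> N \<Longrightarrow> dir_null e \<sigma> F"
proof -
  have "\<exists>F. X \<subseteq> F \<and> fsigma_in euclidean F \<and> (\<forall>e\<in>N. dir_null e \<sigma> F)"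
    using assms
  proof (induction N)
    case empty
    have "fsigma_in euclidean (UNIV :: 'a set)"
      using fsigma_in_topspace[of "euclidean :: 'a topology"] by simp
    then show ?case by blast
  next
    case (insert e N)
    then obtain F where F: "X \<subseteq> F" "fsigma_in euclidean F" "\<forall>e\<in>N. dir_null e \<sigma> F" by auto
    obtain G where G: "X \<subseteq> G" "fsigma_in euclidean G" "dir_null e \<sigma> G"
      using insert.prems[of e] by (auto simp: dir_small_def)
    have "fsigma_in euclidean (F \<inter> G)" using F G by (intro fsigma_in_Int)
    then show ?case using F G by (intro exI[of _ "F \<inter> G"]) (auto intro: dir_null_subset)
  qed
  then show thesis using that by blast
qed

lemma sphere_net:
  assumes "0 < r"
  obtains N :: "'a::euclidean_space set" where "finite N" "N \<subseteq> sphere 0 1" "sphere 0 1 \<subseteq> (\<Union>e\<in>N. ball e r)"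
proof -
  have "(sphere 0 1 :: 'a set) \<subseteq> (\<Union>c\<in>sphere 0 1. ball c r)"
    using assms by (intro subsetI, rule_tac a = x in UN_I) auto
  then obtain N :: "'a set" where "N \<subseteq> sphere 0 1" "finite N" "sphere 0 1 \<subseteq> (\<Union>e\<in>N. ball e r)"
    using compactE_image[of "sphere 0 1 :: 'a set" "sphere 0 1" "\<lambda>e. ball e r"] by auto
  then show thesis using that by blast
qed

text \<open>A common cover for a finite net of directions is null on every Lipschitz curve, because
  almost every tangent, once normalised, is close to a net point.\<close>

lemma not_dir_small_if_not_covered:
  fixes A :: "'a::euclidean_space set"
  assumes "\<nexists>P. A \<subseteq> P \<and> fsigma_in euclidean P \<and> purely_unrectifiable P" "0 < \<sigma>"
  obtains e :: 'a where "norm e = 1" "\<not> dir_small e \<sigma> A"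
proof (rule ccontr)
  assume "\<not> thesis"
  then have sm: "dir_small e \<sigma> A" if "norm e = 1" for e :: 'a using that \<open>\<And>e. norm e = 1 \<Longrightarrow> \<not> dir_small e \<sigma> A \<Longrightarrow> thesis\<close> by blast
  obtain N :: "'a set" where N: "finite N" "N \<subseteq> sphere 0 1" "sphere 0 1 \<subseteq> (\<Union>e\<in>N. ball e (\<sigma> / (2 * DIM('a))))"
    using sphere_net[of "\<sigma> / (2 * DIM('a))"] \<open>0 < \<sigma>\<close> by auto
  obtain F where F: "A \<subseteq> F" "fsigma_in euclidean F" "\<And>e. e \<in> N \<Longrightarrow> dir_null e \<sigma> F"
    using finite_fsigma_cover[OF N(1), of \<sigma> A] sm N(2) by (metis mem_sphere_0 subsetD)
  have "purely_unrectifiable F"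
    unfolding purely_unrectifiable_def
  proof (intro allI impI)
    fix \<gamma> :: "real \<Rightarrow> 'a" assume "lipschitz_curve_on {0..1} \<gamma>"
    then obtain c where c: "c > 0" "AE t in lebesgue_on {0..1}.
        \<exists>v. (\<gamma> has_vector_derivative v) (at t within {0..1}) \<and> c \<le> norm v"
      unfolding lipschitz_curve_on_def by blast
    have "AE t in lebesgue. t \<in> {0..1} \<longrightarrow> (\<exists>v. (\<gamma> has_vector_derivative v) (at t within {0..1}) \<and> c \<le> norm v)"
      using c(2) by (subst (asm) AE_restrict_space_iff) auto
    then obtain Z where Z: "Z \<in> null_sets lebesgue"
      "{t. \<not> (t \<in> {0..1} \<longrightarrow> (\<exists>v. (\<gamma> has_vector_derivative v) (at t within {0..1}) \<and> c \<le> norm v))} \<subseteq> Z"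
      by (auto simp: eventually_ae_filter)
    have "negligible {t \<in> {0..1}. \<gamma> t \<in> F}"
    proof (rule negligible_curve_preimage[of N \<sigma>])
      show "countable N" using N(1) by (rule countable_finite)
      show "0 < \<sigma>" by fact
      show "norm e = 1 \<and> dir_null e \<sigma> F" if "e \<in> N" for e using N(2) F(3) that by auto
      have "{t\<in>{0..1}. \<not> (\<exists>v. (\<gamma> has_vector_derivative v) (at t within {0..1}) \<and> v \<noteq> 0 \<and>
                   (\<exists>e\<in>N. norm (v /\<^sub>R norm v - e) < \<sigma> / (2 * DIM('a))))} \<subseteq> Z"
      proof (rule subsetI, rule ccontr)
        fix t assume t: "t \<in> {t\<in>{0..1}. \<not> (\<exists>v. (\<gamma> has_vector_derivative v) (at t within {0..1}) \<and> v \<noteq> 0 \<and>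
                   (\<exists>e\<in>N. norm (v /\<^sub>R norm v - e) < \<sigma> / (2 * DIM('a))))}" "t \<notin> Z"
        then obtain v where v: "(\<gamma> has_vector_derivative v) (at t within {0..1})" "c \<le> norm v"
          using Z(2) by blast
        then have "v \<noteq> 0" using c by auto
        then have "v /\<^sub>R norm v \<in> sphere 0 1" by simp
        then obtain e where "e \<in> N" "v /\<^sub>R norm v \<in> ball e (\<sigma> / (2 * DIM('a)))" using N(3) by blast
        then have "e \<in> N" "norm (v /\<^sub>R norm v - e) < \<sigma> / (2 * DIM('a))" by (auto simp: dist_norm norm_minus_commute)
        then show False using t v \<open>v \<noteq> 0\<close> by blast
      qed
      then show "negligible {t\<in>{0..1}. \<not> (\<exists>v. (\<gamma> has_vector_derivative v) (at t within {0..1}) \<and> v \<noteq> 0 \<and>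
                   (\<exists>e\<in>N. norm (v /\<^sub>R norm v - e) < \<sigma> / (2 * DIM('a))))}"
        using Z(1) negligible_iff_null_sets negligible_subset by blast
    qed
    then show "{t \<in> {0..1}. \<gamma> t \<in> F} \<in> null_sets lebesgue" by (simp add: negligible_iff_null_sets)
  qed
  then show False using F assms(1) by blast
qed

lemma near_curve_lipschitz:
  assumes "\<gamma> \<in> near_curves e \<sigma>" "norm e = 1" "0 \<le> \<sigma>"
  shows "(1 + \<sigma>)-lipschitz_on UNIV \<gamma>"
proof (rule lipschitz_onI)
  fix s t
  have "norm (\<gamma> s - \<gamma> t) \<le> norm (\<gamma> s - \<gamma> t - (s - t) *\<^sub>R e) + norm ((s - t) *\<^sub>R e)"
    using norm_triangle_ineq[of "\<gamma> s - \<gamma> t - (s - t) *\<^sub>R e" "(s - t) *\<^sub>R e"] by simp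
  also have "\<dots> \<le> \<sigma> * \<bar>s - t\<bar> + \<bar>s - t\<bar>"
    using assms by (intro add_mono) (auto simp: near_curves_def)
  finally show "dist (\<gamma> s) (\<gamma> t) \<le> (1 + \<sigma>) * dist s t"
    by (simp add: dist_norm dist_real_def algebra_simps)
qed (use assms in simp)

lemma near_curve_derivative:
  assumes \<gamma>: "\<gamma> \<in> near_curves e \<sigma>" and v: "(\<gamma> has_vector_derivative v) (at t)"
  shows "norm (v - e) \<le> \<sigma>"
proof (rule field_le_epsilon)
  fix \<epsilon> :: real assume "0 < \<epsilon>"
  then obtain d where d: "0 < d" "\<And>u. norm (u - t) < d \<Longrightarrow> norm (\<gamma> u - \<gamma> t - (u - t) *\<^sub>R v) \<le> \<epsilon> * norm (u - t)"
    using v unfolding has_vector_derivative_def has_derivative_within_alt by blast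
  define h where "h = d / 2"
  have h: "0 < h" "h < d" using d(1) by (auto simp: h_def)
  have "norm (h *\<^sub>R (v - e)) \<le> norm (\<gamma> (t + h) - \<gamma> t - h *\<^sub>R e) + norm (\<gamma> (t + h) - \<gamma> t - h *\<^sub>R v)"
    using norm_triangle_ineq4[of "\<gamma> (t + h) - \<gamma> t - h *\<^sub>R e" "\<gamma> (t + h) - \<gamma> t - h *\<^sub>R v"]
    by (simp add: algebra_simps)
  also have "\<dots> \<le> \<sigma> * h + \<epsilon> * h"
  proof (rule add_mono)
    have "norm (\<gamma> (t + h) - \<gamma> t - (t + h - t) *\<^sub>R e) \<le> \<sigma> * \<bar>t + h - t\<bar>"
      using \<gamma> unfolding near_curves_def by blast
    then show "norm (\<gamma> (t + h) - \<gamma> t - h *\<^sub>R e) \<le> \<sigma> * h" using h by simp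
    show "norm (\<gamma> (t + h) - \<gamma> t - h *\<^sub>R v) \<le> \<epsilon> * h" using d(2)[of "t + h"] h by simp
  qed
  finally have "h * norm (v - e) \<le> h * (\<sigma> + \<epsilon>)"
    using h by (simp only: norm_scaleR) (simp add: algebra_simps)
  then show "norm (v - e) \<le> \<sigma> + \<epsilon>" using h by simp
qed

text \<open>Tangents v of curves in the cone around e satisfy |v - e| \<le> \<sigma>. Normalising v
  costs another \<sigma> and the net a third one, so net points within 3 \<sigma> of e account for
  all of these tangents.\<close>

lemma not_dir_small_refine:
  fixes e :: "'a::euclidean_space"
  assumes "\<not> dir_small e \<sigma> X" "norm e = 1" "0 < \<sigma>" "\<sigma> < 1" "0 < \<sigma>'"
  obtains e' :: 'a where "norm e' = 1" "norm (e' - e) \<le> 3 * \<sigma>" "\<not> dir_small e' \<sigma>' X"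
proof (rule ccontr)
  assume neg: "\<not> thesis"
  then have sm: "dir_small e' \<sigma>' X" if "norm e' = 1" "norm (e' - e) \<le> 3 * \<sigma>" for e' :: 'a
    using that \<open>\<And>e'. norm e' = 1 \<Longrightarrow> norm (e' - e) \<le> 3 * \<sigma> \<Longrightarrow> \<not> dir_small e' \<sigma>' X \<Longrightarrow> thesis\<close> by blast
  define r where "r = min \<sigma> (\<sigma>' / (2 * DIM('a)))"
  have r: "0 < r" using assms by (simp add: r_def)
  obtain N0 :: "'a set" where N0: "finite N0" "N0 \<subseteq> sphere 0 1" "sphere 0 1 \<subseteq> (\<Union>e\<in>N0. ball e r)"
    using sphere_net[OF r] by metis
  define N where "N = {e' \<in> N0. norm (e' - e) \<le> 3 * \<sigma>}"
  have "finite N" using N0(1) by (simp add: N_def)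
  moreover have "dir_small e' \<sigma>' X" if "e' \<in> N" for e' using that N0(2) sm by (auto simp: N_def)
  ultimately obtain F where F: "X \<subseteq> F" "fsigma_in euclidean F" "\<And>e. e \<in> N \<Longrightarrow> dir_null e \<sigma>' F"
    using finite_fsigma_cover[of N \<sigma>' X] by metis
  have "negligible {t. \<gamma> t \<in> F}" if \<gamma>: "\<gamma> \<in> near_curves e \<sigma>" for \<gamma>
  proof -
    have "negligible {t \<in> UNIV. \<gamma> t \<in> F}"
    proof (rule negligible_curve_preimage[of N \<sigma>'])
      show "countable N" using \<open>finite N\<close> by (rule countable_finite)
      show "0 < \<sigma>'" by fact
      show "norm e = 1 \<and> dir_null e \<sigma>' F" if "e \<in> N" for e using N0(2) F(3) that by (auto simp: N_def)
      have "{t\<in>UNIV. \<not> (\<exists>v. (\<gamma> has_vector_derivative v) (at t) \<and> v \<noteq> 0 \<and>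
                   (\<exists>e\<in>N. norm (v /\<^sub>R norm v - e) < \<sigma>' / (2 * DIM('a))))} \<subseteq> {t. \<not> \<gamma> differentiable (at t)}"
      proof (rule subsetI, rule ccontr)
        fix t assume t: "t \<in> {t\<in>UNIV. \<not> (\<exists>v. (\<gamma> has_vector_derivative v) (at t) \<and> v \<noteq> 0 \<and>
                   (\<exists>e\<in>N. norm (v /\<^sub>R norm v - e) < \<sigma>' / (2 * DIM('a))))}" "t \<notin> {t. \<not> \<gamma> differentiable (at t)}"
        then obtain v where v: "(\<gamma> has_vector_derivative v) (at t)"
          using vector_derivative_works by blast
        have ve: "norm (v - e) \<le> \<sigma>" using near_curve_derivative[OF \<gamma> v] .
        then have nv: "\<bar>norm v - 1\<bar> \<le> \<sigma>"
          using norm_triangle_ineq3[of v e] assms(2) by linarith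
        then have "v \<noteq> 0" using assms by auto
        then have "v /\<^sub>R norm v \<in> sphere 0 1" by simp
        then obtain e' where "e' \<in> N0" "v /\<^sub>R norm v \<in> ball e' r" using N0(3) by blast
        then have e': "e' \<in> N0" "norm (v /\<^sub>R norm v - e') < r"
          by (auto simp: dist_norm norm_minus_commute)
        have "norm (v /\<^sub>R norm v - v) = \<bar>norm v - 1\<bar>"
        proof -
          have "v /\<^sub>R norm v - v = (1 - norm v) *\<^sub>R (v /\<^sub>R norm v)"
            using \<open>v \<noteq> 0\<close> by (simp add: algebra_simps)
          then have "norm (v /\<^sub>R norm v - v) = \<bar>1 - norm v\<bar> * norm (v /\<^sub>R norm v)"
            by (simp only: norm_scaleR)
          then show ?thesis using \<open>v \<noteq> 0\<close> by simp
        qed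
        then have "norm (e' - e) \<le> r + \<sigma> + \<sigma>"
          using e'(2) ve nv norm_triangle_ineq[of "e' - v /\<^sub>R norm v" "v /\<^sub>R norm v - v + (v - e)"]
            norm_triangle_ineq[of "v /\<^sub>R norm v - v" "v - e"]
          by (simp add: norm_minus_commute[of e' "v /\<^sub>R norm v"])
        then have "e' \<in> N" using e' by (simp add: N_def r_def)
        moreover have "norm (v /\<^sub>R norm v - e') < \<sigma>' / (2 * DIM('a))" using e'(2) by (simp add: r_def)
        ultimately show False using t v \<open>v \<noteq> 0\<close> by blast
      qed
      then show "negligible {t\<in>UNIV. \<not> (\<exists>v. (\<gamma> has_vector_derivative v) (at t) \<and> v \<noteq> 0 \<and>
                   (\<exists>e\<in>N. norm (v /\<^sub>R norm v - e) < \<sigma>' / (2 * DIM('a))))}"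
        using lipschitz_curve_differentiable_ae[OF near_curve_lipschitz[OF \<gamma> assms(2)]] assms(3)
          negligible_subset by (meson less_imp_le)
    qed
    then show ?thesis by simp
  qed
  then have "dir_small e \<sigma> X" unfolding dir_small_def dir_null_def using F by blast
  then show False using assms(1) by blast
qed

text \<open>The analogue of the perfect kernel of the Cantor-Bendixson theorem, with the sigma-ideal
  \<open>dir_small e \<sigma>\<close> in place of the countable sets.\<close>

definition dir_kernel :: "'a::euclidean_space \<Rightarrow> real \<Rightarrow> 'a set \<Rightarrow> 'a set" where
  "dir_kernel e \<sigma> X = {x. \<forall>r>0. \<not> dir_small e \<sigma> (X \<inter> ball x r)}"

lemma closed_dir_kernel: "closed (dir_kernel e \<sigma> X)"
proof -
  have "open (- dir_kernel e \<sigma> X)"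
  proof (rule openI)
    fix x assume "x \<in> - dir_kernel e \<sigma> X"
    then obtain r where r: "r > 0" "dir_small e \<sigma> (X \<inter> ball x r)" by (auto simp: dir_kernel_def)
    have "ball x (r/2) \<subseteq> - dir_kernel e \<sigma> X"
    proof
      fix y assume "y \<in> ball x (r/2)"
      then have "ball y (r/2) \<subseteq> ball x r"
        by (simp add: ball_subset_ball_iff dist_commute)
      then have "dir_small e \<sigma> (X \<inter> ball y (r/2))"
        using r(2) by (rule_tac dir_small_subset) auto
      then show "y \<in> - dir_kernel e \<sigma> X" using r(1) by (auto simp: dir_kernel_def intro!: exI[of _ "r/2"])
    qed
    then show "\<exists>T>0. ball x T \<subseteq> - dir_kernel e \<sigma> X" using r(1) by (intro exI[of _ "r/2"]) auto
  qed
  then show ?thesis by (simp add: closed_def)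
qed

text \<open>By the Lindelof property countably many of the balls with small trace suffice, and small
  sets form a sigma-ideal.\<close>

lemma dir_small_Diff_kernel: "dir_small e \<sigma> (X - dir_kernel e \<sigma> X)"
proof -
  define \<B> where "\<B> = {ball x r |x r. dir_small e \<sigma> (X \<inter> ball x r)}"
  obtain \<B>' where B': "\<B>' \<subseteq> \<B>" "countable \<B>'" "\<Union>\<B>' = \<Union>\<B>"
    using Lindelof[of \<B>] by (auto simp: \<B>_def)
  have "dir_small e \<sigma> (\<Union>((\<inter>) X ` \<B>'))"
    using B' by (intro dir_small_Union) (auto simp: \<B>_def)
  moreover have "X - dir_kernel e \<sigma> X \<subseteq> \<Union>((\<inter>) X ` \<B>')"
  proof
    fix x assume "x \<in> X - dir_kernel e \<sigma> X"
    then obtain r where "x \<in> X" "r > 0" "dir_small e \<sigma> (X \<inter> ball x r)" by (auto simp: dir_kernel_def)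
    then have "x \<in> \<Union>\<B>" unfolding \<B>_def by (intro UnionI[of "ball x r"]) auto
    then show "x \<in> \<Union>((\<inter>) X ` \<B>')" using B'(3) \<open>x \<in> X\<close> by blast
  qed
  ultimately show ?thesis by (rule dir_small_subset)
qed

text \<open>Here closedness of the kernel meets the F_sigma form of the covers: a null kernel would
  cover itself, while the rest of \<open>X\<close> is small in any case.\<close>

lemma dir_kernel_not_null:
  assumes "\<not> dir_small e \<sigma> X"
  shows "\<not> dir_null e \<sigma> (dir_kernel e \<sigma> X)"
proof
  let ?K = "dir_kernel e \<sigma> X"
  assume "dir_null e \<sigma> ?K"
  then have "dir_small e \<sigma> ?K"
    unfolding dir_small_def using closed_dir_kernel
    by (meson closed_closedin closed_imp_fsigma_in subset_refl)
  then have "dir_small e \<sigma> (\<Union>{X - ?K, ?K})"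
    using dir_small_Diff_kernel[of e \<sigma> X] by (intro dir_small_Union) auto
  then show False using assms dir_small_subset by blast
qed

lemma density_interval:
  fixes T :: "real set"
  assumes T: "T \<in> sets lebesgue" "\<not> negligible T" and "0 < d"
  obtains a b where "a < b" "b - a < d" "9 / 10 * (b - a) < measure lebesgue (T \<inter> {a..b})"
proof (rule ccontr)
  assume neg: "\<not> thesis"
  have small: "measure lebesgue (T \<inter> {a..b}) \<le> 9 / 10 * (b - a)" if "a < b" "b - a < d" for a b
    using that neg \<open>\<And>a b. a < b \<Longrightarrow> b - a < d \<Longrightarrow> 9 / 10 * (b - a) < measure lebesgue (T \<inter> {a..b}) \<Longrightarrow> thesis\<close>
    by force
  have "negligible (T \<inter> cball 0 (real n))" for n :: nat
  proof -
    let ?E = "T \<inter> cball 0 (real n)"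
    have m: "?E \<in> lmeasurable"
      using T(1) fmeasurable_Int_fmeasurable[OF lmeasurable_cball, of T 0 "real n"]
      by (simp add: Int_commute)
    have "measure lebesgue ?E = 0"
    proof (rule fine_cover_imp_null[OF m, of "9/10"])
      fix x \<delta> :: real assume "x \<in> ?E" "0 < \<delta>"
      define q where "q = x + min d \<delta> / 2"
      have q: "x < q" "q - x < d" "q - x < \<delta>" using \<open>0 < d\<close> \<open>0 < \<delta>\<close> by (auto simp: q_def)
      have "measure lebesgue (?E \<inter> {x..q}) \<le> measure lebesgue (T \<inter> {x..q})"
        using T(1) m by (intro measure_mono_fmeasurable) (auto intro: fmeasurable_Int_fmeasurable simp: Int_commute[of T])
      also have "\<dots> \<le> 9 / 10 * (q - x)" using small q by auto
      finally show "\<exists>p q. p < q \<and> x \<in> {p..q} \<and> q - p < \<delta> \<and> measure lebesgue (?E \<inter> {p..q}) \<le> 9 / 10 * (q - p)"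
        using q by (intro exI[of _ x] exI[of _ q]) auto
    qed auto
    then show ?thesis using m by (simp add: negligible_iff_measure0)
  qed
  then have "negligible (\<Union>n::nat. T \<inter> cball 0 (real n))"
    by (intro negligible_countable_Union) auto
  moreover have "T \<subseteq> (\<Union>n::nat. T \<inter> cball 0 (real n))"
    using real_arch_simple by fastforce
  ultimately show False using T(2) negligible_subset by blast
qed

section \<open>Points of almost maximal growth\<close>

text \<open>\<open>q\<close> records how far \<open>u\<close> falls short of the maximal slope 1 +
  \<sigma>; its total increase is at most 3 \<sigma> (b - a). By the weak maximal inequality the
  points lying in an interval of deficit rate \<theta> have measure below 4/10 (b - a).
  \<open>T\<close> still has more than that after the outer quarters are removed, as 9/10 - 1/2 =
  4/10.\<close>

lemma good_point_on_line:
  fixes u :: "real \<Rightarrow> real"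
  assumes "a < b" "0 \<le> \<sigma>" "0 < \<theta>" "15 * \<sigma> < 4 / 10 * \<theta>"
    and lip: "\<And>s t. \<bar>u s - u t\<bar> \<le> (1 + \<sigma>) * \<bar>s - t\<bar>"
    and inc: "(1 - 2 * \<sigma>) * (b - a) \<le> u b - u a"
    and T: "T \<in> sets lebesgue" "9 / 10 * (b - a) < measure lebesgue (T \<inter> {a..b})"
  obtains t0 where "t0 \<in> T" "a + (b - a) / 4 \<le> t0" "t0 \<le> b - (b - a) / 4"
    "\<And>t. t0 \<le> t \<Longrightarrow> t \<le> b \<Longrightarrow> (1 + \<sigma> - \<theta>) * (t - t0) \<le> u t - u t0"
    "\<And>t. a \<le> t \<Longrightarrow> t \<le> t0 \<Longrightarrow> (1 + \<sigma> - \<theta>) * (t0 - t) \<le> u t0 - u t"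
proof -
  define q where "q t = (1 + \<sigma>) * t - u t" for t
  have "mono q"
  proof (rule monoI)
    fix s t :: real assume "s \<le> t"
    then show "q s \<le> q t" using lip[of t s] by (simp add: q_def abs_le_iff algebra_simps)
  qed
  then have mono: "mono_on {a..b} q" by (rule mono_on_subset) auto
  define B where "B = {t. \<exists>p q'. a \<le> p \<and> p < q' \<and> q' \<le> b \<and> t \<in> {p..q'} \<and> \<theta> * (q' - p) \<le> q q' - q p}"
  obtain M where M: "B \<subseteq> M" "M \<in> lmeasurable" "\<theta> * measure lebesgue M \<le> 5 * (q b - q a)"
    using weak_maximal_inequality[OF mono \<open>a < b\<close> \<open>0 < \<theta>\<close>, of B] unfolding B_def by blast
  have "q b - q a \<le> 3 * \<sigma> * (b - a)" using inc by (simp add: q_def algebra_simps)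
  then have "\<theta> * measure lebesgue M \<le> 15 * \<sigma> * (b - a)" using M(3) by simp
  also have "\<dots> < 4 / 10 * \<theta> * (b - a)" using assms by (intro mult_strict_right_mono) auto
  finally have "\<theta> * measure lebesgue M < \<theta> * (4 / 10 * (b - a))" by (simp add: mult_ac)
  then have Mle: "measure lebesgue M < 4 / 10 * (b - a)" using \<open>0 < \<theta>\<close> by simp
  define l where "l = (b - a) / 4"
  have l: "0 < l" "b - a = 4 * l" using \<open>a < b\<close> by (auto simp: l_def)
  let ?J = "{a + l..b - l}"
  have mT: "T \<inter> {c..d} \<in> lmeasurable" for c d
    using T(1) fmeasurable_Int_fmeasurable[of "{c..d}" lebesgue T] by (simp add: Int_commute)
  have "measure lebesgue (T \<inter> {a..b}) \<le> measure lebesgue ((T \<inter> ?J) \<union> ({a..a + l} \<union> {b - l..b}))"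
    using mT by (intro measure_mono_fmeasurable fmeasurable.Un) auto
  also have "\<dots> \<le> measure lebesgue (T \<inter> ?J) + measure lebesgue ({a..a + l} \<union> {b - l..b})"
    using mT by (intro measure_Un_le) auto
  also have "measure lebesgue ({a..a + l} \<union> {b - l..b}) \<le> measure lebesgue {a..a + l} + measure lebesgue {b - l..b}"
    by (intro measure_Un_le) auto
  also have "\<dots> = 2 * l" using l by simp
  finally have "4 / 10 * (b - a) < measure lebesgue (T \<inter> ?J)" using T(2) l by simp
  moreover have "measure lebesgue (T \<inter> ?J) \<le> measure lebesgue M" if "T \<inter> ?J \<subseteq> M"
    using that fmeasurableD[OF mT] M(2) by (rule measure_mono_fmeasurable)
  ultimately have "\<not> T \<inter> ?J \<subseteq> M" using Mle by linarith
  then obtain t0 where "t0 \<in> T \<inter> ?J" "t0 \<notin> M" by blast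
  then have t0: "t0 \<in> T" "a + l \<le> t0" "t0 \<le> b - l" "t0 \<notin> B" using M(1) by auto
  show thesis
  proof (rule that[of t0])
    show "t0 \<in> T" "a + (b - a) / 4 \<le> t0" "t0 \<le> b - (b - a) / 4" using t0 by (auto simp: l_def)
    have ge: "(1 + \<sigma> - \<theta>) * (d - c) \<le> u d - u c" if "a \<le> c" "c \<le> d" "d \<le> b" "t0 = c \<or> t0 = d" for c d
    proof (cases "c = d")
      case False
      then have "\<not> \<theta> * (d - c) \<le> q d - q c" using that t0(4) unfolding B_def by auto
      then show ?thesis by (simp add: q_def algebra_simps)
    qed simp
    show "(1 + \<sigma> - \<theta>) * (t - t0) \<le> u t - u t0" if "t0 \<le> t" "t \<le> b" for t
      using ge[of t0 t] that t0 l by simp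
    show "(1 + \<sigma> - \<theta>) * (t0 - t) \<le> u t0 - u t" if "a \<le> t" "t \<le> t0" for t
      using ge[of t t0] that t0 l by simp
  qed
qed

text \<open>After squaring, the two sides differ by exactly \<open>c\<^sup>2\<close>; the bound |w|
  \<le> T makes the right-hand side nonnegative.\<close>

lemma norm_add_scaled_le:
  fixes e w :: "'a::real_inner"
  assumes "norm e = 1" "0 < T" "norm w \<le> T"
  shows "norm (w + T *\<^sub>R e) \<le> T + e \<bullet> w + (norm w)\<^sup>2 / (2 * T)"
proof (rule power2_le_imp_le)
  define c where "c = e \<bullet> w + (norm w)\<^sup>2 / (2 * T)"
  have "(norm (w + T *\<^sub>R e))\<^sup>2 = (norm w)\<^sup>2 + 2 * T * (e \<bullet> w) + T\<^sup>2"
    using assms(1) unfolding power2_norm_eq_inner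
    by (simp add: inner_add_left inner_add_right inner_commute norm_eq_1 power2_eq_square algebra_simps)
  also have "\<dots> \<le> (T + c)\<^sup>2"
    using assms(2) zero_le_power2[of c] by (simp add: c_def power2_sum distrib_left)
  finally show "(norm (w + T *\<^sub>R e))\<^sup>2 \<le> (T + e \<bullet> w + (norm w)\<^sup>2 / (2 * T))\<^sup>2" by (simp add: c_def add.assoc)
  have "\<bar>e \<bullet> w\<bar> \<le> T" using Cauchy_Schwarz_ineq2[of e w] assms by simp
  moreover have "0 \<le> (norm w)\<^sup>2 / (2 * T)" using assms by simp
  ultimately show "0 \<le> T + e \<bullet> w + (norm w)\<^sup>2 / (2 * T)" by linarith
qed

text \<open>Compare \<open>x + w\<close> with the points \<open>x \<plusminus> T e\<close>, \<open>T = N |w|\<close>: the detour caused by the component of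
  \<open>w\<close> across \<open>e\<close> costs only \<open>|w|\<^sup>2 / (2 T)\<close>.\<close>
lemma almost_gradient_if_steep:
  fixes h :: "'a::real_inner \<Rightarrow> real"
  assumes lip: "1-lipschitz_on UNIV h" and e: "norm e = 1" and N: "1 \<le> N"
    and fwd: "\<And>s. 0 \<le> s \<Longrightarrow> s \<le> R \<Longrightarrow> (1 - 1 / N\<^sup>2) * s \<le> h (x + s *\<^sub>R e) - h x"
    and bwd: "\<And>s. 0 \<le> s \<Longrightarrow> s \<le> R \<Longrightarrow> (1 - 1 / N\<^sup>2) * s \<le> h x - h (x - s *\<^sub>R e)"
    and w: "N * norm w \<le> R"
  shows "\<bar>h (x + w) - h x - e \<bullet> w\<bar> \<le> 2 / N * norm w"
proof (cases "w = 0")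
  case False
  define T where "T = N * norm w"
  have T: "0 < T" "norm w \<le> T" "T \<le> R" using False N w by (auto simp: T_def)
  \<comment> \<open>With T = N |w| the slope deficit contributes |w|/N and the detour |w|/(2
    N).\<close>
  have err: "1 / N\<^sup>2 * T + (norm w)\<^sup>2 / (2 * T) \<le> 2 / N * norm w"
    using N False by (simp add: T_def power2_eq_square field_simps)
  have hl: "h y \<le> h z + norm (y - z)" for y z
    using lipschitz_onD[OF lip, of y z] by (simp add: dist_norm abs_le_iff)
  have "h (x + w) \<le> h (x - T *\<^sub>R e) + norm (w + T *\<^sub>R e)"
    using hl[of "x + w" "x - T *\<^sub>R e"] by (simp add: algebra_simps)
  also have "\<dots> \<le> h x - (1 - 1 / N\<^sup>2) * T + (T + e \<bullet> w + (norm w)\<^sup>2 / (2 * T))"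
    using bwd[of T] T norm_add_scaled_le[OF e T(1,2)] by simp
  finally have up: "h (x + w) - h x - e \<bullet> w \<le> 1 / N\<^sup>2 * T + (norm w)\<^sup>2 / (2 * T)"
    by (simp add: algebra_simps)
  have "h (x + T *\<^sub>R e) \<le> h (x + w) + norm (- w + T *\<^sub>R e)"
    using hl[of "x + T *\<^sub>R e" "x + w"] by (simp add: algebra_simps)
  also have "\<dots> \<le> h (x + w) + (T + e \<bullet> (- w) + (norm (- w))\<^sup>2 / (2 * T))"
    using norm_add_scaled_le[OF e T(1), of "- w"] T by simp
  finally have "h x + (1 - 1 / N\<^sup>2) * T \<le> h (x + w) + (T - e \<bullet> w + (norm w)\<^sup>2 / (2 * T))"
    using fwd[of T] T by simp
  then have "- (h (x + w) - h x - e \<bullet> w) \<le> 1 / N\<^sup>2 * T + (norm w)\<^sup>2 / (2 * T)"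
    by (simp add: algebra_simps)
  with up err show ?thesis by linarith
qed simp

lemma sets_lipschitz_preimage:
  fixes \<gamma> :: "real \<Rightarrow> 'a::euclidean_space"
  assumes "L-lipschitz_on UNIV \<gamma>" "closed K"
  shows "{t. \<gamma> t \<in> K} \<in> sets lebesgue"
proof -
  have "closed (\<gamma> -` K)"
    using lipschitz_on_continuous_on[OF assms(1)] assms(2)
    by (simp add: closed_vimage continuous_on_eq_continuous_at)
  then show ?thesis by (simp add: vimage_def borel_closed sets_completionI_sets)
qed

text \<open>Replacing the curve by the straight line along e costs \<sigma> s, exactly the excess of
  the slope 1 + \<sigma> - 1/N^2 over 1 - 1/N^2. The factor 50 in \<sigma> is chosen for
  \<open>good_point_on_line\<close> with \<theta> = 1/N^2, since 15/50 < 4/10.\<close>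

lemma good_point_on_curve:
  fixes h :: "'a::euclidean_space \<Rightarrow> real"
  assumes lip: "1-lipschitz_on UNIV h" and e: "norm e = 1" and N: "1 \<le> N"
    and \<sigma>: "\<sigma> = 1 / (50 * N\<^sup>2)"
    and \<gamma>: "\<gamma> \<in> near_curves e \<sigma>" and "a < b" and "closed K"
    and dens: "9 / 10 * (b - a) < measure lebesgue ({t. \<gamma> t \<in> K} \<inter> {a..b})"
    and inc: "(1 - 2 * \<sigma>) * (b - a) \<le> h (\<gamma> b) - h (\<gamma> a)"
  obtains t0 where "t0 \<in> {a..b}" "\<gamma> t0 \<in> K"
    "\<And>w. N * norm w \<le> (b - a) / 4 \<Longrightarrow> \<bar>h (\<gamma> t0 + w) - h (\<gamma> t0) - e \<bullet> w\<bar> \<le> 2 / N * norm w"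
proof -
  have \<sigma>0: "0 \<le> \<sigma>" "15 * \<sigma> < 4 / 10 * (1 / N\<^sup>2)" using N unfolding \<sigma> by (auto simp: field_simps)
  have \<gamma>lip: "(1 + \<sigma>)-lipschitz_on UNIV \<gamma>" by (rule near_curve_lipschitz[OF \<gamma> e \<sigma>0(1)])
  have nc: "norm (\<gamma> s - \<gamma> t - (s - t) *\<^sub>R e) \<le> \<sigma> * \<bar>s - t\<bar>" for s t
    using \<gamma> by (simp add: near_curves_def)
  have hl: "\<bar>h y - h z\<bar> \<le> norm (y - z)" for y z
    using lipschitz_onD[OF lip, of y z] by (simp add: dist_norm dist_real_def)
  have ulip: "\<bar>h (\<gamma> s) - h (\<gamma> t)\<bar> \<le> (1 + \<sigma>) * \<bar>s - t\<bar>" for s t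
    using hl[of "\<gamma> s" "\<gamma> t"] lipschitz_onD[OF \<gamma>lip, of s t] by (simp add: dist_norm dist_real_def)
  have T: "{t. \<gamma> t \<in> K} \<in> sets lebesgue" by (rule sets_lipschitz_preimage[OF \<gamma>lip \<open>closed K\<close>])
  have N2: "0 < 1 / N\<^sup>2" using N by simp
  obtain t0 where t0: "t0 \<in> {t. \<gamma> t \<in> K}" "a + (b - a) / 4 \<le> t0" "t0 \<le> b - (b - a) / 4"
    "\<And>t. t0 \<le> t \<Longrightarrow> t \<le> b \<Longrightarrow> (1 + \<sigma> - 1 / N\<^sup>2) * (t - t0) \<le> h (\<gamma> t) - h (\<gamma> t0)"
    "\<And>t. a \<le> t \<Longrightarrow> t \<le> t0 \<Longrightarrow> (1 + \<sigma> - 1 / N\<^sup>2) * (t0 - t) \<le> h (\<gamma> t0) - h (\<gamma> t)"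
    using good_point_on_line[of a b \<sigma> "1 / N\<^sup>2" "\<lambda>t. h (\<gamma> t)", OF \<open>a < b\<close> \<sigma>0(1) N2 \<sigma>0(2) ulip inc T dens] by blast
  show thesis
  proof (rule that)
    have "0 < (b - a) / 4" using \<open>a < b\<close> by simp
    then show "t0 \<in> {a..b}" using t0(2,3) unfolding atLeastAtMost_iff by linarith
    show "\<gamma> t0 \<in> K" using t0 by simp
    fix w :: 'a assume "N * norm w \<le> (b - a) / 4"
    then show "\<bar>h (\<gamma> t0 + w) - h (\<gamma> t0) - e \<bullet> w\<bar> \<le> 2 / N * norm w"
    proof (rule almost_gradient_if_steep[OF lip e N, rotated -1])
      fix s assume s: "0 \<le> s" "s \<le> (b - a) / 4"
      have "norm (\<gamma> (t0 + s) - (\<gamma> t0 + s *\<^sub>R e)) \<le> \<sigma> * s"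
        using nc[of "t0 + s" t0] s by (simp add: algebra_simps)
      moreover have "(1 + \<sigma> - 1 / N\<^sup>2) * s \<le> h (\<gamma> (t0 + s)) - h (\<gamma> t0)"
        using t0(4)[of "t0 + s"] t0(3) s by simp
      ultimately show "(1 - 1 / N\<^sup>2) * s \<le> h (\<gamma> t0 + s *\<^sub>R e) - h (\<gamma> t0)"
        using hl[of "\<gamma> (t0 + s)" "\<gamma> t0 + s *\<^sub>R e"] by (simp add: algebra_simps abs_le_iff)
      have "norm (\<gamma> (t0 - s) - (\<gamma> t0 - s *\<^sub>R e)) \<le> \<sigma> * s"
        using nc[of "t0 - s" t0] s by (simp add: algebra_simps)
      moreover have "(1 + \<sigma> - 1 / N\<^sup>2) * s \<le> h (\<gamma> t0) - h (\<gamma> (t0 - s))"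
        using t0(5)[of "t0 - s"] t0(2) s by simp
      ultimately show "(1 - 1 / N\<^sup>2) * s \<le> h (\<gamma> t0) - h (\<gamma> t0 - s *\<^sub>R e)"
        using hl[of "\<gamma> (t0 - s)" "\<gamma> t0 - s *\<^sub>R e"] by (simp add: algebra_simps abs_le_iff)
    qed
  qed
qed

section \<open>The Banach--Mazur game\<close>

definition close_on :: "'a set \<Rightarrow> real \<Rightarrow> ('a \<Rightarrow> real) \<Rightarrow> ('a \<Rightarrow> real) \<Rightarrow> bool" where
  "close_on S d f g \<longleftrightarrow> (\<forall>y\<in>S. \<bar>f y - g y\<bar> \<le> d)"

lemma close_on_mono: "close_on S d f g \<Longrightarrow> d \<le> d' \<Longrightarrow> close_on S d' f g"
  by (force simp: close_on_def)

lemma close_on_trans: "close_on S d f g \<Longrightarrow> close_on S d' g h \<Longrightarrow> close_on S (d + d') f h"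
  by (force simp: close_on_def)

text \<open>Nowhere density in \<open>Lip\<^sub>1\<close>, for functions not required to be extensional.\<close>
definition avoidable :: "('a::euclidean_space \<Rightarrow> real) set \<Rightarrow> bool" where
  "avoidable M \<longleftrightarrow> (\<forall>f \<epsilon>. 1-lipschitz_on (cbox 0 One) f \<longrightarrow> 0 < \<epsilon> \<longrightarrow>
     (\<exists>h \<eta>. 1-lipschitz_on (cbox 0 One) h \<and> 0 < \<eta> \<and> close_on (cbox 0 One) \<epsilon> h f \<and>
        (\<forall>k. 1-lipschitz_on (cbox 0 One) k \<longrightarrow> close_on (cbox 0 One) \<eta> k h \<longrightarrow>
             restrict k (cbox 0 One) \<notin> M)))"

definition cyl :: "(nat \<Rightarrow> nat) \<Rightarrow> nat \<Rightarrow> (nat \<Rightarrow> nat) set" where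
  "cyl z n = {y. \<forall>i<n. y i = z i}"

text \<open>Position after a move: all later functions stay within \<open>budget\<close> of \<open>fn\<close>, which is affine with
  gradient \<open>dir\<close> on the ball of radius \<open>rad\<close> around \<open>pt\<close>; the point of the analytic set sought has
  a code extending the first \<open>n\<close> entries of \<open>code\<close>; \<open>fn\<close> is almost affine around \<open>pt\<close> up to \<open>scale\<close>.\<close>
record 'a stage =
  fn :: "'a \<Rightarrow> real"
  budget :: real
  code :: "nat \<Rightarrow> nat"
  pt :: 'a
  rad :: real
  dir :: 'a
  scale :: real

text \<open>The cone width of \<open>good_point_on_curve\<close> for N = 2^n.\<close>

definition tol :: "nat \<Rightarrow> real" where "tol n = 1 / (50 * (2 ^ n)\<^sup>2)"

text \<open>With N = 2^n, a good point contributes 2/N, and turning the direction by at most 3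
  \<open>tol n\<close> \<le> 1/N adds the third part.\<close>

definition err :: "nat \<Rightarrow> real" where "err n = 3 / 2 ^ n"

text \<open>The piece of the analytic set is confined to the half ball, so its kernel lies there
  too, and a short curve meeting the kernel stays where \<open>fn\<close> is affine.\<close>

definition stage_inv :: "((nat \<Rightarrow> nat) \<Rightarrow> 'a::euclidean_space) \<Rightarrow> nat \<Rightarrow> 'a stage \<Rightarrow> bool" where
  "stage_inv g n s \<longleftrightarrow> 1-lipschitz_on UNIV (fn s) \<and> 0 < budget s \<and> 0 < rad s \<and>
     cball (pt s) (rad s) \<subseteq> box 0 One \<and> norm (dir s) = 1 \<and>
     (\<forall>y\<in>cball (pt s) (rad s). fn s y = fn s (pt s) + dir s \<bullet> (y - pt s)) \<and>
     \<not> dir_small (dir s) (tol n) (g ` cyl (code s) n \<inter> cball (pt s) (rad s / 2))"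

text \<open>Later functions stay within \<open>err n * scale s'\<close> of \<open>fn s\<close>,
  which is harmless at distances comparable with \<open>scale s'\<close> or larger; the last clause
  controls \<open>fn s'\<close> at distances up to \<open>scale s'\<close>. Together they leave no
  gap between consecutive scales.\<close>

definition stage_step :: "('a::euclidean_space \<Rightarrow> real) set \<Rightarrow> nat \<Rightarrow> 'a stage \<Rightarrow> 'a stage \<Rightarrow> bool" where
  "stage_step M n s s' \<longleftrightarrow>
     (\<forall>k. 1-lipschitz_on (cbox 0 One) k \<longrightarrow> close_on (cbox 0 One) (budget s') k (fn s') \<longrightarrow>
        restrict k (cbox 0 One) \<notin> M) \<and>
     (\<forall>k. close_on (cbox 0 One) (budget s') k (fn s') \<longrightarrow>
        close_on (cbox 0 One) (budget s) k (fn s) \<and> close_on (cbox 0 One) (err n * scale s') k (fn s)) \<and>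
     (\<forall>i<n. code s' i = code s i) \<and>
     cball (pt s') (rad s') \<subseteq> cball (pt s) (3 / 4 * rad s) \<and>
     norm (dir s' - dir s) \<le> 3 * tol n \<and>
     0 < scale s' \<and> scale s' \<le> rad s \<and> rad s' \<le> scale s' / 2 \<and>
     (\<forall>y\<in>cball (pt s') (scale s').
        \<bar>fn s' y - fn s' (pt s') - dir s' \<bullet> (y - pt s')\<bar> \<le> err n * norm (y - pt s'))"

lemma tol_pos: "0 < tol n" and tol_less_1: "tol n < 1" and tol_le_err: "3 * tol n \<le> 1 / 2 ^ n"
proof -
  have p: "1 \<le> (2::real) ^ n" by simp
  then have sq: "(2::real) ^ n \<le> (2 ^ n)\<^sup>2" by (simp add: power2_eq_square)
  show "0 < tol n" by (simp add: tol_def)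
  have "1 < 50 * ((2::real) ^ n)\<^sup>2" using sq p by linarith
  then show "tol n < 1" by (simp add: tol_def)
  have "3 * 2 ^ n \<le> 50 * ((2::real) ^ n)\<^sup>2" using sq p by linarith
  then show "3 * tol n \<le> 1 / 2 ^ n" by (simp add: tol_def field_simps)
qed

lemma dir_small_empty: "dir_small e \<sigma> {}"
  by (auto simp: dir_small_def dir_null_def intro!: exI[of _ "{}"])

lemma dir_kernel_subset_closed:
  assumes "X \<subseteq> C" "closed C"
  shows "dir_kernel e \<sigma> X \<subseteq> C"
proof
  fix y assume y: "y \<in> dir_kernel e \<sigma> X"
  show "y \<in> C"
  proof (rule ccontr)
    assume "y \<notin> C"
    then obtain r where "r > 0" "ball y r \<subseteq> - C"
      using \<open>closed C\<close> by (metis ComplI open_Compl openE)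
    then have "X \<inter> ball y r = {}" using assms by blast
    then have "dir_small e \<sigma> (X \<inter> ball y r)" by (simp add: dir_small_empty)
    then show False using y \<open>r > 0\<close> by (auto simp: dir_kernel_def)
  qed
qed

lemma truncate_to_affine:
  fixes h :: "'a::euclidean_space \<Rightarrow> real" and x :: 'a
  assumes lip: "1-lipschitz_on UNIV h" and e: "norm e = 1" and "0 < \<rho>"
  defines "l \<equiv> \<lambda>y. h x + e \<bullet> (y - x)"
  obtains f where "1-lipschitz_on UNIV f" "\<And>y. \<bar>f y - h y\<bar> \<le> \<rho>" "\<And>y. \<bar>f y - l y\<bar> \<le> \<bar>h y - l y\<bar>"
    "\<And>y. y \<in> cball x (\<rho> / 2) \<Longrightarrow> f y = l y"
proof -
  \<comment> \<open>the median of the three values lies between \<open>h\<close> and \<open>l\<close>\<close>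
  define f where "f y = max (h y - \<rho>) (min (l y) (h y + \<rho>))" for y
  have hl: "\<bar>h y - h z\<bar> \<le> norm (y - z)" for y z
    using lipschitz_onD[OF lip, of y z] by (simp add: dist_norm dist_real_def)
  have ll: "\<bar>l y - l z\<bar> \<le> norm (y - z)" for y z
  proof -
    have "l y - l z = e \<bullet> (y - z)" by (simp add: l_def inner_diff_right)
    then show ?thesis using Cauchy_Schwarz_ineq2[of e "y - z"] e by simp
  qed
  show thesis
  proof (rule that[of f])
    show "1-lipschitz_on UNIV f"
    proof (rule lipschitz_onI)
      show "dist (f y) (f z) \<le> 1 * dist y z" for y z
        using hl[of y z] ll[of y z] unfolding f_def dist_norm dist_real_def by (simp; linarith)
    qed simp
    show "\<bar>f y - h y\<bar> \<le> \<rho>" for y unfolding f_def using \<open>0 < \<rho>\<close> by linarith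
    show "\<bar>f y - l y\<bar> \<le> \<bar>h y - l y\<bar>" for y unfolding f_def using \<open>0 < \<rho>\<close> by linarith
    \<comment> \<open>Both \<open>h\<close> and \<open>l\<close> differ from \<open>h x\<close> by
      at most \<rho>/2 there, so \<open>l\<close> lies inside the band around
      \<open>h\<close>.\<close>
    show "f y = l y" if "y \<in> cball x (\<rho> / 2)" for y
    proof -
      have "norm (y - x) \<le> \<rho> / 2" using that by (simp add: dist_norm norm_minus_commute)
      moreover have "l x = h x" by (simp add: l_def)
      ultimately show ?thesis unfolding f_def using hl[of y x] ll[of y x] by linarith
    qed
  qed
qed

text \<open>The curve is chosen before the function that avoids \<open>M\<close>, so the
  perturbation can be made small against the length \<open>b - a\<close>; good point, new direction
  and code entry come afterwards and depend on the answer. The good point lies only in the kernel,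
  but every ball around it meets the piece \<open>X\<close> in a set that is not small, and this is
  what the next stage needs.\<close>

lemma stage_step_exists:
  fixes g :: "(nat \<Rightarrow> nat) \<Rightarrow> 'a::euclidean_space"
  assumes inv: "stage_inv g n s" and M: "avoidable M"
  shows "\<exists>s'. stage_inv g (Suc n) s' \<and> stage_step M n s s'"
proof -
  let ?Q = "cbox 0 One :: 'a set"
  define f \<beta> z x \<rho> e where "f = fn s" and "\<beta> = budget s" and "z = code s" and "x = pt s"
    and "\<rho> = rad s" and "e = dir s"
  note s_defs = f_def \<beta>_def z_def x_def \<rho>_def e_def
  define N :: real where "N = 2 ^ n"
  have N: "1 \<le> N" by (simp add: N_def)
  define \<sigma> where "\<sigma> = tol n"
  have \<sigma>: "\<sigma> = 1 / (50 * N\<^sup>2)" "0 < \<sigma>" "\<sigma> < 1" "3 * \<sigma> \<le> 1 / N"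
    using tol_pos tol_less_1 tol_le_err by (auto simp: \<sigma>_def N_def tol_def)
  have f: "1-lipschitz_on UNIV f" "0 < \<beta>" "0 < \<rho>" "cball x \<rho> \<subseteq> box 0 One" "norm e = 1"
    "\<And>y. y \<in> cball x \<rho> \<Longrightarrow> f y = f x + e \<bullet> (y - x)"
    "\<not> dir_small e \<sigma> (g ` cyl z n \<inter> cball x (\<rho> / 2))"
    using inv unfolding stage_inv_def s_defs \<sigma>_def by blast+
  define X where "X = g ` cyl z n \<inter> cball x (\<rho> / 2)"
  define K where "K = dir_kernel e \<sigma> X"
  have "closed K" unfolding K_def by (rule closed_dir_kernel)
  have KX: "K \<subseteq> cball x (\<rho> / 2)"
    unfolding K_def X_def by (rule dir_kernel_subset_closed) auto
  have "\<not> dir_null e \<sigma> K" unfolding K_def X_def by (rule dir_kernel_not_null[OF f(7)])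
  then obtain \<gamma> where \<gamma>: "\<gamma> \<in> near_curves e \<sigma>" "\<not> negligible {t. \<gamma> t \<in> K}" by (auto simp: dir_null_def)
  have \<gamma>lip: "(1 + \<sigma>)-lipschitz_on UNIV \<gamma>" using near_curve_lipschitz[OF \<gamma>(1) f(5)] \<sigma> by simp
  have T: "{t. \<gamma> t \<in> K} \<in> sets lebesgue" by (rule sets_lipschitz_preimage[OF \<gamma>lip \<open>closed K\<close>])
  obtain a b where ab: "a < b" "b - a < \<rho> / 8" "9 / 10 * (b - a) < measure lebesgue ({t. \<gamma> t \<in> K} \<inter> {a..b})"
    using density_interval[OF T \<gamma>(2), of "\<rho> / 8"] f(3) by auto
  have "{t. \<gamma> t \<in> K} \<inter> {a..b} \<noteq> {}"
  proof
    assume "{t. \<gamma> t \<in> K} \<inter> {a..b} = {}"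
    then show False using ab(1,3) by simp
  qed
  then obtain t1 where t1: "\<gamma> t1 \<in> K" "t1 \<in> {a..b}" by blast
  \<comment> \<open>The kernel point uses \<rho>/2; the curve moves at most \<rho>/4 from it, with
    Lipschitz constant at most 2 on a parameter interval shorter than \<rho>/8.\<close>
  have in_ball: "\<gamma> t \<in> cball x \<rho>" if "t \<in> {a..b}" for t
  proof -
    have "dist (\<gamma> t1) (\<gamma> t) \<le> (1 + \<sigma>) * dist t1 t" using lipschitz_onD[OF \<gamma>lip] by auto
    also have "\<dots> \<le> 2 * (\<rho> / 8)"
    proof (rule mult_mono)
      have "\<bar>t1 - t\<bar> \<le> b - a" using t1(2) that by auto
      then show "dist t1 t \<le> \<rho> / 8" using ab(2) unfolding dist_real_def by linarith
    qed (use \<sigma>(2,3) in auto)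
    finally have "dist (\<gamma> t1) (\<gamma> t) \<le> \<rho> / 4" by simp
    moreover have "dist x (\<gamma> t1) \<le> \<rho> / 2" using KX t1(1) by auto
    ultimately show ?thesis using dist_triangle[of x "\<gamma> t" "\<gamma> t1"] f(3) unfolding mem_cball by linarith
  qed
  \<comment> \<open>The radius within which the good point controls \<open>h\<close>, namely N |w|
    \<le> (b - a)/4.\<close>
  define r where "r = (b - a) / 4 / N"
  have r: "0 < r" "r \<le> \<rho>" "N * r = (b - a) / 4"
  proof -
    show "0 < r" unfolding r_def using N ab(1) by simp
    show "N * r = (b - a) / 4" unfolding r_def using N by simp
    have "(b - a) / 4 / N \<le> (b - a) / 4 / 1" using N ab(1) by (intro divide_left_mono) auto
    also have "\<dots> \<le> \<rho>" using ab(2) f(3) by simp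
    finally show "r \<le> \<rho>" by (simp only: r_def)
  qed
  have errp: "0 < err n" by (simp add: err_def)
  \<comment> \<open>The three bounds protect the old budget, the growth along the curve, and the
    relative error at distance \<open>r\<close>.\<close>
  define \<delta> where "\<delta> = min \<beta> (min (\<sigma> * (b - a)) (err n * r))"
  have \<delta>: "0 < \<delta>" "\<delta> \<le> \<beta>" "\<delta> \<le> \<sigma> * (b - a)" "\<delta> \<le> err n * r"
    using f(2) mult_pos_pos[OF \<sigma>(2), of "b - a"] ab(1) mult_pos_pos[OF errp r(1)] unfolding \<delta>_def by simp_all
  obtain h0 \<eta>0 where h0: "1-lipschitz_on ?Q h0" "0 < \<eta>0" "close_on ?Q (\<delta> / 2) h0 f"
    "\<And>k. 1-lipschitz_on ?Q k \<Longrightarrow> close_on ?Q \<eta>0 k h0 \<Longrightarrow> restrict k ?Q \<notin> M"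
  proof -
    have "1-lipschitz_on ?Q f" "0 < \<delta> / 2" using lipschitz_on_subset[OF f(1)] \<delta>(1) by auto
    then show thesis using M that unfolding avoidable_def by meson
  qed
  define \<eta> where "\<eta> = min \<eta>0 (\<delta> / 2)"
  have \<eta>: "0 < \<eta>" "\<eta> \<le> \<eta>0" "\<eta> \<le> \<delta> / 2" using h0(2) \<delta>(1) by (auto simp: \<eta>_def)
  obtain h where h: "1-lipschitz_on UNIV h" "\<And>y. y \<in> ?Q \<Longrightarrow> h y = h0 y"
    using lipschitz_extend_real[OF h0(1)] by blast
  have hf: "\<bar>h y - f y\<bar> \<le> \<delta> / 2" if "y \<in> ?Q" for y
    using h0(3) h(2)[OF that] that by (simp add: close_on_def)
  have Qball: "cball x \<rho> \<subseteq> ?Q" using f(4) box_subset_cbox by blast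
  have inc: "(1 - 2 * \<sigma>) * (b - a) \<le> h (\<gamma> b) - h (\<gamma> a)"
  proof -
    have ga: "\<gamma> a \<in> cball x \<rho>" "\<gamma> b \<in> cball x \<rho>" using in_ball ab(1) by auto
    have "f (\<gamma> b) - f (\<gamma> a) = e \<bullet> (\<gamma> b - \<gamma> a)"
      using f(6)[OF ga(1)] f(6)[OF ga(2)] by (simp add: inner_diff_right)
    also have "\<dots> = (b - a) + e \<bullet> (\<gamma> b - \<gamma> a - (b - a) *\<^sub>R e)"
      using f(5) by (simp add: inner_diff_right norm_eq_1)
    also have "\<dots> \<ge> (b - a) - \<sigma> * (b - a)"
    proof -
      have "norm (\<gamma> b - \<gamma> a - (b - a) *\<^sub>R e) \<le> \<sigma> * \<bar>b - a\<bar>"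
        using \<gamma>(1) unfolding near_curves_def by blast
      then show ?thesis
        using Cauchy_Schwarz_ineq2[of e "\<gamma> b - \<gamma> a - (b - a) *\<^sub>R e"] f(5) ab(1) by simp
    qed
    finally have "(b - a) - \<sigma> * (b - a) \<le> f (\<gamma> b) - f (\<gamma> a)" .
    moreover have "\<bar>h (\<gamma> a) - f (\<gamma> a)\<bar> \<le> \<delta> / 2" "\<bar>h (\<gamma> b) - f (\<gamma> b)\<bar> \<le> \<delta> / 2"
      using ga Qball hf by auto
    moreover have "(1 - 2 * \<sigma>) * (b - a) = (b - a) - \<sigma> * (b - a) - \<sigma> * (b - a)" by (simp add: algebra_simps)
    ultimately show ?thesis using \<delta>(3) by linarith
  qed
  obtain t0 where t0: "t0 \<in> {a..b}" "\<gamma> t0 \<in> K"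
    "\<And>w. N * norm w \<le> (b - a) / 4 \<Longrightarrow> \<bar>h (\<gamma> t0 + w) - h (\<gamma> t0) - e \<bullet> w\<bar> \<le> 2 / N * norm w"
    using good_point_on_curve[OF h(1) f(5) N \<sigma>(1) \<gamma>(1) ab(1) \<open>closed K\<close> ab(3) inc] by blast
  define x' where "x' = \<gamma> t0"
  \<comment> \<open>Within \<eta>/4 the truncated function is affine, r/2 separates this core from
    the scale, and \<rho>/4 keeps the new ball inside the ball of radius 3/4 \<rho>.\<close>
  define \<rho>' where "\<rho>' = min (\<eta> / 4) (min (r / 2) (\<rho> / 4))"
  have \<rho>': "0 < \<rho>'" "\<rho>' \<le> \<eta> / 4" "\<rho>' \<le> r / 2" "\<rho>' \<le> \<rho> / 4" using \<eta>(1) r(1) f(3) by (auto simp: \<rho>'_def)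
  have "\<not> dir_small e \<sigma> (X \<inter> ball x' (\<rho>' / 2))"
    using t0(2) \<rho>'(1) unfolding K_def dir_kernel_def x'_def by simp
  then obtain e' where e': "norm e' = 1" "norm (e' - e) \<le> 3 * \<sigma>"
    "\<not> dir_small e' (tol (Suc n)) (X \<inter> ball x' (\<rho>' / 2))"
    using not_dir_small_refine[OF _ f(5) \<sigma>(2,3) tol_pos[of "Suc n"]] by metis
  \<comment> \<open>Fixing one more entry of the code splits the piece into countably many parts,
    which cannot all be small.\<close>
  obtain j where j: "\<not> dir_small e' (tol (Suc n)) (g ` cyl (z(n := j)) (Suc n) \<inter> cball x' (\<rho>' / 2))"
  proof (rule ccontr)
    assume "\<not> thesis"
    then have "dir_small e' (tol (Suc n)) (g ` cyl (z(n := j)) (Suc n) \<inter> cball x' (\<rho>' / 2))" for j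
      using that by blast
    then have "dir_small e' (tol (Suc n)) (\<Union>(range (\<lambda>j. g ` cyl (z(n := j)) (Suc n) \<inter> cball x' (\<rho>' / 2))))"
      by (intro dir_small_Union) auto
    moreover have "X \<inter> ball x' (\<rho>' / 2) \<subseteq> \<Union>(range (\<lambda>j. g ` cyl (z(n := j)) (Suc n) \<inter> cball x' (\<rho>' / 2)))"
    proof
      fix p assume p: "p \<in> X \<inter> ball x' (\<rho>' / 2)"
      then obtain y where y: "y \<in> cyl z n" "p = g y" by (auto simp: X_def)
      then have "y \<in> cyl (z(n := y n)) (Suc n)" by (auto simp: cyl_def less_Suc_eq)
      then show "p \<in> \<Union>(range (\<lambda>j. g ` cyl (z(n := j)) (Suc n) \<inter> cball x' (\<rho>' / 2)))"
        using y p by (intro UN_I[of "y n"]) auto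
    qed
    ultimately show False using e'(3) dir_small_subset by blast
  qed
  obtain f' where f': "1-lipschitz_on UNIV f'" "\<And>y. \<bar>f' y - h y\<bar> \<le> \<eta> / 2"
    "\<And>y. \<bar>f' y - (h x' + e' \<bullet> (y - x'))\<bar> \<le> \<bar>h y - (h x' + e' \<bullet> (y - x'))\<bar>"
    "\<And>y. y \<in> cball x' (\<eta> / 2 / 2) \<Longrightarrow> f' y = h x' + e' \<bullet> (y - x')"
    using truncate_to_affine[OF h(1) e'(1), of "\<eta> / 2" x'] \<eta>(1) by auto
  have f'x: "f' x' = h x'" using f'(3)[of x'] by simp
  define s' where "s' = \<lparr>fn = f', budget = \<eta> / 2, code = z(n := j), pt = x', rad = \<rho>', dir = e', scale = r\<rparr>"
  have sub: "cball x' \<rho>' \<subseteq> cball x (3 / 4 * \<rho>)"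
  proof -
    have "dist x x' \<le> \<rho> / 2" using KX t0(2) by (auto simp: x'_def)
    then show ?thesis using \<rho>'(4) by (simp add: cball_subset_cball_iff dist_commute)
  qed
  have close: "close_on ?Q \<delta> k f \<and> close_on ?Q \<eta>0 k h0" if "close_on ?Q (\<eta> / 2) k f'" for k
  proof -
    have "\<bar>k y - h0 y\<bar> \<le> \<eta>" if "y \<in> ?Q" for y
    proof -
      have "\<bar>k y - f' y\<bar> \<le> \<eta> / 2" using \<open>close_on ?Q (\<eta> / 2) k f'\<close> that by (simp add: close_on_def)
      then show ?thesis using f'(2)[of y] h(2)[OF that] by linarith
    qed
    then have "close_on ?Q \<eta> k h0" by (simp add: close_on_def)
    then show ?thesis
      using close_on_mono[OF close_on_trans[OF _ h0(3)], of \<eta> k \<delta>] close_on_mono[of ?Q \<eta> k h0 \<eta>0] \<eta>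
      by simp
  qed
  have "stage_inv g (Suc n) s'"
  proof -
    have "cball x' \<rho>' \<subseteq> cball x \<rho>" using sub f(3) subset_cball[of "3/4 * \<rho>" \<rho> x] by auto
    then have "cball x' \<rho>' \<subseteq> box 0 One" using f(4) by blast
    moreover have "f' y = f' x' + e' \<bullet> (y - x')" if "y \<in> cball x' \<rho>'" for y
    proof -
      have "y \<in> cball x' (\<eta> / 2 / 2)" using that \<rho>'(2) by simp
      then show ?thesis using f'(4) f'x by simp
    qed
    moreover have "0 < \<eta> / 2" using \<eta>(1) by simp
    ultimately show ?thesis
      using f'(1) \<rho>'(1) e'(1) j unfolding stage_inv_def s'_def stage.select_convs by blast
  qed
  moreover have "stage_step M n s s'"
  proof -
    have z_upd: "\<forall>i<n. (z(n := j)) i = z i" by simp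
    have "\<bar>f' y - f' x' - e' \<bullet> (y - x')\<bar> \<le> err n * norm (y - x')" if "y \<in> cball x' r" for y
    proof -
      have nw: "norm (y - x') \<le> r" using that by (simp add: dist_norm norm_minus_commute)
      have "N * norm (y - x') \<le> N * r" using nw N by (intro mult_left_mono) auto
      then have "\<bar>h y - h x' - e \<bullet> (y - x')\<bar> \<le> 2 / N * norm (y - x')"
        using t0(3)[of "y - x'"] r(3) by (simp add: x'_def)
      moreover have "\<bar>(e' - e) \<bullet> (y - x')\<bar> \<le> 1 / N * norm (y - x')"
      proof -
        have "\<bar>(e' - e) \<bullet> (y - x')\<bar> \<le> norm (e' - e) * norm (y - x')" by (rule Cauchy_Schwarz_ineq2)
        also have "\<dots> \<le> 1 / N * norm (y - x')" using e'(2) \<sigma>(4) by (intro mult_right_mono) auto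
        finally show ?thesis .
      qed
      moreover have "(e' - e) \<bullet> (y - x') = e' \<bullet> (y - x') - e \<bullet> (y - x')" by (rule inner_diff_left)
      ultimately have "\<bar>h y - (h x' + e' \<bullet> (y - x'))\<bar> \<le> 2 / N * norm (y - x') + 1 / N * norm (y - x')"
        by linarith
      also have "\<dots> = err n * norm (y - x')" by (simp add: err_def N_def field_simps)
      finally show ?thesis using f'(3)[of y] f'x by linarith
    qed
    moreover have "restrict k ?Q \<notin> M" if "1-lipschitz_on ?Q k" "close_on ?Q (\<eta> / 2) k f'" for k
      using h0(4)[OF that(1)] close[OF that(2)] by blast
    moreover have "close_on ?Q \<beta> k f \<and> close_on ?Q (err n * r) k f" if "close_on ?Q (\<eta> / 2) k f'" for k
      using close[OF that] \<delta> close_on_mono by blast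
    ultimately show ?thesis
      using sub e'(2) r(1,2) \<rho>'(3) z_upd
      unfolding stage_step_def s'_def stage.select_convs s_defs \<sigma>_def by blast
  qed
  ultimately show ?thesis by blast
qed

section \<open>The limit of the game and its derivative\<close>

lemma affine_core_estimate:
  fixes F :: "'a::euclidean_space \<Rightarrow> real"
  assumes aff: "\<And>y. y \<in> cball p \<rho> \<Longrightarrow> F y = F p + e \<bullet> (y - p)"
    and est: "\<And>y. y \<in> cball p r \<Longrightarrow> \<bar>F y - F p - e \<bullet> (y - p)\<bar> \<le> c * norm (y - p)"
    and X: "X \<in> cball p (3 / 4 * \<rho>)" and "0 \<le> c" "0 < \<rho>" "\<rho> \<le> r / 2" and y: "norm (y - X) \<le> r / 2"
  shows "\<bar>F y - F X - e \<bullet> (y - X)\<bar> \<le> 4 * c * norm (y - X)"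
proof -
  have Xp: "norm (X - p) \<le> 3 / 4 * \<rho>" using X by (simp add: dist_norm norm_minus_commute)
  have FX: "F X = F p + e \<bullet> (X - p)" using aff[of X] X \<open>0 < \<rho>\<close> by simp
  have eq: "F y - F X - e \<bullet> (y - X) = F y - F p - e \<bullet> (y - p)"
    unfolding FX by (simp add: inner_diff_right)
  have tri: "norm (y - p) \<le> norm (y - X) + norm (X - p)"
    using norm_triangle_ineq[of "y - X" "X - p"] by simp
  show ?thesis
  proof (cases "y \<in> cball p \<rho>")
    case True
    then show ?thesis using aff[OF True] \<open>0 \<le> c\<close> unfolding eq by simp
  next
    case False
    then have yp: "\<rho> < norm (y - p)" by (simp add: dist_norm norm_minus_commute)
    \<comment> \<open>Outside the affine core y is farther than \<rho> from p, while X is within 3/4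
      \<rho> of p; so moving the centre from p to X costs at most a factor 4. Inside the core there
      is no error at all.\<close>
    have le: "norm (y - p) \<le> 4 * norm (y - X)" using tri Xp yp by linarith
    have "norm (y - p) \<le> r" using tri Xp y \<open>\<rho> \<le> r / 2\<close> \<open>0 < \<rho>\<close> by linarith
    then have "\<bar>F y - F p - e \<bullet> (y - p)\<bar> \<le> c * norm (y - p)"
      by (intro est) (simp add: dist_norm norm_minus_commute)
    also have "\<dots> \<le> c * (4 * norm (y - X))" using le \<open>0 \<le> c\<close> by (rule mult_left_mono)
    finally show ?thesis unfolding eq by (simp add: mult_ac)
  qed
qed

lemma tendsto_baire_cylinder:
  assumes "\<And>n. y n \<in> cyl Z n"
  shows "y \<longlonglongrightarrow> Z"
proof -
  have "limitin (product_topology (\<lambda>i. euclidean) UNIV) y Z sequentially"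
    unfolding limitin_componentwise
  proof (intro conjI ballI)
    fix i
    have "\<forall>\<^sub>F n in sequentially. y n i = Z i"
      using assms unfolding cyl_def eventually_sequentially by (intro exI[of _ "Suc i"]) auto
    then show "limitin euclidean (\<lambda>n. y n i) (Z i) sequentially"
      by (simp add: tendsto_eventually)
  qed auto
  then show ?thesis by (simp add: euclidean_product_topology)
qed

lemma convergent_geometric_steps:
  fixes e :: "nat \<Rightarrow> 'a::banach"
  assumes "\<And>n. norm (e (Suc n) - e n) \<le> 1 / 2 ^ n"
  shows "convergent e"
proof -
  have "summable (\<lambda>n. e (Suc n) - e n)"
  proof (rule summable_comparison_test)
    show "\<exists>N. \<forall>n\<ge>N. norm (e (Suc n) - e n) \<le> (1 / 2) ^ n"
      using assms by (simp add: power_one_over)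
  qed (simp add: summable_geometric)
  then have "convergent (\<lambda>n. \<Sum>i<n. e (Suc i) - e i)" by (simp add: summable_iff_convergent)
  then have "convergent (\<lambda>n. (e n - e 0) + e 0)"
    unfolding sum_lessThan_telescope by (intro convergent_add convergent_const)
  then show ?thesis by simp
qed

text \<open>The pieces of \<open>A\<close> are not closed, so the limit point is found through
  codes: it is \<open>g Z\<close> for the limiting code, because points of the cylinders lying in
  the shrinking balls converge to it by continuity of \<open>g\<close>. For the derivative, each
  distance from it is assigned to the stage that controls it.\<close>

lemma avoidable_sequence_missed:
  fixes A :: "'a::euclidean_space set" and g :: "(nat \<Rightarrow> nat) \<Rightarrow> 'a"
  assumes A: "A \<subseteq> box 0 One" and g: "continuous_on UNIV g" "range g = A"
    and nocover: "\<nexists>P. A \<subseteq> P \<and> fsigma_in euclidean P \<and> purely_unrectifiable P"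
    and M: "\<And>n. avoidable (M n)"
  obtains f x where "1-lipschitz_on (cbox 0 One) f" "\<And>n::nat. restrict f (cbox 0 One) \<notin> M n"
    "x \<in> A" "restrict f (cbox 0 One) differentiable (at x)"
proof -
  let ?Q = "cbox 0 One :: 'a set"
  obtain e0 :: 'a where e0: "norm e0 = 1" "\<not> dir_small e0 (tol 0) A"
    using not_dir_small_if_not_covered[OF nocover tol_pos] by blast
  \<comment> \<open>A starting point in \<open>A\<close> has a ball inside the open cube; other
    kernel points may lie on the boundary.\<close>
  have "A \<inter> dir_kernel e0 (tol 0) A \<noteq> {}"
  proof
    assume "A \<inter> dir_kernel e0 (tol 0) A = {}"
    then have "A - dir_kernel e0 (tol 0) A = A" by blast
    then show False using dir_small_Diff_kernel[of e0 "tol 0" A] e0(2) by simp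
  qed
  then obtain x0 where x0: "x0 \<in> A" "x0 \<in> dir_kernel e0 (tol 0) A" by blast
  obtain \<rho>0 where \<rho>0: "\<rho>0 > 0" "cball x0 \<rho>0 \<subseteq> box 0 One"
    using A x0(1) open_box open_contains_cball by (metis subsetD)
  have "\<not> dir_small e0 (tol 0) (A \<inter> ball x0 (\<rho>0 / 2))" using x0(2) \<rho>0(1) by (simp add: dir_kernel_def)
  then have small0: "\<not> dir_small e0 (tol 0) (A \<inter> cball x0 (\<rho>0 / 2))"
    using dir_small_subset[of e0 "tol 0" "A \<inter> cball x0 (\<rho>0 / 2)" "A \<inter> ball x0 (\<rho>0 / 2)"] ball_subset_cball by blast
  have "1-lipschitz_on UNIV (\<lambda>y. e0 \<bullet> y)"
  proof (rule lipschitz_onI)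
    show "dist (e0 \<bullet> y) (e0 \<bullet> z) \<le> 1 * dist y z" for y z
      using Cauchy_Schwarz_ineq2[of e0 "y - z"] e0(1) by (simp add: dist_norm inner_diff_right)
  qed simp
  moreover have "cyl (\<lambda>_. 0) 0 = UNIV" by (simp add: cyl_def)
  ultimately have "stage_inv g 0 \<lparr>fn = \<lambda>y. e0 \<bullet> y, budget = 1, code = \<lambda>_. 0, pt = x0, rad = \<rho>0, dir = e0, scale = 1\<rparr>"
    using \<rho>0 e0(1) small0 g(2) by (simp add: stage_inv_def inner_diff_right)
  then obtain S where S: "\<And>n. stage_inv g n (S n)" "\<And>n. stage_step (M n) n (S n) (S (Suc n))"
    using dependent_nat_choice[of "stage_inv g" "\<lambda>n. stage_step (M n) n"] stage_step_exists M by blast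
  define F \<beta> z x \<rho> e r where "F n = fn (S n)" and "\<beta> n = budget (S n)" and "z n = code (S n)" and "x n = pt (S n)"
    and "\<rho> n = rad (S n)" and "e n = dir (S n)" and "r n = scale (S n)" for n
  note S_defs = F_def \<beta>_def z_def x_def \<rho>_def e_def r_def
  have inv: "1-lipschitz_on UNIV (F n)" "0 < \<beta> n" "0 < \<rho> n" "cball (x n) (\<rho> n) \<subseteq> box 0 One"
    "\<And>y. y \<in> cball (x n) (\<rho> n) \<Longrightarrow> F n y = F n (x n) + e n \<bullet> (y - x n)"
    "\<not> dir_small (e n) (tol n) (g ` cyl (z n) n \<inter> cball (x n) (\<rho> n / 2))" for n
    using S(1)[of n] unfolding stage_inv_def S_defs by blast+
  have avoid: "\<And>k. 1-lipschitz_on ?Q k \<Longrightarrow> close_on ?Q (\<beta> (Suc n)) k (F (Suc n)) \<Longrightarrow> restrict k ?Q \<notin> M n"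
    and near: "\<And>k. close_on ?Q (\<beta> (Suc n)) k (F (Suc n)) \<Longrightarrow> close_on ?Q (\<beta> n) k (F n)"
      "\<And>k. close_on ?Q (\<beta> (Suc n)) k (F (Suc n)) \<Longrightarrow> close_on ?Q (err n * r (Suc n)) k (F n)"
    and zs: "\<And>i. i < n \<Longrightarrow> z (Suc n) i = z n i"
    and nest: "cball (x (Suc n)) (\<rho> (Suc n)) \<subseteq> cball (x n) (3 / 4 * \<rho> n)"
    and es: "norm (e (Suc n) - e n) \<le> 3 * tol n"
    and rs: "0 < r (Suc n)" "r (Suc n) \<le> \<rho> n" "\<rho> (Suc n) \<le> r (Suc n) / 2"
    and est: "\<And>y. y \<in> cball (x (Suc n)) (r (Suc n)) \<Longrightarrow>
        \<bar>F (Suc n) y - F (Suc n) (x (Suc n)) - e (Suc n) \<bullet> (y - x (Suc n))\<bar> \<le> err n * norm (y - x (Suc n))" for n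
    using S(2)[of n] unfolding stage_step_def S_defs by blast+
  have err0: "0 < err n" for n by (simp add: err_def)
  have errlim: "err \<longlonglongrightarrow> 0"
    unfolding err_def[abs_def] using tendsto_mult[OF tendsto_const LIMSEQ_inverse_realpow_zero[of 2], of 3]
    by (simp add: divide_inverse power_inverse)
  have \<rho>dec: "\<rho> n \<le> \<rho> 0 / 2 ^ n" for n
  proof (induction n)
    case (Suc n)
    have "\<rho> (Suc n) \<le> \<rho> n / 2" using rs[of n] by linarith
    then show ?case using Suc by simp
  qed simp
  have \<rho>lim: "\<rho> \<longlonglongrightarrow> 0"
  proof (rule tendsto_sandwich[OF _ _ tendsto_const])
    show "(\<lambda>n. \<rho> 0 / 2 ^ n) \<longlonglongrightarrow> 0"
      using tendsto_mult[OF tendsto_const LIMSEQ_inverse_realpow_zero[of 2], of "\<rho> 0"]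
      by (simp add: divide_inverse power_inverse)
  qed (use \<rho>dec inv(3) in \<open>auto simp: less_imp_le\<close>)
  have rlim: "(\<lambda>n. r (Suc n)) \<longlonglongrightarrow> 0"
    by (rule tendsto_sandwich[OF _ _ tendsto_const \<rho>lim]) (use rs in \<open>auto simp: less_imp_le\<close>)
  have nested: "cball (x m) (\<rho> m) \<subseteq> cball (x n) (\<rho> n)" if "n \<le> m" for n m
  proof (rule lift_Suc_antimono_le[OF _ that])
    show "cball (x (Suc n)) (\<rho> (Suc n)) \<subseteq> cball (x n) (\<rho> n)" for n
      using nest[of n] inv(3)[of n] subset_cball[of "3 / 4 * \<rho> n" "\<rho> n" "x n"] by auto
  qed
  have zc: "z m i = z n i" if "i < n" "n \<le> m" for i n m
    using that(2) by (induction rule: dec_induct) (use zs that(1) in auto)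
  \<comment> \<open>Entry \<open>i\<close> is settled on reaching stage \<open>Suc i\<close> and
    kept from then on.\<close>
  define Z where "Z i = z (Suc i) i" for i
  have cylZ: "cyl (z n) n = cyl Z n" for n
    using zc[of _ _ n] unfolding cyl_def Z_def by (metis Suc_leI lessI)
  have "\<exists>y. y \<in> cyl Z n \<and> g y \<in> cball (x n) (\<rho> n / 2)" for n
  proof (rule ccontr)
    assume "\<not> ?thesis"
    then have "g ` cyl (z n) n \<inter> cball (x n) (\<rho> n / 2) = {}" unfolding cylZ by blast
    then show False using inv(6)[of n] dir_small_empty by metis
  qed
  then obtain y where y: "\<And>n. y n \<in> cyl Z n" "\<And>n. g (y n) \<in> cball (x n) (\<rho> n / 2)" by metis
  define X where "X = g Z"
  have "(\<lambda>n. g (y n)) \<longlonglongrightarrow> X"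
    unfolding X_def using continuous_on_tendsto_compose[OF g(1) tendsto_baire_cylinder[of y Z]] y(1) by simp
  moreover have "(\<lambda>n. x n - g (y n)) \<longlonglongrightarrow> 0"
  proof -
    have "(\<lambda>n. dist (x n) (g (y n))) \<longlonglongrightarrow> 0"
    proof (rule tendsto_sandwich[OF _ _ tendsto_const \<rho>lim])
      have "dist (x n) (g (y n)) \<le> \<rho> n" for n using y(2)[of n] inv(3)[of n] by simp
      then show "\<forall>\<^sub>F n in sequentially. dist (x n) (g (y n)) \<le> \<rho> n" by simp
    qed simp
    then show ?thesis unfolding dist_norm by (rule tendsto_norm_zero_cancel)
  qed
  ultimately have xX: "x \<longlonglongrightarrow> X" by (rule Lim_transform)
  have Xin: "X \<in> cball (x n) (3 / 4 * \<rho> n)" for n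
  proof (rule Lim_in_closed_set[OF closed_cball _ _ xX])
    have "x m \<in> cball (x n) (3 / 4 * \<rho> n)" if "Suc n \<le> m" for m
      using nested[OF that] nest[of n] inv(3)[of m] by (auto simp: subset_iff)
    then show "\<forall>\<^sub>F m in sequentially. x m \<in> cball (x n) (3 / 4 * \<rho> n)"
      unfolding eventually_sequentially by blast
  qed simp
  have XA: "X \<in> A" using g(2) by (auto simp: X_def)
  have chain: "close_on ?Q (\<beta> n) k (F n)" if "n \<le> m" "close_on ?Q (\<beta> m) k (F m)" for n m k
    using that by (induction rule: dec_induct) (use near(1) in auto)
  have selfc: "close_on ?Q (\<beta> m) (F m) (F m)" for m using inv(2)[of m] by (simp add: close_on_def)
  have step: "\<bar>F m y - F n y\<bar> \<le> err n * r (Suc n)" if "Suc n \<le> m" "y \<in> ?Q" for n m y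
    using near(2)[OF chain[OF that(1) selfc]] that(2) by (simp add: close_on_def)
  have stepb: "\<bar>F m y - F n y\<bar> \<le> \<beta> n" if "n \<le> m" "y \<in> ?Q" for n m y
    using chain[OF that(1) selfc] that(2) by (simp add: close_on_def)
  have gap: "(\<lambda>n. err n * r (Suc n)) \<longlonglongrightarrow> 0" using tendsto_mult[OF errlim rlim] by simp
  have "convergent (\<lambda>n. F n y)" if "y \<in> ?Q" for y
  proof (rule Cauchy_convergent, rule metric_CauchyI)
    fix \<epsilon> :: real assume "0 < \<epsilon>"
    then have "\<forall>\<^sub>F n in sequentially. err n * r (Suc n) < \<epsilon> / 2" using gap by (intro order_tendstoD) auto
    then obtain n where n: "err n * r (Suc n) < \<epsilon> / 2" unfolding eventually_sequentially by blast
    show "\<exists>M. \<forall>m\<ge>M. \<forall>k\<ge>M. dist (F m y) (F k y) < \<epsilon>"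
    proof (intro exI allI impI)
      fix m k assume "Suc n \<le> m" "Suc n \<le> k"
      then show "dist (F m y) (F k y) < \<epsilon>"
        using step[of n m y] step[of n k y] that n unfolding dist_real_def by linarith
    qed
  qed
  then obtain f where flim: "\<And>y. y \<in> ?Q \<Longrightarrow> (\<lambda>n. F n y) \<longlonglongrightarrow> f y" unfolding convergent_def by metis
  have fstep: "\<bar>f y - F n y\<bar> \<le> err n * r (Suc n)" if "y \<in> ?Q" for n y
  proof (rule tendsto_upperbound)
    show "(\<lambda>m. \<bar>F m y - F n y\<bar>) \<longlonglongrightarrow> \<bar>f y - F n y\<bar>" using flim[OF that] by (intro tendsto_intros)
    show "\<forall>\<^sub>F m in sequentially. \<bar>F m y - F n y\<bar> \<le> err n * r (Suc n)"
      unfolding eventually_sequentially using step that by blast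
  qed simp
  have fb: "close_on ?Q (\<beta> n) f (F n)" for n
    unfolding close_on_def
  proof
    fix y assume "y \<in> ?Q"
    show "\<bar>f y - F n y\<bar> \<le> \<beta> n"
    proof (rule tendsto_upperbound)
      show "(\<lambda>m. \<bar>F m y - F n y\<bar>) \<longlonglongrightarrow> \<bar>f y - F n y\<bar>" using flim[OF \<open>y \<in> ?Q\<close>] by (intro tendsto_intros)
      show "\<forall>\<^sub>F m in sequentially. \<bar>F m y - F n y\<bar> \<le> \<beta> n"
        unfolding eventually_sequentially using stepb \<open>y \<in> ?Q\<close> by blast
    qed simp
  qed
  have flip: "1-lipschitz_on ?Q f"
  proof (rule lipschitz_onI)
    fix y w assume yw: "y \<in> ?Q" "w \<in> ?Q"
    show "dist (f y) (f w) \<le> 1 * dist y w"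
    proof (rule tendsto_upperbound)
      show "(\<lambda>m. dist (F m y) (F m w)) \<longlonglongrightarrow> dist (f y) (f w)" using flim yw by (intro tendsto_intros) auto
      have "dist (F m y) (F m w) \<le> 1 * dist y w" for m using lipschitz_onD[OF inv(1)] by blast
      then show "\<forall>\<^sub>F m in sequentially. dist (F m y) (F m w) \<le> 1 * dist y w" by simp
    qed simp
  qed simp
  have "norm (e (Suc n) - e n) \<le> 1 / 2 ^ n" for n using es[of n] tol_le_err[of n] by linarith
  then obtain E where Elim: "e \<longlonglongrightarrow> E" using convergent_geometric_steps[of e] by (auto simp: convergent_def)
  have "(restrict f ?Q has_derivative (\<lambda>w. E \<bullet> w)) (at X)"
    unfolding has_derivative_at_alt
  proof (intro conjI allI impI)
    show "bounded_linear ((\<bullet>) E)" by (rule bounded_linear_inner_right)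
    fix \<epsilon> :: real assume "0 < \<epsilon>"
    have "(\<lambda>n. 4 * err n + 4 * err (Suc n) + norm (e (Suc n) - E)) \<longlonglongrightarrow> 4 * 0 + 4 * 0 + norm (E - E)"
      using errlim Elim by (intro tendsto_intros LIMSEQ_Suc)
    then have "\<forall>\<^sub>F n in sequentially. 4 * err n + 4 * err (Suc n) + norm (e (Suc n) - E) < \<epsilon>"
      using \<open>0 < \<epsilon>\<close> by (intro order_tendstoD) auto
    then obtain n0 where n0: "\<And>n. n0 \<le> n \<Longrightarrow> 4 * err n + 4 * err (Suc n) + norm (e (Suc n) - E) < \<epsilon>"
      unfolding eventually_sequentially by blast
    have "X \<in> box 0 One" using XA A by blast
    then obtain d0 where d0: "d0 > 0" "ball X d0 \<subseteq> box 0 One" using open_contains_ball[of "box 0 (One::'a)"] by auto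
    define d where "d = min d0 (r (Suc n0) / 2)"
    have d: "0 < d" "d \<le> d0" "d \<le> r (Suc n0) / 2" using d0(1) rs(1)[of n0] by (auto simp: d_def)
    show "\<exists>d>0. \<forall>y. norm (y - X) < d \<longrightarrow>
        norm (restrict f ?Q y - restrict f ?Q X - E \<bullet> (y - X)) \<le> \<epsilon> * norm (y - X)"
    proof (intro exI[of _ d] conjI allI impI)
      show "0 < d" by fact
      fix y assume yd: "norm (y - X) < d"
      then have "y \<in> ball X d0" using d(2) by (simp add: dist_norm norm_minus_commute)
      then have Q: "y \<in> ?Q" "X \<in> ?Q" using d0(2) \<open>X \<in> box 0 One\<close> box_subset_cbox by blast+
      show "norm (restrict f ?Q y - restrict f ?Q X - E \<bullet> (y - X)) \<le> \<epsilon> * norm (y - X)"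
      proof (cases "y = X")
        case False
        define D where "D = norm (y - X)"
        have "0 < D" using False by (simp add: D_def)
        \<comment> \<open>The least such \<open>j\<close> yields r (Suc (Suc j)) / 2 < D \<le> r
          (Suc j) / 2, the window governed by stage \<open>Suc j\<close>: the limit is within O(err
          (Suc j) D) of that function, which is itself almost affine there.\<close>
        have "\<exists>j\<ge>n0. r (Suc (Suc j)) / 2 < D"
        proof -
          have "\<forall>\<^sub>F j in sequentially. r (Suc (Suc j)) < 2 * D"
            using LIMSEQ_Suc[OF rlim] \<open>0 < D\<close> by (intro order_tendstoD) auto
          then obtain j0 where "\<And>j. j0 \<le> j \<Longrightarrow> r (Suc (Suc j)) < 2 * D" unfolding eventually_sequentially by blast
          from this[of "max j0 n0"] show ?thesis by (intro exI[of _ "max j0 n0"]) auto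
        qed
        then obtain j where j: "n0 \<le> j" "r (Suc (Suc j)) / 2 < D"
          "\<And>i. i < j \<Longrightarrow> \<not> (n0 \<le> i \<and> r (Suc (Suc i)) / 2 < D)"
          using exists_least_iff[of "\<lambda>j. n0 \<le> j \<and> r (Suc (Suc j)) / 2 < D"] by blast
        have Dle: "D \<le> r (Suc j) / 2"
        proof (cases "j = n0")
          case True
          then show ?thesis using yd d(3) by (simp add: D_def)
        next
          case False
          then obtain i where "j = Suc i" "n0 \<le> i" using j(1) by (cases j) auto
          then show ?thesis using j(3)[of i] by auto
        qed
        let ?F = "F (Suc j)" and ?e = "e (Suc j)"
        have 1: "\<bar>?F y - ?F X - ?e \<bullet> (y - X)\<bar> \<le> 4 * err j * D"
          unfolding D_def
        proof (rule affine_core_estimate[OF inv(5) est Xin])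
          show "0 \<le> err j" "0 < \<rho> (Suc j)" "\<rho> (Suc j) \<le> r (Suc j) / 2"
            using err0[of j] inv(3) rs(3) by (auto simp: less_imp_le)
          show "norm (y - X) \<le> r (Suc j) / 2" using Dle by (simp add: D_def)
        qed
        have "err (Suc j) * r (Suc (Suc j)) \<le> err (Suc j) * (2 * D)"
          using j(2) err0[of "Suc j"] by (intro mult_left_mono) auto
        then have 2: "\<bar>f y - ?F y\<bar> \<le> 2 * err (Suc j) * D" "\<bar>f X - ?F X\<bar> \<le> 2 * err (Suc j) * D"
          using fstep[OF Q(1), of "Suc j"] fstep[OF Q(2), of "Suc j"] by (simp_all add: mult_ac)
        have 3: "\<bar>(?e - E) \<bullet> (y - X)\<bar> \<le> norm (?e - E) * D"
          unfolding D_def by (rule Cauchy_Schwarz_ineq2)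
        have 4: "E \<bullet> (y - X) = ?e \<bullet> (y - X) - (?e - E) \<bullet> (y - X)" by (simp add: inner_diff_left)
        have "\<bar>f y - f X - E \<bullet> (y - X)\<bar> \<le> 4 * err j * D + 2 * err (Suc j) * D + 2 * err (Suc j) * D + norm (?e - E) * D"
          unfolding 4 using 1 2 3 by linarith
        also have "\<dots> = (4 * err j + 4 * err (Suc j) + norm (?e - E)) * D" by (simp add: algebra_simps)
        also have "\<dots> \<le> \<epsilon> * D" using n0[OF j(1)] \<open>0 < D\<close> by (intro mult_right_mono) auto
        finally show ?thesis using Q by (simp add: D_def)
      qed simp
    qed
  qed
  then have "restrict f ?Q differentiable (at X)" by (rule differentiableI)
  then show thesis using that flip avoid[OF flip fb] XA by blast
qed

section \<open>Steepness of typical functions\<close>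

lemma lipschitz_bounded_cube:
  fixes f :: "'a::euclidean_space \<Rightarrow> real"
  assumes "1-lipschitz_on (cbox 0 One) f"
  obtains B where "0 < B" "\<And>y. y \<in> cbox 0 One \<Longrightarrow> \<bar>f y\<bar> \<le> B"
proof -
  have "compact (f ` cbox 0 One)"
    by (intro compact_continuous_image lipschitz_on_continuous_on[OF assms] compact_cbox)
  then obtain B where "B > 0" "\<forall>v \<in> f ` cbox 0 One. norm v \<le> B"
    using compact_imp_bounded bounded_pos by metis
  then show thesis using that by auto
qed

lemma small_factor:
  fixes B \<epsilon> :: real
  assumes "0 < B" "0 < \<epsilon>"
  obtains \<delta> where "0 < \<delta>" "\<delta> < 1" "\<delta> * B \<le> \<epsilon> / 2"
proof
  let ?\<delta> = "min (1 / 2) (\<epsilon> / (2 * B))"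
  show "0 < ?\<delta>" "?\<delta> < 1" using assms by (auto simp: min_def)
  have "?\<delta> * B \<le> \<epsilon> / (2 * B) * B" using assms by (intro mult_right_mono) auto
  then show "?\<delta> * B \<le> \<epsilon> / 2" using assms by simp
qed

lemma finite_separated:
  fixes Z :: "'a::metric_space set"
  assumes "finite Z"
  obtains d where "0 < d" "\<And>z z'. z \<in> Z \<Longrightarrow> z' \<in> Z \<Longrightarrow> z \<noteq> z' \<Longrightarrow> d \<le> dist z z'"
proof -
  \<comment> \<open>The extra 1 keeps \<open>D\<close> nonempty when \<open>Z\<close> has at most
    one point.\<close>
  define D where "D = insert 1 {dist z z' |z z'. z \<in> Z \<and> z' \<in> Z \<and> z \<noteq> z'}"
  have "{dist z z' |z z'. z \<in> Z \<and> z' \<in> Z \<and> z \<noteq> z'} \<subseteq> (\<lambda>(z, z'). dist z z') ` (Z \<times> Z)" by auto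
  then have fin: "finite D" unfolding D_def using assms finite_subset by fastforce
  have "Min D \<in> D" using fin by (intro Min_in) (auto simp: D_def)
  then have "0 < Min D" by (auto simp: D_def)
  moreover have "Min D \<le> dist z z'" if "z \<in> Z" "z' \<in> Z" "z \<noteq> z'" for z z'
    using fin by (rule Min_le) (use that in \<open>auto simp: D_def\<close>)
  ultimately show thesis using that by blast
qed

lemma cube_neighbour:
  fixes z :: "'a::euclidean_space"
  assumes "z \<in> cbox 0 One" "0 \<le> \<tau>" "\<tau> \<le> 1 / 2"
  obtains y where "y \<in> cbox 0 One" "dist z y = \<tau>"
proof -
  obtain b :: 'a where b: "b \<in> Basis" using nonempty_Basis by blast
  define s where "s = (if z \<bullet> b \<le> 1 / 2 then \<tau> else - \<tau>)"
  have "z + s *\<^sub>R b \<in> cbox 0 One"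
    using assms b by (auto simp: mem_box inner_add_left inner_Basis s_def)
  moreover have "dist z (z + s *\<^sub>R b) = \<tau>"
    using b assms(2) by (simp add: dist_norm s_def)
  ultimately show thesis using that by blast
qed

definition flat_somewhere :: "real \<Rightarrow> ('a::euclidean_space \<Rightarrow> real) set" where
  "flat_somewhere d = {f. \<exists>x\<in>cbox 0 One. \<forall>y\<in>cbox 0 One. y \<noteq> x \<longrightarrow> dist x y < d \<longrightarrow> \<bar>f y - f x\<bar> \<le> dist x y / 2}"

text \<open>Replacing a function by the lower envelope of cones of slope 1 over its values on a fine net
  moves it little, but makes it steep at a small scale around every point.\<close>
lemma avoidable_flat_somewhere:
  assumes "0 < d"
  shows "avoidable (flat_somewhere d :: ('a::euclidean_space \<Rightarrow> real) set)"
  unfolding avoidable_def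
proof (intro allI impI)
  fix f :: "'a \<Rightarrow> real" and \<epsilon> :: real
  let ?Q = "cbox 0 One :: 'a set"
  assume lip: "1-lipschitz_on ?Q f" and "0 < \<epsilon>"
  obtain B where B: "0 < B" "\<And>y. y \<in> ?Q \<Longrightarrow> \<bar>f y\<bar> \<le> B" using lipschitz_bounded_cube[OF lip] by blast
  obtain \<delta> where \<delta>: "0 < \<delta>" "\<delta> < 1" "\<delta> * B \<le> \<epsilon> / 2"
    using small_factor[OF B(1) \<open>0 < \<epsilon>\<close>] by blast
  \<comment> \<open>A Lipschitz constant strictly below 1 gives room: at a net point every other
    cone is higher by at least \<delta> times the distance of the two vertices.\<close>
  define f1 where "f1 y = (1 - \<delta>) * f y" for y
  have f1lip: "\<bar>f1 y - f1 z\<bar> \<le> (1 - \<delta>) * dist y z" if "y \<in> ?Q" "z \<in> ?Q" for y z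
  proof -
    have "\<bar>f1 y - f1 z\<bar> = (1 - \<delta>) * \<bar>f y - f z\<bar>"
      using \<delta> by (simp add: f1_def abs_mult flip: right_diff_distrib)
    then show ?thesis using lipschitz_onD[OF lip that] \<delta> by (simp add: dist_real_def mult_left_mono)
  qed
  have f1f: "\<bar>f1 y - f y\<bar> \<le> \<epsilon> / 2" if "y \<in> ?Q" for y
  proof -
    have "\<bar>f1 y - f y\<bar> = \<delta> * \<bar>f y\<bar>" using \<delta>(1) by (simp add: f1_def algebra_simps abs_mult)
    also have "\<dots> \<le> \<delta> * B" using B(2)[OF that] \<delta>(1) by simp
    finally show ?thesis using \<delta>(3) by simp
  qed
  \<comment> \<open>The first bound keeps the envelope close to \<open>f\<close>; the second forces
    the vertex of a cone active at x to lie within d of x.\<close>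
  define r where "r = min (\<epsilon> / 4) (\<delta> * d / 4)"
  have r: "0 < r" "2 * r \<le> \<epsilon> / 2" "2 * r < \<delta> * d"
    using \<open>0 < \<epsilon>\<close> mult_pos_pos[OF \<delta>(1) assms] unfolding r_def by linarith+
  have "?Q \<subseteq> (\<Union>z\<in>?Q. ball z r)" using r(1) by auto
  then obtain Z where Z: "Z \<subseteq> ?Q" "finite Z" "?Q \<subseteq> (\<Union>z\<in>Z. ball z r)"
    using compactE_image[OF compact_cbox, of ?Q "\<lambda>z. ball z r" 0 One] by auto
  have f1Z: "f1 z - f1 z' \<le> (1 - \<delta>) * dist z z'" if "z \<in> Z" "z' \<in> Z" for z z'
    using f1lip[OF subsetD[OF Z(1) that(1)] subsetD[OF Z(1) that(2)]] by linarith
  have "0 \<in> ?Q" by (simp add: mem_box)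
  then have Zne: "Z \<noteq> {}" using Z(3) by auto
  obtain sp where sp: "0 < sp" "\<And>z z'. z \<in> Z \<Longrightarrow> z' \<in> Z \<Longrightarrow> z \<noteq> z' \<Longrightarrow> sp \<le> dist z z'"
    using finite_separated[OF Z(2)] by blast
  define h where "h y = Min ((\<lambda>z. f1 z + dist y z) ` Z)" for y
  have hle: "h y \<le> f1 z + dist y z" if "z \<in> Z" for y z
    unfolding h_def using Z(2) that by (intro Min_le) auto
  have hex: "\<exists>z\<in>Z. h y = f1 z + dist y z" for y
  proof -
    have "h y \<in> (\<lambda>z. f1 z + dist y z) ` Z" unfolding h_def using Z(2) Zne by (intro Min_in) auto
    then show ?thesis by blast
  qed
  have hlip: "1-lipschitz_on ?Q h"
  proof (rule lipschitz_onI)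
    fix y w
    have le: "h y \<le> h w + dist y w" for y w
    proof -
      obtain z where z: "z \<in> Z" "h w = f1 z + dist w z" using hex by blast
      show ?thesis using hle[OF z(1), of y] z(2) dist_triangle[of y z w] by linarith
    qed
    show "dist (h y) (h w) \<le> 1 * dist y w"
      using le[of y w] le[of w y] by (simp add: dist_real_def dist_commute)
  qed simp
  have hge: "f1 y \<le> h y" if "y \<in> ?Q" for y
  proof -
    obtain z where z: "z \<in> Z" "h y = f1 z + dist y z" using hex by blast
    have "f1 y - f1 z \<le> (1 - \<delta>) * dist y z" using f1lip[OF that, of z] z(1) Z(1) by auto
    also have "\<dots> \<le> 1 * dist y z" using \<delta> by (intro mult_right_mono) auto
    finally show ?thesis using z(2) by simp
  qed
  have hclose: "close_on ?Q \<epsilon> h f"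
    unfolding close_on_def
  proof
    fix y assume y: "y \<in> ?Q"
    then obtain z where z: "z \<in> Z" "dist z y < r" using Z(3) by auto
    have "f1 z - f1 y \<le> (1 - \<delta>) * dist z y" using f1lip[of z y] z(1) Z(1) y by auto
    also have "\<dots> \<le> 1 * dist z y" using \<delta> by (intro mult_right_mono) auto
    finally have "h y \<le> f1 y + 2 * r" using hle[OF z(1), of y] z(2) by (simp add: dist_commute)
    then show "\<bar>h y - f y\<bar> \<le> \<epsilon>" using hge[OF y] f1f[OF y] r(2) by linarith
  qed
  \<comment> \<open>Since 2 \<tau> \<le> \<delta> sp, at distance \<tau> from a net point its own
    cone is still the lowest.\<close>
  define \<tau> where "\<tau> = min (\<delta> * sp / 2) (min (d / 4) (1 / 4))"
  have \<tau>: "0 < \<tau>" "\<tau> \<le> \<delta> * sp / 2" "\<tau> \<le> d / 4" "\<tau> \<le> 1 / 4"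
    using \<delta>(1) sp(1) assms by (auto simp: \<tau>_def)
  have "restrict k ?Q \<notin> flat_somewhere d" if klip: "1-lipschitz_on ?Q k" and kh: "close_on ?Q (\<tau> / 32) k h" for k
  proof
    assume "restrict k ?Q \<in> flat_somewhere d"
    then obtain x where x: "x \<in> ?Q" "\<And>y. y \<in> ?Q \<Longrightarrow> y \<noteq> x \<Longrightarrow> dist x y < d \<Longrightarrow> \<bar>k y - k x\<bar> \<le> dist x y / 2"
      unfolding flat_somewhere_def by auto
    have kh': "\<bar>k y - h y\<bar> \<le> \<tau> / 32" if "y \<in> ?Q" for y using kh that by (simp add: close_on_def)
    obtain z where z: "z \<in> Z" "h x = f1 z + dist x z" using hex by blast
    have zQ: "z \<in> ?Q" using z(1) Z(1) by blast
    \<comment> \<open>If x is far from the active vertex \<open>z\<close>, the pair x, z is itself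
      steep. Otherwise a point at distance \<tau> from \<open>z\<close> is higher by more than 3/4
      \<tau> at distance at most 5/4 \<tau> from x; this exceeds half the distance by \<tau>/8, more
      than the two errors \<tau>/32.\<close>
    show False
    proof (cases "\<tau> / 4 \<le> dist x z")
      case True
      obtain z0 where z0: "z0 \<in> Z" "dist z0 x < r" using Z(3) x(1) by auto
      have "f1 z0 - f1 z \<le> (1 - \<delta>) * dist z0 z" using f1Z z0(1) z(1) by blast
      also have "\<dots> \<le> (1 - \<delta>) * (dist x z + r)"
        using \<delta> dist_triangle[of z0 z x] z0(2) by (intro mult_left_mono) auto
      also have "\<dots> = dist x z + r - \<delta> * dist x z - \<delta> * r" by (simp add: algebra_simps)
      finally have "\<delta> * dist x z \<le> 2 * r - \<delta> * r"
        using hle[OF z0(1), of x] z(2) z0(2) by (simp add: dist_commute)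
      also have "\<dots> < \<delta> * d" using r(3) mult_pos_pos[OF \<delta>(1) r(1)] by linarith
      finally have "dist x z < d" using \<delta>(1) by simp
      moreover have "z \<noteq> x" using True \<tau>(1) by auto
      ultimately have "\<bar>k z - k x\<bar> \<le> dist x z / 2" using x(2) zQ by blast
      moreover have "h z \<le> f1 z" using hle[OF z(1), of z] by simp
      ultimately show False using kh'[OF zQ] kh'[OF x(1)] z(2) True \<tau>(1) by linarith
    next
      case False
      obtain y where y: "y \<in> ?Q" "dist z y = \<tau>"
        using cube_neighbour[OF zQ, of \<tau>] \<tau> by auto
      have hy: "f1 z + \<tau> \<le> h y"
      proof -
        obtain z' where z': "z' \<in> Z" "h y = f1 z' + dist y z'" using hex by blast
        show ?thesis
        proof (cases "z' = z")
          case True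
          then show ?thesis using z' y(2) by (simp add: dist_commute)
        next
          case False
          have "f1 z - f1 z' \<le> (1 - \<delta>) * dist z z'" using f1Z z'(1) z(1) by blast
          also have "\<dots> = dist z z' - \<delta> * dist z z'" by (simp add: algebra_simps)
          finally have "f1 z - f1 z' \<le> dist z z' - \<delta> * dist z z'" .
          moreover have "\<delta> * sp \<le> \<delta> * dist z z'" using sp(2)[OF z(1) z'(1)] False \<delta>(1) by simp
          ultimately show ?thesis using dist_triangle[of z z' y] y(2) z'(2) \<tau>(2) by linarith
        qed
      qed
      have dxy: "dist x y \<le> 5 / 4 * \<tau>" "3 / 4 * \<tau> \<le> dist x y"
        using False y(2) dist_triangle[of x y z] dist_triangle[of z y x] dist_commute[of x z] by linarith+
      then have "y \<noteq> x" "dist x y < d" using \<tau>(1,3) by auto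
      then have "\<bar>k y - k x\<bar> \<le> dist x y / 2" using x(2) y(1) by blast
      then show False using kh'[OF y(1)] kh'[OF x(1)] hy z(2) dxy(1) False \<tau>(1) by linarith
    qed
  qed
  then show "\<exists>h \<eta>. 1-lipschitz_on ?Q h \<and> 0 < \<eta> \<and> close_on ?Q \<epsilon> h f \<and>
        (\<forall>k. 1-lipschitz_on ?Q k \<longrightarrow> close_on ?Q \<eta> k h \<longrightarrow> restrict k ?Q \<notin> flat_somewhere d)"
    using hlip hclose \<tau>(1) by (intro exI[of _ h] exI[of _ "\<tau> / 32"]) auto
qed

section \<open>The potential of a purely unrectifiable set\<close>

text \<open>These are the graphs s e + \<phi> s over the line along \<open>e\<close>. The slope
  bound \<alpha> will be large: a potential built from steep graphs varies across \<open>e\<close>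
  at rate at most 1/\<alpha>.\<close>

definition transversal :: "'a::euclidean_space \<Rightarrow> real \<Rightarrow> (real \<Rightarrow> 'a) set" where
  "transversal e \<alpha> = {\<phi>. \<alpha>-lipschitz_on UNIV \<phi> \<and> (\<forall>s. \<phi> s \<bullet> e = 0)}"

text \<open>Used with w = 0 to go straight on along \<open>e\<close>, and with |w| = \<alpha> to
  reach a point displaced across \<open>e\<close> as quickly as possible.\<close>

lemma transversal_continue:
  assumes \<phi>: "\<phi> \<in> transversal e \<alpha>" and w: "w \<bullet> e = 0" "norm w \<le> \<alpha>"
  shows "(\<lambda>s. if s \<le> b then \<phi> s else \<phi> b + (s - b) *\<^sub>R w) \<in> transversal e \<alpha>" (is "?\<psi> \<in> _")
proof -
  have \<alpha>: "0 \<le> \<alpha>" using w(2) norm_ge_zero[of w] by linarith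
  have lip: "dist (\<phi> s) (\<phi> t) \<le> \<alpha> * dist s t" for s t
    using \<phi> lipschitz_onD[of \<alpha> UNIV \<phi>] by (auto simp: transversal_def)
  have after: "dist (\<phi> b + (s - b) *\<^sub>R w) (\<phi> b + (t - b) *\<^sub>R w) \<le> \<alpha> * (t - s)" if "s \<le> t" for s t
  proof -
    have "dist (\<phi> b + (s - b) *\<^sub>R w) (\<phi> b + (t - b) *\<^sub>R w) = norm ((s - t) *\<^sub>R w)"
      by (simp add: dist_norm algebra_simps)
    also have "\<dots> = (t - s) * norm w" using that by simp
    also have "\<dots> \<le> (t - s) * \<alpha>" using w(2) that by (intro mult_left_mono) auto
    finally show ?thesis by (simp add: mult.commute)
  qed
  have "\<alpha>-lipschitz_on UNIV ?\<psi>"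
  proof (rule lipschitz_on_leI[OF _ \<alpha>])
    fix s t :: real assume st: "s \<le> t"
    consider "t \<le> b" | "s \<le> b" "b < t" | "b < s" by linarith
    then show "dist (?\<psi> s) (?\<psi> t) \<le> \<alpha> * dist s t"
    proof cases
      case 1
      then show ?thesis using lip[of s t] st by simp
    next
      case 2
      have "dist (\<phi> s) (\<phi> b + (t - b) *\<^sub>R w) \<le> dist (\<phi> s) (\<phi> b) + dist (\<phi> b) (\<phi> b + (t - b) *\<^sub>R w)"
        by (rule dist_triangle)
      also have "\<dots> \<le> \<alpha> * (b - s) + \<alpha> * (t - b)"
        using lip[of s b] after[of b t] 2 by (simp add: dist_real_def)
      also have "\<dots> = \<alpha> * dist s t" using st by (simp add: dist_real_def algebra_simps)
      finally show ?thesis using 2 by simp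
    next
      case 3
      then show ?thesis using after[OF st] st by (simp add: dist_real_def)
    qed
  qed
  moreover have "?\<psi> s \<bullet> e = 0" for s using \<phi> w(1) by (simp add: transversal_def inner_add_left)
  ultimately show ?thesis by (simp add: transversal_def)
qed

lemma transversal_preimage_lmeasurable:
  assumes \<phi>: "\<phi> \<in> transversal e \<alpha>" and e: "norm e = 1" and G: "open G" "bounded G"
  shows "{s. s *\<^sub>R e + \<phi> s \<in> G} \<in> lmeasurable" "{s. s \<le> b \<and> s *\<^sub>R e + \<phi> s \<in> G} \<in> lmeasurable"
proof -
  have "continuous_on UNIV (\<lambda>s. s *\<^sub>R e + \<phi> s)"
    using \<phi> lipschitz_on_continuous_on[of \<alpha> UNIV \<phi>]
    by (intro continuous_intros) (auto simp: transversal_def)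
  then have op: "open {s. s *\<^sub>R e + \<phi> s \<in> G}"
    using G(1) open_vimage[of G "\<lambda>s. s *\<^sub>R e + \<phi> s"] by (simp add: vimage_def)
  obtain R where R: "\<And>y. y \<in> G \<Longrightarrow> norm y \<le> R" using G(2) bounded_iff by blast
  have "\<bar>s\<bar> \<le> R" if "s *\<^sub>R e + \<phi> s \<in> G" for s
  proof -
    have "s = (s *\<^sub>R e + \<phi> s) \<bullet> e"
      using \<phi> e by (simp add: transversal_def inner_add_left norm_eq_1)
    then have "\<bar>s\<bar> \<le> norm (s *\<^sub>R e + \<phi> s)"
      using Cauchy_Schwarz_ineq2[of "s *\<^sub>R e + \<phi> s" e] e by simp
    then show ?thesis using R[OF that] by linarith
  qed
  then have "bounded {s. s *\<^sub>R e + \<phi> s \<in> G}" unfolding bounded_iff by auto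
  then show m: "{s. s *\<^sub>R e + \<phi> s \<in> G} \<in> lmeasurable" using op by (rule lmeasurable_open)
  have "{s. s \<le> b \<and> s *\<^sub>R e + \<phi> s \<in> G} = {s. s *\<^sub>R e + \<phi> s \<in> G} \<inter> {..b}" by auto
  then show "{s. s \<le> b \<and> s *\<^sub>R e + \<phi> s \<in> G} \<in> lmeasurable"
    using fmeasurable_Int_fmeasurable[OF m, of "{..b}"] by simp
qed

text \<open>Continuing a graph straight along \<open>e\<close> gains the full length inside
  \<open>G\<close>, which gives the unit growth. For a displacement w across \<open>e\<close>, a
  graph ending on the line through x + w is turned towards the line through x with slope \<alpha>;
  it arrives higher by |w|/\<alpha>, and the penalty charges exactly this amount.\<close>

lemma transversal_potential:
  fixes e :: "'a::euclidean_space"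
  assumes e: "norm e = 1" and \<alpha>: "0 < \<alpha>" and G: "open G" "bounded G"
    and H: "\<And>\<phi>. \<phi> \<in> transversal e \<alpha> \<Longrightarrow> measure lebesgue {s. s *\<^sub>R e + \<phi> s \<in> G} \<le> \<epsilon>"
  obtains g :: "'a \<Rightarrow> real" where "\<And>x. 0 \<le> g x" "\<And>x. g x \<le> \<epsilon>"
    "\<And>x t. 0 \<le> t \<Longrightarrow> g x \<le> g (x + t *\<^sub>R e)" "\<And>x t. 0 \<le> t \<Longrightarrow> g (x + t *\<^sub>R e) \<le> g x + t"
    "\<And>x t. 0 \<le> t \<Longrightarrow> (\<And>s. 0 \<le> s \<Longrightarrow> s \<le> t \<Longrightarrow> x + s *\<^sub>R e \<in> G) \<Longrightarrow> g x + t \<le> g (x + t *\<^sub>R e)"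
    "\<And>x w. w \<bullet> e = 0 \<Longrightarrow> g (x + w) \<le> g x + norm w / \<alpha>"
proof -
  define m where "m \<phi> b = measure lebesgue {s. s \<le> b \<and> s *\<^sub>R e + \<phi> s \<in> G}" for \<phi> b
  define C where "C x = {(\<phi>, a). \<phi> \<in> transversal e \<alpha> \<and> 0 \<le> a \<and> \<phi> (x \<bullet> e + a) = x - (x \<bullet> e) *\<^sub>R e}" for x
  \<comment> \<open>the penalty \<open>a\<close> for ending above \<open>x\<close> instead of at \<open>x\<close> makes \<open>g\<close> 1-Lipschitz along \<open>e\<close>\<close>
  define g where "g x = (SUP (\<phi>, a)\<in>C x. m \<phi> (x \<bullet> e + a) - a)" for x
  have ee: "e \<bullet> e = 1" using e by (simp add: norm_eq_1)
  note lm = transversal_preimage_lmeasurable[OF _ e G]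
  have m_le: "m \<phi> b \<le> \<epsilon>" if "\<phi> \<in> transversal e \<alpha>" for \<phi> b
  proof -
    have "m \<phi> b \<le> measure lebesgue {s. s *\<^sub>R e + \<phi> s \<in> G}"
      unfolding m_def using lm[OF that] by (intro measure_mono_fmeasurable) auto
    then show ?thesis using H[OF that] by linarith
  qed
  have m_mono: "m \<phi> b \<le> m \<psi> b'" if "\<phi> \<in> transversal e \<alpha>" "\<psi> \<in> transversal e \<alpha>" "b \<le> b'" "\<And>s. s \<le> b \<Longrightarrow> \<psi> s = \<phi> s"
    for \<phi> \<psi> b b'
    unfolding m_def using lm[OF that(1)] lm[OF that(2)] that(3,4) by (intro measure_mono_fmeasurable) auto
  have bdd: "bdd_above ((\<lambda>(\<phi>, a). m \<phi> (x \<bullet> e + a) - a) ` C x)" for x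
  proof (rule bdd_aboveI2)
    fix p assume "p \<in> C x"
    then obtain \<phi> a where p: "p = (\<phi>, a)" "\<phi> \<in> transversal e \<alpha>" "0 \<le> a" by (auto simp: C_def)
    then show "(case p of (\<phi>, a) \<Rightarrow> m \<phi> (x \<bullet> e + a) - a) \<le> \<epsilon>"
      using m_le[OF p(2), of "x \<bullet> e + a"] by simp
  qed
  have g_ge: "m \<phi> (x \<bullet> e + a) - a \<le> g x" if "\<phi> \<in> transversal e \<alpha>" "0 \<le> a" "\<phi> (x \<bullet> e + a) = x - (x \<bullet> e) *\<^sub>R e"
    for x \<phi> a
    unfolding g_def using cSUP_upper[OF _ bdd, of "(\<phi>, a)" x] that by (simp add: C_def)
  have line: "(\<lambda>s. x - (x \<bullet> e) *\<^sub>R e) \<in> transversal e \<alpha>" for x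
    using \<alpha> ee by (simp add: transversal_def inner_diff_left lipschitz_on_def)
  have g_le: "g x \<le> c" if "\<And>\<phi> a. \<phi> \<in> transversal e \<alpha> \<Longrightarrow> 0 \<le> a \<Longrightarrow> \<phi> (x \<bullet> e + a) = x - (x \<bullet> e) *\<^sub>R e \<Longrightarrow>
      m \<phi> (x \<bullet> e + a) - a \<le> c" for x c
    unfolding g_def
  proof (rule cSUP_least)
    have "((\<lambda>s. x - (x \<bullet> e) *\<^sub>R e), 0) \<in> C x" using line by (simp add: C_def)
    then show "C x \<noteq> {}" by blast
  qed (use that in \<open>auto simp: C_def\<close>)
  have shift: "(x + t *\<^sub>R e) \<bullet> e = x \<bullet> e + t" "x + t *\<^sub>R e - (x \<bullet> e + t) *\<^sub>R e = x - (x \<bullet> e) *\<^sub>R e" for x t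
    using ee by (simp_all add: inner_add_left scaleR_add_left)
  show thesis
  proof (rule that)
    show "0 \<le> g x" for x
    proof -
      have "m (\<lambda>s. x - (x \<bullet> e) *\<^sub>R e) (x \<bullet> e + 0) - 0 \<le> g x" by (rule g_ge[OF line]) auto
      moreover have "0 \<le> m (\<lambda>s. x - (x \<bullet> e) *\<^sub>R e) (x \<bullet> e + 0)" unfolding m_def by (rule measure_nonneg)
      ultimately show ?thesis by linarith
    qed
    show "g x \<le> \<epsilon>" for x
    proof (rule g_le)
      fix \<phi> and a :: real assume "\<phi> \<in> transversal e \<alpha>" "0 \<le> a"
      then show "m \<phi> (x \<bullet> e + a) - a \<le> \<epsilon>" using m_le[of \<phi> "x \<bullet> e + a"] by linarith
    qed
    \<comment> \<open>For t \<le> a the same graph serves the raised point with a penalty smaller by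
      t; otherwise the graph is continued straight from its end point.\<close>
    have climb: "m \<phi> (x \<bullet> e + a) - a \<le> g (x + t *\<^sub>R e) \<and>
        ((\<forall>s. 0 \<le> s \<longrightarrow> s \<le> t \<longrightarrow> x + s *\<^sub>R e \<in> G) \<longrightarrow> m \<phi> (x \<bullet> e + a) - a + t \<le> g (x + t *\<^sub>R e))"
      if t: "0 \<le> t" and \<phi>: "\<phi> \<in> transversal e \<alpha>" "0 \<le> a" "\<phi> (x \<bullet> e + a) = x - (x \<bullet> e) *\<^sub>R e" for x t \<phi> a
    proof (cases "t \<le> a")
      case True
      have "m \<phi> (x \<bullet> e + a) - (a - t) \<le> g (x + t *\<^sub>R e)"
        using g_ge[OF \<phi>(1), of "a - t" "x + t *\<^sub>R e"] True \<phi>(3) shift[of x t] by simp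
      then show ?thesis using t by simp
    next
      case False
      let ?b = "x \<bullet> e + a"
      define \<psi> where "\<psi> = (\<lambda>s. if s \<le> ?b then \<phi> s else \<phi> ?b + (s - ?b) *\<^sub>R 0)"
      have \<psi>: "\<psi> \<in> transversal e \<alpha>" unfolding \<psi>_def using \<alpha> by (intro transversal_continue[OF \<phi>(1)]) auto
      have "\<psi> (x \<bullet> e + t) = x - (x \<bullet> e) *\<^sub>R e" using False \<phi>(3) by (simp add: \<psi>_def)
      then have ge: "m \<psi> (x \<bullet> e + t) \<le> g (x + t *\<^sub>R e)"
        using g_ge[OF \<psi>, of 0 "x + t *\<^sub>R e"] shift[of x t] by simp
      have "m \<phi> ?b \<le> m \<psi> (x \<bullet> e + t)" using False by (intro m_mono[OF \<phi>(1) \<psi>]) (auto simp: \<psi>_def)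
      moreover have "m \<phi> ?b + (t - a) \<le> m \<psi> (x \<bullet> e + t)" if inG: "\<forall>s. 0 \<le> s \<longrightarrow> s \<le> t \<longrightarrow> x + s *\<^sub>R e \<in> G"
      proof -
        let ?A = "{s. s \<le> ?b \<and> s *\<^sub>R e + \<phi> s \<in> G}" and ?J = "{?b<..x \<bullet> e + t}"
        have "m \<phi> ?b + (t - a) = measure lebesgue ?A + measure lebesgue ?J"
          using False by (simp add: m_def)
        also have "\<dots> = measure lebesgue (?A \<union> ?J)"
        proof -
          have "?J \<in> lmeasurable" by (rule fmeasurableI2[of "{?b..x \<bullet> e + t}"]) auto
          moreover have "?A \<inter> ?J = {}" by auto
          ultimately show ?thesis using measure_Un3[OF lm(2)[OF \<phi>(1), of ?b], of ?J] by simp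
        qed
        also have "\<dots> \<le> m \<psi> (x \<bullet> e + t)"
          unfolding m_def
        proof (rule measure_mono_fmeasurable)
          show "?A \<union> ?J \<subseteq> {s. s \<le> x \<bullet> e + t \<and> s *\<^sub>R e + \<psi> s \<in> G}"
          proof
            fix s assume s: "s \<in> ?A \<union> ?J"
            show "s \<in> {s. s \<le> x \<bullet> e + t \<and> s *\<^sub>R e + \<psi> s \<in> G}"
            proof (cases "s \<le> ?b")
              case True
              then show ?thesis using s False by (auto simp: \<psi>_def)
            next
              case nb: False
              then have "s *\<^sub>R e + \<psi> s = x + (s - x \<bullet> e) *\<^sub>R e"
                using \<phi>(3) by (simp add: \<psi>_def scaleR_diff_left)
              moreover have "x + (s - x \<bullet> e) *\<^sub>R e \<in> G" using s nb \<phi>(2) by (intro inG[rule_format]) auto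
              ultimately show ?thesis using s nb by auto
            qed
          qed
          show "?A \<union> ?J \<in> sets lebesgue" using lm(2)[OF \<phi>(1), of ?b] by auto
          show "{s. s \<le> x \<bullet> e + t \<and> s *\<^sub>R e + \<psi> s \<in> G} \<in> lmeasurable" by (rule lm(2)[OF \<psi>])
        qed
        finally show ?thesis .
      qed
      ultimately show ?thesis using ge \<phi>(2) by (smt (verit))
    qed
    show "g x \<le> g (x + t *\<^sub>R e)" if "0 \<le> t" for x t
      by (rule g_le) (use climb[OF that] in blast)
    show "g x + t \<le> g (x + t *\<^sub>R e)" if t: "0 \<le> t" and inG: "\<And>s. 0 \<le> s \<Longrightarrow> s \<le> t \<Longrightarrow> x + s *\<^sub>R e \<in> G" for x t
    proof -
      have "g x \<le> g (x + t *\<^sub>R e) - t"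
      proof (rule g_le)
        fix \<phi> a assume "\<phi> \<in> transversal e \<alpha>" "0 \<le> a" "\<phi> (x \<bullet> e + a) = x - (x \<bullet> e) *\<^sub>R e"
        then have "m \<phi> (x \<bullet> e + a) - a + t \<le> g (x + t *\<^sub>R e)" using climb[OF t] inG by blast
        then show "m \<phi> (x \<bullet> e + a) - a \<le> g (x + t *\<^sub>R e) - t" by linarith
      qed
      then show ?thesis by linarith
    qed
    show "g (x + t *\<^sub>R e) \<le> g x + t" if "0 \<le> t" for x t
    proof (rule g_le)
      fix \<phi> a assume \<phi>: "\<phi> \<in> transversal e \<alpha>" "0 \<le> a" "\<phi> ((x + t *\<^sub>R e) \<bullet> e + a) = x + t *\<^sub>R e - ((x + t *\<^sub>R e) \<bullet> e) *\<^sub>R e"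
      then have "m \<phi> (x \<bullet> e + (t + a)) - (t + a) \<le> g x"
        using \<open>0 \<le> t\<close> shift[of x t] by (intro g_ge) (auto simp: add.assoc)
      then show "m \<phi> ((x + t *\<^sub>R e) \<bullet> e + a) - a \<le> g x + t" using shift(1)[of x t] by (simp add: add.assoc)
    qed
    show "g (x + w) \<le> g x + norm w / \<alpha>" if w: "w \<bullet> e = 0" for x w
    proof (cases "w = 0")
      case False
      show ?thesis
      proof (rule g_le)
        fix \<phi> a assume \<phi>: "\<phi> \<in> transversal e \<alpha>" "0 \<le> a" "\<phi> ((x + w) \<bullet> e + a) = x + w - ((x + w) \<bullet> e) *\<^sub>R e"
        let ?b = "x \<bullet> e + a" and ?l = "norm w / \<alpha>"
        have l: "0 < ?l" using False \<alpha> by simp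
        have xw: "(x + w) \<bullet> e = x \<bullet> e" using w by (simp add: inner_add_left)
        define u where "u = (- \<alpha> / norm w) *\<^sub>R w"
        define \<psi> where "\<psi> = (\<lambda>s. if s \<le> ?b then \<phi> s else \<phi> ?b + (s - ?b) *\<^sub>R u)"
        have \<psi>: "\<psi> \<in> transversal e \<alpha>" unfolding \<psi>_def
          using \<alpha> w False by (intro transversal_continue[OF \<phi>(1)]) (auto simp: u_def)
        have "?l *\<^sub>R u = - w" using False \<alpha> by (simp add: u_def)
        then have "\<psi> (x \<bullet> e + (a + ?l)) = x - (x \<bullet> e) *\<^sub>R e"
          using l \<phi>(3) unfolding xw by (simp add: \<psi>_def)
        then have "m \<psi> (x \<bullet> e + (a + ?l)) - (a + ?l) \<le> g x"
          using \<phi>(2) l by (intro g_ge[OF \<psi>]) auto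
        moreover have "m \<phi> ?b \<le> m \<psi> (x \<bullet> e + (a + ?l))"
          using l by (intro m_mono[OF \<phi>(1) \<psi>]) (auto simp: \<psi>_def)
        ultimately show "m \<phi> ((x + w) \<bullet> e + a) - a \<le> g x + norm w / \<alpha>" unfolding xw by linarith
      qed
    qed simp
  qed
qed

section \<open>Thin neighbourhoods of compact purely unrectifiable sets\<close>

lemma purely_unrectifiable_subset:
  assumes "purely_unrectifiable P" "K \<subseteq> P"
  shows "purely_unrectifiable K"
  unfolding purely_unrectifiable_def
proof (intro allI impI)
  fix \<gamma> :: "real \<Rightarrow> 'a" assume "lipschitz_curve_on {0..1} \<gamma>"
  then have "negligible {t \<in> {0..1}. \<gamma> t \<in> P}"
    using assms(1) by (simp add: purely_unrectifiable_def negligible_iff_null_sets)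
  then have "negligible {t \<in> {0..1}. \<gamma> t \<in> K}"
    by (rule negligible_subset) (use assms(2) in auto)
  then show "{t \<in> {0..1}. \<gamma> t \<in> K} \<in> null_sets lebesgue" by (simp add: negligible_iff_null_sets)
qed

text \<open>Run over \<open>{0..1}\<close>, the graph has derivative with constant e-component 2 R,
  hence bounded away from 0. Extending \<psi> makes almost everywhere differentiability on the whole
  line available.\<close>

lemma purely_unrectifiable_transversal_null:
  fixes e :: "'a::euclidean_space"
  assumes pu: "purely_unrectifiable K" and e: "norm e = 1" and "0 < R"
    and lip: "\<alpha>-lipschitz_on {-R..R} \<psi>" and orth: "\<And>s. s \<in> {-R..R} \<Longrightarrow> \<psi> s \<bullet> e = 0"
  shows "negligible {s \<in> {-R..R}. s *\<^sub>R e + \<psi> s \<in> K}"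
proof -
  obtain \<zeta> where \<zeta>: "(DIM('a) * \<alpha>)-lipschitz_on UNIV \<zeta>" "\<And>s. s \<in> {-R..R} \<Longrightarrow> \<zeta> s = \<psi> s"
    using lipschitz_extend_euclidean[OF lip] by blast
  define c where "c = 2 * R"
  define a where "a t = c * t + - R" for t
  have c: "0 < c" using \<open>0 < R\<close> by (simp add: c_def)
  have a_in: "a t \<in> {-R..R}" if "t \<in> {0..1}" for t
  proof -
    have "c * t \<le> c * 1" using that c by (intro mult_left_mono) auto
    moreover have "0 \<le> c * t" using that c by simp
    ultimately show ?thesis by (simp add: a_def c_def)
  qed
  define \<gamma> where "\<gamma> t = a t *\<^sub>R e + \<zeta> (a t)" for t
  define L where "L = c + DIM('a) * \<alpha> * c"
  have L0: "0 \<le> L" using c lipschitz_on_nonneg[OF \<zeta>(1)] by (simp add: L_def)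
  have \<gamma>lip: "L-lipschitz_on UNIV \<gamma>"
  proof (rule lipschitz_onI[OF _ L0])
    fix s t :: real
    have "dist (\<gamma> s) (\<gamma> t) \<le> dist (a s *\<^sub>R e) (a t *\<^sub>R e) + dist (\<zeta> (a s)) (\<zeta> (a t))"
      unfolding \<gamma>_def by (rule dist_triangle_add)
    also have "dist (a s *\<^sub>R e) (a t *\<^sub>R e) = dist (a s) (a t)"
      using e by (simp add: dist_norm flip: scaleR_diff_left)
    also have "dist (\<zeta> (a s)) (\<zeta> (a t)) \<le> DIM('a) * \<alpha> * dist (a s) (a t)"
      by (rule lipschitz_onD[OF \<zeta>(1)]) auto
    also have "dist (a s) (a t) = c * dist s t"
      using c by (simp add: a_def dist_real_def abs_mult flip: right_diff_distrib)
    finally show "dist (\<gamma> s) (\<gamma> t) \<le> L * dist s t" by (simp add: L_def algebra_simps)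
  qed
  have deriv: "c \<le> norm v" if t: "t \<in> {0..1}" and v: "(\<gamma> has_vector_derivative v) (at t within {0..1})" for t v
  proof -
    have "((\<lambda>t. \<gamma> t \<bullet> e) has_vector_derivative v \<bullet> e) (at t within {0..1})"
      using v by (rule bounded_linear.has_vector_derivative[OF bounded_linear_inner_left])
    moreover have "\<gamma> u \<bullet> e = a u" if "u \<in> {0..1}" for u
      using orth[OF a_in[OF that]] \<zeta>(2)[OF a_in[OF that]] e
      by (simp add: \<gamma>_def inner_add_left norm_eq_1)
    ultimately have "(a has_vector_derivative v \<bullet> e) (at t within {0..1})"
      using t by (rule_tac has_vector_derivative_transform[of t "{0..1}" a "\<lambda>t. \<gamma> t \<bullet> e"]) auto
    moreover have "(a has_vector_derivative c) (at t within {0..1})"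
      unfolding a_def by (auto intro!: derivative_eq_intros simp: has_real_derivative_iff_has_vector_derivative[symmetric])
    ultimately have "v \<bullet> e = c"
      using t by (intro vector_derivative_unique_within_closed_interval[of 0 1 t a]) auto
    then show ?thesis using Cauchy_Schwarz_ineq2[of v e] e c by simp
  qed
  have "lipschitz_curve_on {0..1} \<gamma>"
    unfolding lipschitz_curve_on_def
  proof (intro conjI exI)
    show "L-lipschitz_on {0..1} \<gamma>" using \<gamma>lip by (rule lipschitz_on_subset) auto
    show "c > 0" by (rule c)
    have "{t. \<not> \<gamma> differentiable (at t)} \<in> null_sets lebesgue"
      using lipschitz_curve_differentiable_ae[OF \<gamma>lip] by (simp add: negligible_iff_null_sets)
    then have "AE t in lebesgue. t \<notin> {t. \<not> \<gamma> differentiable (at t)}" by (rule AE_not_in)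
    then have "AE t in lebesgue. t \<in> {0..1} \<longrightarrow> (\<exists>v. (\<gamma> has_vector_derivative v) (at t within {0..1}) \<and> c \<le> norm v)"
    proof (rule AE_mp, intro AE_I2 impI)
      fix t assume "t \<notin> {t. \<not> \<gamma> differentiable (at t)}" "t \<in> {0..1::real}"
      then have "(\<gamma> has_vector_derivative vector_derivative \<gamma> (at t)) (at t within {0..1})"
        using vector_derivative_works has_vector_derivative_at_within by blast
      then show "\<exists>v. (\<gamma> has_vector_derivative v) (at t within {0..1}) \<and> c \<le> norm v"
        using deriv \<open>t \<in> {0..1}\<close> by blast
    qed
    then show "AE t in lebesgue_on {0..1}. \<exists>v. (\<gamma> has_vector_derivative v) (at t within {0..1}) \<and> c \<le> norm v"
      by (subst AE_restrict_space_iff) auto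
  qed
  then have "negligible {t \<in> {0..1}. \<gamma> t \<in> K}"
    using pu by (simp add: purely_unrectifiable_def negligible_iff_null_sets)
  then have "negligible {s. inverse c * s + R / c \<in> {t \<in> {0..1}. \<gamma> t \<in> K}}"
    by (rule negligible_affine_preimage) (use c in simp)
  moreover have "{s \<in> {-R..R}. s *\<^sub>R e + \<psi> s \<in> K} \<subseteq> {s. inverse c * s + R / c \<in> {t \<in> {0..1}. \<gamma> t \<in> K}}"
  proof
    fix s assume s: "s \<in> {s \<in> {-R..R}. s *\<^sub>R e + \<psi> s \<in> K}"
    let ?t = "inverse c * s + R / c"
    have t: "?t = (s + R) / c" using c by (simp add: field_split_simps)
    have "?t \<in> {0..1}" unfolding t using s c by (auto simp: c_def)
    moreover have "a ?t = s" unfolding t a_def using c by simp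
    ultimately show "s \<in> {s. inverse c * s + R / c \<in> {t \<in> {0..1}. \<gamma> t \<in> K}}"
      using s \<zeta>(2)[of s] by (simp add: \<gamma>_def)
  qed
  ultimately show ?thesis by (rule negligible_subset)
qed

text \<open>Otherwise some graphs spend length more than \<epsilon> in ever thinner neighbourhoods.
  Along a uniformly convergent subsequence, the parameters that occur infinitely often have measure
  at least \<epsilon> by continuity from above, and as \<open>K\<close> is closed the limit graph
  maps them into \<open>K\<close>, contradicting pure unrectifiability.\<close>

lemma transversal_thin_neighbourhood:
  fixes e :: "'a::euclidean_space"
  assumes K: "compact K" "purely_unrectifiable K" and e: "norm e = 1" and "0 < \<alpha>" "0 < \<epsilon>"
  obtains r where "0 < r" "\<And>\<phi>. \<phi> \<in> transversal e \<alpha> \<Longrightarrow>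
      measure lebesgue {s. s *\<^sub>R e + \<phi> s \<in> (\<Union>k\<in>K. ball k r)} \<le> \<epsilon>"
proof (rule ccontr)
  assume neg: "\<not> thesis"
  define G where "G n = (\<Union>k\<in>K. ball k (1 / Suc n))" for n :: nat
  have "\<exists>\<phi>. \<phi> \<in> transversal e \<alpha> \<and> \<epsilon> < measure lebesgue {s. s *\<^sub>R e + \<phi> s \<in> G n}" for n
  proof (rule ccontr)
    assume "\<not> ?thesis"
    then have "\<And>\<phi>. \<phi> \<in> transversal e \<alpha> \<Longrightarrow> measure lebesgue {s. s *\<^sub>R e + \<phi> s \<in> (\<Union>k\<in>K. ball k (1 / Suc n))} \<le> \<epsilon>"
      unfolding G_def by force
    then show False using neg that[of "1 / Suc n"] by simp
  qed
  then obtain \<phi> where \<phi>: "\<And>n. \<phi> n \<in> transversal e \<alpha>" "\<And>n. \<epsilon> < measure lebesgue {s. s *\<^sub>R e + \<phi> n s \<in> G n}" by metis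
  have lip: "norm (\<phi> n s - \<phi> n t) \<le> \<alpha> * \<bar>s - t\<bar>" for n s t
    using \<phi>(1)[of n] lipschitz_onD[of \<alpha> UNIV "\<phi> n" s t] by (simp add: transversal_def dist_norm)
  have orth: "\<phi> n s \<bullet> e = 0" for n s using \<phi>(1)[of n] by (simp add: transversal_def)
  obtain R0 where R0: "R0 > 0" "\<And>k. k \<in> K \<Longrightarrow> norm k \<le> R0" using K(1) compact_imp_bounded bounded_pos by metis
  define R where "R = R0 + 1"
  have R: "0 < R" using R0 by (simp add: R_def)
  have GR: "norm y \<le> R" if "y \<in> G n" for y n
  proof -
    obtain k where k: "k \<in> K" "dist k y < 1 / Suc n" using \<open>y \<in> G n\<close> unfolding G_def UN_iff mem_ball by blast
    have "1 / real (Suc n) \<le> 1" by simp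
    then have "dist k y \<le> 1" using k(2) by linarith
    then show ?thesis using R0(2)[OF k(1)] norm_triangle_sub[of y k] by (simp add: R_def dist_norm norm_minus_commute)
  qed
  have sR: "s \<in> {-R..R}" if "s *\<^sub>R e + \<phi> n s \<in> G n" for s n
  proof -
    have "\<bar>s\<bar> = \<bar>(s *\<^sub>R e + \<phi> n s) \<bullet> e\<bar>" using orth e by (simp add: inner_add_left norm_eq_1)
    also have "\<dots> \<le> R" using Cauchy_Schwarz_ineq2[of "s *\<^sub>R e + \<phi> n s" e] e GR[OF that] by simp
    finally show ?thesis by auto
  qed
  \<comment> \<open>Each graph meets its neighbourhood because the length there is positive; this
    bounds it at one parameter, and the Lipschitz constant does the rest.\<close>
  have bd: "norm (\<phi> n s) \<le> 2 * R + \<alpha> * (2 * R)" if "s \<in> {-R..R}" for n s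
  proof -
    have "{s. s *\<^sub>R e + \<phi> n s \<in> G n} \<noteq> {}"
    proof
      assume "{s. s *\<^sub>R e + \<phi> n s \<in> G n} = {}"
      then show False using \<phi>(2)[of n] \<open>0 < \<epsilon>\<close> by simp
    qed
    then obtain t where t: "t *\<^sub>R e + \<phi> n t \<in> G n" by blast
    have "norm (\<phi> n t) \<le> norm (t *\<^sub>R e + \<phi> n t) + norm (t *\<^sub>R e)"
      using norm_triangle_ineq4[of "t *\<^sub>R e + \<phi> n t" "t *\<^sub>R e"] by simp
    also have "\<dots> \<le> R + R" using GR[OF t] sR[OF t] e by (intro add_mono) auto
    finally have "norm (\<phi> n t) \<le> 2 * R" by simp
    moreover have "\<alpha> * \<bar>s - t\<bar> \<le> \<alpha> * (2 * R)"
      using that sR[OF t] \<open>0 < \<alpha>\<close> by (intro mult_left_mono) auto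
    ultimately show ?thesis using lip[of n s t] norm_triangle_sub[of "\<phi> n s" "\<phi> n t"] by linarith
  qed
  obtain \<psi> k where \<psi>: "continuous_on {-R..R} \<psi>" "strict_mono (k :: nat \<Rightarrow> nat)"
    "\<And>\<delta>. 0 < \<delta> \<Longrightarrow> \<exists>N. \<forall>n s. N \<le> n \<and> s \<in> {-R..R} \<longrightarrow> norm (\<phi> (k n) s - \<psi> s) < \<delta>"
  proof (rule Arzela_Ascoli[of "{-R..R}" \<phi> "2 * R + \<alpha> * (2 * R)"])
    show "\<exists>d>0. \<forall>n t. t \<in> {-R..R} \<and> norm (s - t) < d \<longrightarrow> norm (\<phi> n s - \<phi> n t) < \<delta>"
      if "s \<in> {-R..R}" "0 < \<delta>" for s \<delta>
    proof (intro exI[of _ "\<delta> / \<alpha>"] conjI allI impI)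
      show "0 < \<delta> / \<alpha>" using that \<open>0 < \<alpha>\<close> by simp
      fix n t assume "t \<in> {-R..R} \<and> norm (s - t) < \<delta> / \<alpha>"
      then have "\<alpha> * \<bar>s - t\<bar> < \<delta>" using \<open>0 < \<alpha>\<close> by (simp add: less_divide_eq mult.commute)
      then show "norm (\<phi> n s - \<phi> n t) < \<delta>" using lip[of n s t] by linarith
    qed
  qed (use bd in auto)
  have conv: "(\<lambda>n. \<phi> (k n) s) \<longlonglongrightarrow> \<psi> s" if "s \<in> {-R..R}" for s
    unfolding LIMSEQ_iff using \<psi>(3) that by blast
  have "\<alpha>-lipschitz_on {-R..R} \<psi>"
  proof (rule lipschitz_onI)
    fix s t assume st: "s \<in> {-R..R}" "t \<in> {-R..R}"
    show "dist (\<psi> s) (\<psi> t) \<le> \<alpha> * dist s t"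
    proof (rule tendsto_upperbound)
      show "(\<lambda>n. dist (\<phi> (k n) s) (\<phi> (k n) t)) \<longlonglongrightarrow> dist (\<psi> s) (\<psi> t)" using conv st by (intro tendsto_intros) auto
      show "\<forall>\<^sub>F n in sequentially. dist (\<phi> (k n) s) (\<phi> (k n) t) \<le> \<alpha> * dist s t"
        using lip by (simp add: dist_norm)
    qed simp
  qed (use \<open>0 < \<alpha>\<close> in simp)
  moreover have "\<psi> s \<bullet> e = 0" if "s \<in> {-R..R}" for s
  proof -
    have "(\<lambda>n. \<phi> (k n) s \<bullet> e) \<longlonglongrightarrow> \<psi> s \<bullet> e" using conv[OF that] by (intro tendsto_intros)
    then show ?thesis using LIMSEQ_unique[OF _ tendsto_const[of 0]] by (simp add: orth)
  qed
  ultimately have null: "negligible {s \<in> {-R..R}. s *\<^sub>R e + \<psi> s \<in> K}"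
    by (intro purely_unrectifiable_transversal_null[OF K(2) e R])
  define E where "E j = {s. s *\<^sub>R e + \<phi> (k j) s \<in> G (k j)}" for j
  have Em: "E j \<in> lmeasurable" for j
  proof -
    have "open (G n)" for n unfolding G_def by blast
    moreover have "bounded (G n)" for n using GR unfolding bounded_iff by blast
    ultimately show ?thesis unfolding E_def by (intro transversal_preimage_lmeasurable[OF \<phi>(1) e])
  qed
  have EJ: "E j \<subseteq> {-R..R}" for j using sR by (auto simp: E_def)
  define U where "U n = (\<Union>j\<in>{n..}. E j)" for n :: nat
  have UJ: "U n \<subseteq> {-R..R}" for n using EJ by (auto simp: U_def)
  have Us: "U n \<in> sets lebesgue" for n unfolding U_def using Em by (intro sets.countable_UN') auto
  have Um: "U n \<in> lmeasurable" for n
    using fmeasurableI2[of "{-R..R}" lebesgue "U n"] UJ Us by auto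
  have "(\<lambda>n. measure lebesgue (U n)) \<longlonglongrightarrow> measure lebesgue (\<Inter>n. U n)"
  proof (rule Lim_measure_decseq)
    show "range U \<subseteq> sets lebesgue" using Us by auto
    show "decseq U" unfolding decseq_def U_def by (intro allI impI UN_mono) auto
    show "emeasure lebesgue (U n) \<noteq> \<infinity>" for n using fmeasurableD2[OF Um[of n]] by (simp only: infinity_ennreal_def) simp
  qed
  moreover have "\<forall>\<^sub>F n in sequentially. \<epsilon> \<le> measure lebesgue (U n)"
  proof (intro always_eventually allI)
    fix n
    have "\<epsilon> < measure lebesgue (E n)" unfolding E_def by (rule \<phi>(2))
    also have "\<dots> \<le> measure lebesgue (U n)"
      using Em[of n] Um by (intro measure_mono_fmeasurable) (auto simp: U_def)
    finally show "\<epsilon> \<le> measure lebesgue (U n)" by simp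
  qed
  ultimately have "\<epsilon> \<le> measure lebesgue (\<Inter>n. U n)" by (rule tendsto_lowerbound) simp
  moreover have "(\<Inter>n. U n) \<subseteq> {s \<in> {-R..R}. s *\<^sub>R e + \<psi> s \<in> K}"
  proof
    fix s assume s: "s \<in> (\<Inter>n. U n)"
    then have sJ: "s \<in> {-R..R}" using UJ by blast
    have "infdist (s *\<^sub>R e + \<psi> s) K < \<delta>" if "0 < \<delta>" for \<delta>
    proof -
      obtain N where N: "\<And>n. N \<le> n \<Longrightarrow> norm (\<phi> (k n) s - \<psi> s) < \<delta> / 2" using \<psi>(3)[of "\<delta> / 2"] \<open>0 < \<delta>\<close> sJ by auto
      obtain N' where N': "1 / real (Suc N') < \<delta> / 2" using nat_approx_posE[of "\<delta> / 2"] \<open>0 < \<delta>\<close> by (metis half_gt_zero)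
      have "s \<in> U (max N N')" using s by blast
      then obtain j where j: "max N N' \<le> j" "s \<in> E j" by (auto simp: U_def)
      then obtain p where p: "p \<in> K" "dist p (s *\<^sub>R e + \<phi> (k j) s) < 1 / Suc (k j)"
        unfolding E_def G_def UN_iff mem_ball mem_Collect_eq by blast
      have "N' \<le> k j" using j(1) seq_suble[OF \<psi>(2), of j] by linarith
      then have "1 / real (Suc (k j)) \<le> 1 / real (Suc N')" by (simp add: frac_le)
      then have "dist p (s *\<^sub>R e + \<phi> (k j) s) < \<delta> / 2" using p(2) N' by linarith
      moreover have "dist (s *\<^sub>R e + \<phi> (k j) s) (s *\<^sub>R e + \<psi> s) < \<delta> / 2"
        using N[of j] j(1) by (simp add: dist_norm)
      ultimately have "dist p (s *\<^sub>R e + \<psi> s) < \<delta>"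
        using dist_triangle[of p "s *\<^sub>R e + \<psi> s" "s *\<^sub>R e + \<phi> (k j) s"] by linarith
      then show ?thesis using infdist_le[OF p(1), of "s *\<^sub>R e + \<psi> s"] by (simp add: dist_commute)
    qed
    then have "infdist (s *\<^sub>R e + \<psi> s) K \<le> 0" by (meson linorder_not_less order_less_irrefl)
    then have "infdist (s *\<^sub>R e + \<psi> s) K = 0" using infdist_nonneg[of "s *\<^sub>R e + \<psi> s" K] by linarith
    moreover have "K \<noteq> {}" using \<open>s \<in> (\<Inter>n. U n)\<close> by (auto simp: U_def E_def G_def)
    ultimately have "s *\<^sub>R e + \<psi> s \<in> K" using in_closed_iff_infdist_zero[of K] compact_imp_closed[OF K(1)] by blast
    then show "s \<in> {s \<in> {-R..R}. s *\<^sub>R e + \<psi> s \<in> K}" using sJ by blast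
  qed
  then have "negligible (\<Inter>n. U n)" by (rule negligible_subset[OF null])
  ultimately show False using \<open>0 < \<epsilon>\<close> by (simp add: negligible_imp_measure0)
qed

section \<open>Typical functions on purely unrectifiable sets\<close>

text \<open>Write y - x = a e + w with a \<ge> 0. Along \<open>e\<close> the potential grows by
  between 0 and a, so the shift only compresses; across \<open>e\<close> it changes by at most |w|
  \<delta>. The new e-component is thus at most a + |w| \<delta> in modulus.\<close>

lemma potential_shift_lipschitz:
  fixes g :: "'a::euclidean_space \<Rightarrow> real"
  assumes e: "norm e = 1" and "0 < \<delta>"
    and mono: "\<And>x t. 0 \<le> t \<Longrightarrow> g x \<le> g (x + t *\<^sub>R e)"
    and up: "\<And>x t. 0 \<le> t \<Longrightarrow> g (x + t *\<^sub>R e) \<le> g x + t"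
    and side: "\<And>x w. w \<bullet> e = 0 \<Longrightarrow> g (x + w) \<le> g x + norm w * \<delta>"
  shows "(1 + \<delta>)-lipschitz_on UNIV (\<lambda>x. x - g x *\<^sub>R e)"
proof (rule lipschitz_onI)
  have ee: "e \<bullet> e = 1" using e by (simp add: norm_eq_1)
  have main: "norm ((y - g y *\<^sub>R e) - (x - g x *\<^sub>R e)) \<le> (1 + \<delta>) * norm (y - x)" if "0 \<le> (y - x) \<bullet> e" for x y
  proof -
    define a w where "a = (y - x) \<bullet> e" and "w = (y - x) - a *\<^sub>R e"
    have a: "0 \<le> a" using that by (simp add: a_def)
    have w: "w \<bullet> e = 0" using ee by (simp add: w_def a_def inner_diff_left)
    have y: "y = (x + w) + a *\<^sub>R e" by (simp add: w_def)
    define q where "q = a - (g y - g x)"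
    have "g (x + w) \<le> g y" "g y \<le> g (x + w) + a" using mono[OF a, of "x + w"] up[OF a, of "x + w"] y by auto
    moreover have "g (x + w) \<le> g x + norm w * \<delta>" using side[OF w] .
    moreover have "g x \<le> g (x + w) + norm w * \<delta>" using side[of "- w" "x + w"] w by simp
    ultimately have q: "\<bar>q\<bar> \<le> a + norm w * \<delta>" using a unfolding q_def by linarith
    have pyth: "(norm (c *\<^sub>R e + w))\<^sup>2 = c\<^sup>2 + (norm w)\<^sup>2" for c
      unfolding power2_norm_eq_inner using w ee by (simp add: inner_add_left inner_add_right inner_commute[of e w] power2_eq_square)
    have yx: "y - x = a *\<^sub>R e + w" by (simp add: w_def)
    define n where "n = norm (y - x)"
    have n2: "n\<^sup>2 = a\<^sup>2 + (norm w)\<^sup>2" unfolding n_def yx by (rule pyth)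
    have n0: "0 \<le> n" by (simp add: n_def)
    have an: "a \<le> n" "norm w \<le> n"
      using power2_le_imp_le[OF _ n0, of a] power2_le_imp_le[OF _ n0, of "norm w"] n2 by simp_all
    have eq: "(y - g y *\<^sub>R e) - (x - g x *\<^sub>R e) = q *\<^sub>R e + w"
      unfolding q_def by (simp add: y algebra_simps)
    have "norm (q *\<^sub>R e + w) \<le> (1 + \<delta>) * n"
    proof (rule power2_le_imp_le)
      have "q\<^sup>2 \<le> (a + norm w * \<delta>)\<^sup>2" using q by (simp add: abs_le_square_iff[symmetric])
      then have "(norm (q *\<^sub>R e + w))\<^sup>2 \<le> (a + norm w * \<delta>)\<^sup>2 + (norm w)\<^sup>2" by (simp add: pyth)
      also have "\<dots> = n\<^sup>2 + 2 * \<delta> * (a * norm w) + \<delta>\<^sup>2 * (norm w)\<^sup>2"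
        unfolding n2 by (simp add: power2_eq_square algebra_simps)
      also have "\<dots> \<le> n\<^sup>2 + 2 * \<delta> * (n * n) + \<delta>\<^sup>2 * n\<^sup>2"
        using an a \<open>0 < \<delta>\<close> by (intro add_mono mult_left_mono mult_mono power_mono) auto
      also have "\<dots> = ((1 + \<delta>) * n)\<^sup>2" by (simp add: power2_eq_square algebra_simps)
      finally show "(norm (q *\<^sub>R e + w))\<^sup>2 \<le> ((1 + \<delta>) * n)\<^sup>2" .
      show "0 \<le> (1 + \<delta>) * n" using \<open>0 < \<delta>\<close> by (simp add: n_def)
    qed
    then show ?thesis unfolding eq n_def .
  qed
  show "dist (x - g x *\<^sub>R e) (y - g y *\<^sub>R e) \<le> (1 + \<delta>) * dist x y" for x y
  proof (cases "0 \<le> (y - x) \<bullet> e")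
    case True
    then show ?thesis using main[of y x] by (simp only: dist_norm norm_minus_commute)
  next
    case False
    then have "0 \<le> (x - y) \<bullet> e" by (simp add: inner_diff_left)
    then show ?thesis using main[of x y] by (simp only: dist_norm)
  qed
qed (use \<open>0 < \<delta>\<close> in simp)

text \<open>The single parameter bounds both length and slope: escaping these sets for all
  \<open>1 / Suc n\<close> gives, at each point of \<open>K\<close>, arbitrarily short steps along
  \<open>e\<close> with arbitrarily small difference quotients.\<close>

definition steep_along :: "'a::euclidean_space \<Rightarrow> real \<Rightarrow> 'a set \<Rightarrow> ('a \<Rightarrow> real) set" where
  "steep_along e d K = {f. \<exists>x\<in>K. \<forall>t. 0 < t \<longrightarrow> t < d \<longrightarrow> x + t *\<^sub>R e \<in> cbox 0 One \<longrightarrow>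
      d * t \<le> \<bar>f (x + t *\<^sub>R e) - f x\<bar>}"

text \<open>Composing with \<open>x \<mapsto> x - g x e\<close>, where \<open>g\<close> is a small potential growing at unit speed
  along \<open>e\<close> near \<open>K\<close>, makes a function constant on short segments in direction \<open>e\<close> through \<open>K\<close>.\<close>
lemma avoidable_steep_along:
  fixes K :: "'a::euclidean_space set"
  assumes K: "compact K" "K \<subseteq> box 0 One" "purely_unrectifiable K" and e: "norm e = 1" and "0 < d"
  shows "avoidable (steep_along e d K)"
  unfolding avoidable_def
proof (intro allI impI)
  fix f :: "'a \<Rightarrow> real" and \<epsilon> :: real
  let ?Q = "cbox 0 One :: 'a set"
  assume lip: "1-lipschitz_on ?Q f" and "0 < \<epsilon>"
  obtain B where B: "0 < B" "\<And>y. y \<in> ?Q \<Longrightarrow> \<bar>f y\<bar> \<le> B" using lipschitz_bounded_cube[OF lip] by blast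
  obtain \<delta> where \<delta>: "0 < \<delta>" "\<delta> < 1" "\<delta> * B \<le> \<epsilon> / 2"
    using small_factor[OF B(1) \<open>0 < \<epsilon>\<close>] by blast
  obtain F where F: "1-lipschitz_on UNIV F" "\<And>y. y \<in> ?Q \<Longrightarrow> F y = f y"
    using lipschitz_extend_real[OF lip] by blast
  \<comment> \<open>Graphs of slope up to 1/\<delta> make the potential change across
    \<open>e\<close> at rate at most \<delta>.\<close>
  have \<alpha>: "0 < 1 / \<delta>" "0 < \<epsilon> / 2" using \<delta>(1) \<open>0 < \<epsilon>\<close> by auto
  obtain r where r: "0 < r" "\<And>\<phi>. \<phi> \<in> transversal e (1 / \<delta>) \<Longrightarrow>
      measure lebesgue {s. s *\<^sub>R e + \<phi> s \<in> (\<Union>k\<in>K. ball k r)} \<le> \<epsilon> / 2"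
    using transversal_thin_neighbourhood[OF K(1,3) e \<alpha>] by blast
  define G where "G = (\<Union>k\<in>K. ball k r)"
  have "open G" unfolding G_def by blast
  have "bounded G"
  proof -
    obtain R where R: "\<And>k. k \<in> K \<Longrightarrow> norm k \<le> R" using K(1) compact_imp_bounded bounded_iff by metis
    have "norm y \<le> R + r" if "y \<in> G" for y
    proof -
      obtain k where "k \<in> K" "dist k y < r" using \<open>y \<in> G\<close> unfolding G_def UN_iff mem_ball by blast
      then show ?thesis using R[of k] norm_triangle_sub[of y k] by (simp add: dist_norm norm_minus_commute)
    qed
    then show ?thesis unfolding bounded_iff by blast
  qed
  obtain g where g: "\<And>x. 0 \<le> g x" "\<And>x. g x \<le> \<epsilon> / 2"
    "\<And>x t. 0 \<le> t \<Longrightarrow> g x \<le> g (x + t *\<^sub>R e)" "\<And>x t. 0 \<le> t \<Longrightarrow> g (x + t *\<^sub>R e) \<le> g x + t"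
    "\<And>x t. 0 \<le> t \<Longrightarrow> (\<And>s. 0 \<le> s \<Longrightarrow> s \<le> t \<Longrightarrow> x + s *\<^sub>R e \<in> G) \<Longrightarrow> g x + t \<le> g (x + t *\<^sub>R e)"
    "\<And>x w. w \<bullet> e = 0 \<Longrightarrow> g (x + w) \<le> g x + norm w / (1 / \<delta>)"
    using transversal_potential[OF e \<alpha>(1) \<open>open G\<close> \<open>bounded G\<close> r(2)[folded G_def]] by blast
  define \<psi> where "\<psi> x = x - g x *\<^sub>R e" for x
  have \<psi>lip: "(1 + \<delta>)-lipschitz_on UNIV \<psi>"
    unfolding \<psi>_def using g(3,4,6) by (intro potential_shift_lipschitz[OF e \<delta>(1)]) auto
  \<comment> \<open>The factor 1 - \<delta> offsets the Lipschitz constant 1 + \<delta> of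
    \<psi>.\<close>
  define h where "h x = (1 - \<delta>) * F (\<psi> x)" for x
  have hlip: "1-lipschitz_on ?Q h"
  proof (rule lipschitz_onI)
    fix x y
    have "dist (F (\<psi> x)) (F (\<psi> y)) \<le> 1 * dist (\<psi> x) (\<psi> y)" by (rule lipschitz_onD[OF F(1)]) auto
    also have "dist (\<psi> x) (\<psi> y) \<le> (1 + \<delta>) * dist x y" by (rule lipschitz_onD[OF \<psi>lip]) auto
    finally have *: "dist (F (\<psi> x)) (F (\<psi> y)) \<le> (1 + \<delta>) * dist x y" by simp
    have "dist (h x) (h y) = (1 - \<delta>) * dist (F (\<psi> x)) (F (\<psi> y))"
      using \<delta>(2) by (simp add: h_def dist_real_def abs_mult flip: right_diff_distrib)
    also have "\<dots> \<le> (1 - \<delta>) * ((1 + \<delta>) * dist x y)" using * \<delta>(2) by (intro mult_left_mono) auto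
    also have "\<dots> = (1 - \<delta> * \<delta>) * dist x y" by (simp add: algebra_simps)
    also have "\<dots> \<le> 1 * dist x y" by (intro mult_right_mono) auto
    finally show "dist (h x) (h y) \<le> 1 * dist x y" .
  qed simp
  have hclose: "close_on ?Q \<epsilon> h f"
    unfolding close_on_def
  proof
    fix y assume y: "y \<in> ?Q"
    have "dist (F (\<psi> y)) (F y) \<le> 1 * dist (\<psi> y) y" by (rule lipschitz_onD[OF F(1)]) auto
    then have 1: "\<bar>F (\<psi> y) - F y\<bar> \<le> \<epsilon> / 2" using g(1,2)[of y] e by (simp add: \<psi>_def dist_norm)
    have "h y - f y = (1 - \<delta>) * (F (\<psi> y) - F y) - \<delta> * f y" by (simp add: h_def F(2)[OF y] algebra_simps)
    then have "\<bar>h y - f y\<bar> \<le> \<bar>(1 - \<delta>) * (F (\<psi> y) - F y)\<bar> + \<bar>\<delta> * f y\<bar>" by linarith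
    also have "\<bar>(1 - \<delta>) * (F (\<psi> y) - F y)\<bar> \<le> 1 * (\<epsilon> / 2)"
      unfolding abs_mult using 1 \<delta> by (intro mult_mono) auto
    also have "\<bar>\<delta> * f y\<bar> \<le> \<delta> * B" using B(2)[OF y] \<delta>(1) by (simp add: abs_mult)
    finally show "\<bar>h y - f y\<bar> \<le> \<epsilon>" using \<delta>(3) by linarith
  qed
  obtain \<rho> where \<rho>: "\<rho> > 0" "(\<Union>x\<in>K. cball x \<rho>) \<subseteq> box 0 One"
    using compact_subset_open_imp_cball_epsilon_subset[OF K(1) open_box K(2)] by blast
  \<comment> \<open>One step length refutes steepness at all points of \<open>K\<close> at once: the
    segment stays in \<open>G\<close> and in the cube, \<open>h\<close> agrees at its ends, and two
    errors of d t / 4 remain below d t.\<close>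
  define t where "t = min (d / 2) (min (r / 2) \<rho>)"
  have t: "0 < t" "t < d" "t < r" "t \<le> \<rho>" using \<open>0 < d\<close> r(1) \<rho>(1) by (auto simp: t_def min_less_iff_disj)
  have "restrict k ?Q \<notin> steep_along e d K" if kh: "close_on ?Q (d * t / 4) k h" for k
  proof
    assume "restrict k ?Q \<in> steep_along e d K"
    then obtain x where x: "x \<in> K" "\<And>t. 0 < t \<Longrightarrow> t < d \<Longrightarrow> x + t *\<^sub>R e \<in> ?Q \<Longrightarrow>
        d * t \<le> \<bar>restrict k ?Q (x + t *\<^sub>R e) - restrict k ?Q x\<bar>"
      unfolding steep_along_def by blast
    have "x + t *\<^sub>R e \<in> cball x \<rho>" using t e by (simp add: dist_norm)
    then have "x + t *\<^sub>R e \<in> box 0 One" using x(1) \<rho>(2) by blast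
    then have Q: "x + t *\<^sub>R e \<in> ?Q" "x \<in> ?Q" using x(1) K(2) box_subset_cbox by blast+
    have "x + s *\<^sub>R e \<in> G" if "0 \<le> s" "s \<le> t" for s
      unfolding G_def using x(1) that t(3) e by (intro UN_I[of x]) (auto simp: dist_norm)
    then have "g (x + t *\<^sub>R e) = g x + t" using g(4,5)[of t x] t(1) by (intro antisym) auto
    then have "\<psi> (x + t *\<^sub>R e) = \<psi> x" by (simp add: \<psi>_def scaleR_add_left)
    then have "h (x + t *\<^sub>R e) = h x" by (simp add: h_def)
    moreover have "\<bar>k (x + t *\<^sub>R e) - h (x + t *\<^sub>R e)\<bar> \<le> d * t / 4" "\<bar>k x - h x\<bar> \<le> d * t / 4"
      using kh Q by (auto simp: close_on_def)
    moreover have "d * t \<le> \<bar>k (x + t *\<^sub>R e) - k x\<bar>" using x(2)[OF t(1,2) Q(1)] Q by simp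
    moreover have "0 < d * t" using \<open>0 < d\<close> t(1) by simp
    ultimately show False by linarith
  qed
  moreover have "0 < d * t / 4" using \<open>0 < d\<close> t(1) by simp
  ultimately show "\<exists>h \<eta>. 1-lipschitz_on ?Q h \<and> 0 < \<eta> \<and> close_on ?Q \<epsilon> h f \<and>
        (\<forall>k. 1-lipschitz_on ?Q k \<longrightarrow> close_on ?Q \<eta> k h \<longrightarrow> restrict k ?Q \<notin> steep_along e d K)"
    using hlip hclose by blast
qed

text \<open>Small quotients along every basis vector force the derivative to be 0, whereas quotients
  above 1/2 occur at arbitrarily small distances.\<close>

lemma not_differentiable_if_flat_and_steep:
  fixes f :: "'a::euclidean_space \<Rightarrow> real"
  assumes x: "x \<in> K" "K \<subseteq> box 0 One"
    and level: "\<And>b n. b \<in> Basis \<Longrightarrow> f \<notin> steep_along b (1 / Suc n) K"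
    and steep: "\<And>n. f \<notin> flat_somewhere (1 / Suc n)"
  shows "\<not> f differentiable (at x)"
proof
  assume "f differentiable (at x)"
  then obtain D where D: "(f has_derivative D) (at x)" by (auto simp: differentiable_def)
  then have lin: "linear D" by (rule has_derivative_linear)
  have alt: "\<exists>d>0. \<forall>y. norm (y - x) < d \<longrightarrow> \<bar>f y - f x - D (y - x)\<bar> \<le> \<epsilon> * norm (y - x)" if "0 < \<epsilon>" for \<epsilon>
    using D that unfolding has_derivative_at_alt real_norm_def by blast
  have "D b = 0" if b: "b \<in> Basis" for b
  proof -
    have "\<bar>D b\<bar> \<le> 0 + \<epsilon>" if "0 < \<epsilon>" for \<epsilon>
    proof -
      have "0 < \<epsilon> / 2" using \<open>0 < \<epsilon>\<close> by simp
      then obtain d where d: "d > 0" "\<And>y. norm (y - x) < d \<Longrightarrow> \<bar>f y - f x - D (y - x)\<bar> \<le> \<epsilon> / 2 * norm (y - x)"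
        using alt by blast
      have "0 < min d (\<epsilon> / 2)" using d(1) \<open>0 < \<epsilon>\<close> by simp
      then obtain n where n: "1 / real (Suc n) < min d (\<epsilon> / 2)" using nat_approx_posE by blast
      obtain t where t: "0 < t" "t < 1 / Suc n" "\<bar>f (x + t *\<^sub>R b) - f x\<bar> < 1 / Suc n * t"
        using level[OF b, of n] x(1) unfolding steep_along_def mem_Collect_eq by (meson not_le)
      have "norm (x + t *\<^sub>R b - x) = t" using b t(1) by simp
      then have "\<bar>f (x + t *\<^sub>R b) - f x - t * D b\<bar> \<le> \<epsilon> / 2 * t"
        using d(2)[of "x + t *\<^sub>R b"] t(2) n linear_scale[OF lin, of t b] by simp
      moreover have "1 / Suc n * t \<le> \<epsilon> / 2 * t" using n t(1) by (intro mult_right_mono) auto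
      ultimately have "\<bar>t * D b\<bar> \<le> \<epsilon> / 2 * t + \<epsilon> / 2 * t" using t(3) by linarith
      then have "t * \<bar>D b\<bar> \<le> t * \<epsilon>" using t(1) by (simp add: abs_mult mult.commute)
      then show ?thesis using t(1) by simp
    qed
    then have "\<bar>D b\<bar> \<le> 0" by (rule field_le_epsilon)
    then show ?thesis by simp
  qed
  then have D0: "D w = 0" for w
    using linear_eq_stdbasis[OF lin, of "\<lambda>_. 0"] by (metis linear_zero)
  obtain d where d: "d > 0" "\<And>y. norm (y - x) < d \<Longrightarrow> \<bar>f y - f x\<bar> \<le> 1 / 4 * norm (y - x)"
    using alt[of "1 / 4"] by (auto simp: D0)
  obtain n where n: "1 / real (Suc n) < d" using nat_approx_posE[OF d(1)] by blast
  have "x \<in> cbox 0 One" using x box_subset_cbox by blast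
  then obtain y where y: "y \<noteq> x" "dist x y < 1 / Suc n" "dist x y / 2 < \<bar>f y - f x\<bar>"
    using steep[of n] unfolding flat_somewhere_def mem_Collect_eq by (meson not_le)
  then have "\<bar>f y - f x\<bar> \<le> 1 / 4 * dist x y"
    using d(2)[of y] n by (simp add: dist_norm norm_minus_commute)
  then show False using y(3) zero_le_dist[of x y] by linarith
qed

section \<open>Nowhere dense sets in the metric space of 1-Lipschitz functions\<close>

lemma mspace_Lip1: "f \<in> mspace Lip1_metric \<longleftrightarrow> f \<in> extensional (cbox 0 One) \<and> 1-lipschitz_on (cbox 0 One) f"
proof -
  have "Met_TC.mbounded (f ` cbox 0 One)" if L: "1-lipschitz_on (cbox 0 One) f"
  proof -
    obtain B where "\<And>y. y \<in> cbox 0 One \<Longrightarrow> \<bar>f y\<bar> \<le> B" using lipschitz_bounded_cube[OF L] by blast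
    then have "bounded (f ` cbox 0 One)" by (auto simp: bounded_iff)
    then show ?thesis by (simp add: mbounded_iff_bounded)
  qed
  then show ?thesis by (auto simp: Lip1_metric_def Met_TC.fspace_def)
qed

lemma mdist_Lip1_le:
  assumes "f \<in> mspace Lip1_metric" "g \<in> mspace Lip1_metric"
  shows "mdist Lip1_metric f g \<le> a \<longleftrightarrow> close_on (cbox 0 One) a f g"
proof -
  have "f \<in> mspace (funspace (cbox 0 One) euclidean_metric)" "g \<in> mspace (funspace (cbox 0 One) euclidean_metric)"
    using assms unfolding Lip1_metric_def mspace_submetric by blast+
  moreover have "cbox 0 One \<noteq> ({} :: 'a set)" by simp
  ultimately show ?thesis
    using funspace_mdist_le[of f "cbox 0 One" euclidean_metric g a]
    unfolding Lip1_metric_def mdist_submetric close_on_def by (simp add: dist_real_def)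
qed

text \<open>Outside the closure of \<open>M\<close> there are balls missing \<open>M\<close>. Radii
  are halved because \<open>close_on\<close> is a non-strict bound and metric balls are open;
  \<open>restrict\<close> passes to the extensional representatives.\<close>

lemma nowhere_dense_Lip1_iff:
  assumes M: "M \<subseteq> mspace Lip1_metric"
  shows "nowhere_dense_in Lip1_topology M \<longleftrightarrow> avoidable M"
proof -
  let ?Q = "cbox 0 One :: 'a set"
  interpret L: Metric_space "mspace (Lip1_metric :: ('a \<Rightarrow> real) metric)" "mdist Lip1_metric"
    by (rule Metric_space_mspace_mdist)
  have top: "Lip1_topology = L.mtopology" by (simp add: Lip1_topology_def mtopology_of_def)
  have res: "restrict f ?Q \<in> mspace Lip1_metric" if "1-lipschitz_on ?Q f" for f
  proof -
    have "1-lipschitz_on ?Q (restrict f ?Q)" using that by (simp add: lipschitz_on_def)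
    then show ?thesis by (simp add: mspace_Lip1)
  qed
  have ball: "g \<in> L.mball f r" if "f \<in> mspace Lip1_metric" "g \<in> mspace Lip1_metric" "close_on ?Q (r / 2) f g" "0 < r" for f g r
    using mdist_Lip1_le[OF that(1,2), of "r / 2"] that by simp
  show ?thesis
  proof
    assume nd: "nowhere_dense_in Lip1_topology M"
    show "avoidable M"
      unfolding avoidable_def
    proof (intro allI impI)
      fix f :: "'a \<Rightarrow> real" and \<epsilon> :: real assume f: "1-lipschitz_on ?Q f" and "0 < \<epsilon>"
      let ?f = "restrict f ?Q"
      have fm: "?f \<in> L.mball ?f \<epsilon>" using res[OF f] \<open>0 < \<epsilon>\<close> by simp
      have "\<not> L.mball ?f \<epsilon> \<subseteq> L.mtopology closure_of M"
      proof
        assume "L.mball ?f \<epsilon> \<subseteq> L.mtopology closure_of M"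
        then have "L.mball ?f \<epsilon> \<subseteq> L.mtopology interior_of (L.mtopology closure_of M)"
          by (rule interior_of_maximal) (rule L.openin_mball)
        then show False using nd fm unfolding nowhere_dense_in_def top by blast
      qed
      then obtain h where h: "h \<in> L.mball ?f \<epsilon>" "h \<notin> L.mtopology closure_of M" by blast
      then have hL: "h \<in> mspace Lip1_metric" by simp
      obtain \<eta> where \<eta>: "0 < \<eta>" "\<And>k. k \<in> M \<Longrightarrow> k \<notin> L.mball h \<eta>"
        using h(2) hL unfolding L.metric_closure_of by blast
      show "\<exists>h \<eta>. 1-lipschitz_on ?Q h \<and> 0 < \<eta> \<and> close_on ?Q \<epsilon> h f \<and>
          (\<forall>k. 1-lipschitz_on ?Q k \<longrightarrow> close_on ?Q \<eta> k h \<longrightarrow> restrict k ?Q \<notin> M)"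
      proof (intro exI conjI allI impI)
        show "1-lipschitz_on ?Q h" using hL by (simp add: mspace_Lip1)
        show "0 < \<eta> / 2" using \<eta>(1) by simp
        have "close_on ?Q \<epsilon> ?f h"
          using h(1) mdist_Lip1_le[OF res[OF f] hL, of \<epsilon>] by simp
        then show "close_on ?Q \<epsilon> h f" by (auto simp: close_on_def abs_minus_commute)
        fix k assume k: "1-lipschitz_on ?Q k" "close_on ?Q (\<eta> / 2) k h"
        have "close_on ?Q (\<eta> / 2) h (restrict k ?Q)" using k(2) by (auto simp: close_on_def abs_minus_commute)
        then have "restrict k ?Q \<in> L.mball h \<eta>" using ball[OF hL res[OF k(1)]] \<eta>(1) by simp
        then show "restrict k ?Q \<notin> M" using \<eta>(2) by blast
      qed
    qed
  next
    assume av: "avoidable M"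
    have "L.mtopology interior_of (L.mtopology closure_of M) = {}"
    proof (rule ccontr)
      assume "L.mtopology interior_of (L.mtopology closure_of M) \<noteq> {}"
      then obtain f where f: "f \<in> L.mtopology interior_of (L.mtopology closure_of M)" by blast
      then obtain \<epsilon> where \<epsilon>: "0 < \<epsilon>" "L.mball f \<epsilon> \<subseteq> L.mtopology interior_of (L.mtopology closure_of M)"
        using openin_interior_of[of L.mtopology "L.mtopology closure_of M"] unfolding L.openin_mtopology by blast
      have fL: "f \<in> mspace Lip1_metric"
        using f interior_of_subset_topspace[of L.mtopology] by (auto simp: L.topspace_mtopology)
      have fe: "1-lipschitz_on ?Q f" "0 < \<epsilon> / 2" using fL \<epsilon>(1) by (simp_all add: mspace_Lip1)
      obtain h \<eta> where h: "1-lipschitz_on ?Q h" "0 < \<eta>" "close_on ?Q (\<epsilon> / 2) h f"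
        "\<And>k. 1-lipschitz_on ?Q k \<Longrightarrow> close_on ?Q \<eta> k h \<Longrightarrow> restrict k ?Q \<notin> M"
        using av[unfolded avoidable_def, rule_format, OF fe] by blast
      let ?h = "restrict h ?Q"
      have "close_on ?Q (\<epsilon> / 2) f ?h" using h(3) by (auto simp: close_on_def abs_minus_commute)
      then have "?h \<in> L.mball f \<epsilon>" using ball[OF fL res[OF h(1)]] \<epsilon>(1) by simp
      then have "?h \<in> L.mtopology closure_of M" 
        using subset_trans[OF \<epsilon>(2) interior_of_subset] by (meson subsetD)
      then obtain k where k: "k \<in> M" "k \<in> L.mball ?h \<eta>" using h(2) unfolding L.metric_closure_of by blast
      have kL: "k \<in> mspace Lip1_metric" using k(1) M by blast
      have "close_on ?Q \<eta> ?h k" using k(2) mdist_Lip1_le[OF res[OF h(1)] kL, of \<eta>] by simp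
      then have "close_on ?Q \<eta> k h" by (auto simp: close_on_def abs_minus_commute)
      moreover have "restrict k ?Q = k" using kL by (simp add: mspace_Lip1 extensional_restrict)
      ultimately show False using h(4)[of k] kL k(1) by (simp add: mspace_Lip1)
    qed
    then show "nowhere_dense_in Lip1_topology M" using M by (simp add: nowhere_dense_in_def top L.topspace_mtopology)
  qed
qed

lemma avoidable_subset: "avoidable M \<Longrightarrow> N \<subseteq> M \<Longrightarrow> avoidable N"
  unfolding avoidable_def by (meson subsetD)

lemma topspace_Lip1: "topspace Lip1_topology = mspace Lip1_metric"
  by (simp add: Lip1_topology_def)

theorem theorem2p2:
  fixes A :: "'a::euclidean_space set"
  assumes "A \<subseteq> box 0 One"
    and "analytic_set A"
  shows "(\<exists>P. A \<subseteq> P \<and> fsigma_in euclidean P \<and> purely_unrectifiable P) \<longleftrightarrow>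
         residual_in Lip1_topology
           {f \<in> topspace (Lip1_topology :: ('a \<Rightarrow> real) topology).
              \<forall>x\<in>A. \<not> f differentiable (at x)}"
proof
  let ?L = "mspace (Lip1_metric :: ('a \<Rightarrow> real) metric)"
  define T where "T = {f \<in> ?L. \<exists>x\<in>A. f differentiable (at x)}"
  have T_eq: "topspace Lip1_topology - {f \<in> topspace (Lip1_topology :: ('a \<Rightarrow> real) topology).
      \<forall>x\<in>A. \<not> f differentiable (at x)} = T"
    unfolding T_def topspace_Lip1 by blast
  {
    assume "\<exists>P. A \<subseteq> P \<and> fsigma_in euclidean P \<and> purely_unrectifiable P"
    then obtain P where P: "A \<subseteq> P" "fsigma_in euclidean P" "purely_unrectifiable P" by blast
    obtain \<C> where \<C>0: "countable \<C>" "\<C> \<subseteq> Collect (closedin euclidean)" "\<Union>\<C> = P"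
      using P(2) unfolding fsigma_in_def union_of_def by blast
    then have \<C>: "countable \<C>" "\<And>C. C \<in> \<C> \<Longrightarrow> closed C" "\<Union>\<C> = P"
      unfolding closed_closedin by blast+
    \<comment> \<open>The closed parts of \<open>P\<close> may be non-compact and leave the cube;
      cut with a compact exhaustion of the open cube they become countably many compact pieces that
      still cover \<open>A\<close>.\<close>
    obtain B where B: "\<And>n::nat. compact (B n)" "\<And>n. B n \<subseteq> box 0 (One::'a)" "\<Union>(range B) = box 0 One"
      by (rule open_Union_compact_subsets[OF open_box[of 0 "One::'a"]]) blast
    define \<K> where "\<K> = (\<lambda>(C, n). C \<inter> B n) ` (\<C> \<times> UNIV)"
    have \<K>: "countable \<K>" "\<And>K. K \<in> \<K> \<Longrightarrow> compact K \<and> K \<subseteq> box 0 One \<and> purely_unrectifiable K"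
    proof -
      show "countable \<K>" unfolding \<K>_def using \<C>(1) by (intro countable_image countable_SIGMA) auto
      fix K assume "K \<in> \<K>"
      then obtain C n where K: "K = C \<inter> B n" "C \<in> \<C>" by (auto simp: \<K>_def)
      have "compact K" unfolding K(1) using closed_Int_compact[OF \<C>(2)[OF K(2)] B(1)] .
      moreover have "K \<subseteq> box 0 One" unfolding K(1) using B(2) by blast
      moreover have "purely_unrectifiable K"
        by (rule purely_unrectifiable_subset[OF P(3)]) (use K \<C>(3) in auto)
      ultimately show "compact K \<and> K \<subseteq> box 0 One \<and> purely_unrectifiable K" by blast
    qed
    define \<N> where "\<N> = range (\<lambda>n::nat. flat_somewhere (1 / Suc n)) \<union>
        (\<lambda>(b, n::nat, K). steep_along b (1 / Suc n) K) ` (Basis \<times> UNIV \<times> \<K>)"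
    have "countable (Basis \<times> (UNIV::nat set) \<times> \<K>)"
      using \<K>(1) by (intro countable_SIGMA) (auto intro: countable_finite)
    then have "countable \<N>" unfolding \<N>_def by blast
    have av: "avoidable N" if "N \<in> \<N>" for N
    proof -
      consider n where "N = flat_somewhere (1 / Suc n)"
        | b n K where "N = steep_along b (1 / Suc n) K" "b \<in> Basis" "K \<in> \<K>"
        using \<open>N \<in> \<N>\<close> unfolding \<N>_def by (auto simp del: of_nat_Suc)
      then show ?thesis
      proof cases
        case 1
        show ?thesis unfolding 1 by (rule avoidable_flat_somewhere) simp
      next
        case 2
        show ?thesis unfolding 2(1)
          by (rule avoidable_steep_along) (use \<K>(2)[OF 2(3)] 2(2) in simp_all)
      qed
    qed
    have "T \<subseteq> \<Union>\<N>"
    proof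
      fix f assume "f \<in> T"
      then obtain x where x: "x \<in> A" "f differentiable (at x)" by (auto simp: T_def)
      have "x \<in> \<Union>\<C>" "x \<in> \<Union>(range B)" using x(1) P(1) \<C>(3) B(3) assms(1) by blast+
      then obtain K where K: "K \<in> \<K>" "x \<in> K" by (auto simp: \<K>_def)
      show "f \<in> \<Union>\<N>"
      proof (rule ccontr)
        assume nf: "f \<notin> \<Union>\<N>"
        have "f \<notin> steep_along b (1 / Suc n) K" if "b \<in> Basis" for b n
        proof -
          have "steep_along b (1 / Suc n) K \<in> \<N>"
            unfolding \<N>_def using that K(1) by (intro UnI2 image_eqI[of _ _ "(b, n, K)"]) auto
          then show ?thesis using nf by blast
        qed
        moreover have "f \<notin> flat_somewhere (1 / Suc n)" for n
        proof -
          have "flat_somewhere (1 / Suc n) \<in> \<N>" unfolding \<N>_def by blast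
          then show ?thesis using nf by blast
        qed
        ultimately show False
          using not_differentiable_if_flat_and_steep[of x K f] K \<K>(2)[OF K(1)] x(2) by blast
      qed
    qed
    \<comment> \<open>\<open>meagre_in\<close> asks for an exact union, so the avoidable sets are
      cut down to \<open>T\<close>.\<close>
    then have "T = \<Union>((\<inter>) T ` \<N>)" by blast
    moreover have "nowhere_dense_in Lip1_topology (T \<inter> N)" if "N \<in> \<N>" for N
    proof -
      have "T \<inter> N \<subseteq> ?L" by (auto simp: T_def)
      then show ?thesis using nowhere_dense_Lip1_iff avoidable_subset[OF av[OF that]] by blast
    qed
    ultimately have "meagre_in Lip1_topology T"
      unfolding meagre_in_def union_of_def using \<open>countable \<N>\<close>
      by (intro exI[of _ "(\<inter>) T ` \<N>"]) auto
    then show "residual_in Lip1_topology {f \<in> topspace (Lip1_topology :: ('a \<Rightarrow> real) topology).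
              \<forall>x\<in>A. \<not> f differentiable (at x)}"
      unfolding residual_in_def T_eq by blast
  }
  {
    assume "residual_in Lip1_topology {f \<in> topspace (Lip1_topology :: ('a \<Rightarrow> real) topology).
              \<forall>x\<in>A. \<not> f differentiable (at x)}"
    then have "meagre_in Lip1_topology T" unfolding residual_in_def T_eq by blast
    then obtain \<U> where \<U>0: "countable \<U>" "\<U> \<subseteq> Collect (nowhere_dense_in Lip1_topology)" "\<Union>\<U> = T"
      unfolding meagre_in_def union_of_def by blast
    then have \<U>: "countable \<U>" "\<And>U. U \<in> \<U> \<Longrightarrow> nowhere_dense_in Lip1_topology U" "\<Union>\<U> = T" by auto
    have av: "avoidable U" if "U \<in> insert {} \<U>" for U
    proof (cases "U = {}")
      case True
      then show ?thesis using nowhere_dense_Lip1_iff[of U] by (simp add: nowhere_dense_in_def)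
    next
      case False
      then have "nowhere_dense_in Lip1_topology U" using \<U>(2) that by blast
      moreover have "U \<subseteq> ?L" using calculation by (simp add: nowhere_dense_in_def topspace_Lip1)
      ultimately show ?thesis using nowhere_dense_Lip1_iff by blast
    qed
    \<comment> \<open>The added empty set makes the family nonempty, so it can be enumerated even
      when \<U> is empty.\<close>
    define M where "M = from_nat_into (insert {} \<U>)"
    have M: "avoidable (M n)" for n unfolding M_def by (rule av, rule from_nat_into) simp
    have cov: "\<exists>n. U = M n" if "U \<in> \<U>" for U
      unfolding M_def using from_nat_into_surj[of "insert {} \<U>" U] \<U>(1) that by auto
    show "\<exists>P. A \<subseteq> P \<and> fsigma_in euclidean P \<and> purely_unrectifiable P"
    proof (rule ccontr)
      assume nocover: "\<nexists>P. A \<subseteq> P \<and> fsigma_in euclidean P \<and> purely_unrectifiable P"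
      \<comment> \<open>The empty set covers itself, so \<open>A\<close> is nonempty and has a
        parametrisation by the Baire space.\<close>
      have "fsigma_in euclidean ({} :: 'a set)" "purely_unrectifiable ({} :: 'a set)"
        by (simp_all add: purely_unrectifiable_def)
      then have "A \<noteq> {}" using nocover by blast
      then obtain g :: "(nat \<Rightarrow> nat) \<Rightarrow> 'a" where g: "continuous_on UNIV g" "range g = A"
        using assms(2) unfolding analytic_set_def by blast
      obtain f x where f: "1-lipschitz_on (cbox 0 One) f" "\<And>n. restrict f (cbox 0 One) \<notin> M n"
        "x \<in> A" "restrict f (cbox 0 One) differentiable (at x)"
        by (rule avoidable_sequence_missed[where M = M, OF assms(1) g nocover M]) (rule that)
      have "1-lipschitz_on (cbox 0 One) (restrict f (cbox 0 One))" using f(1) by (simp add: lipschitz_on_def)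
      then have "restrict f (cbox 0 One) \<in> T" using f(3,4) by (auto simp: T_def mspace_Lip1)
      then show False using \<U>(3) cov f(2) by blast
    qed
  }
qed

end
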